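(* Let $d\ge2$ and let $D\subset\mathbb R^d$ be bounded. Suppose there exist $\theta\in(0,1)$ and $p,q\in[1,\infty]$ such that Assumptions (Law), (Cluster) (with parameter $\theta$) and (Moments) (with parameters $\theta,p,q$) hold. Then there exist constants $C_3,C_4<\infty$, depending only on $r_D,\theta,d,p,q$, such that for $\mathbb P_0$-a.e. $\omega$, any $n\ge N_3(\omega,C_{\mathrm d}r_D)$ and any $x,y\in D$ with $x\ne y$, $$n^{d-2}g^\omega_{nD}(\lfloor nx\rfloor,\lfloor ny\rfloor)\le\begin{cases}2C_{\mathrm{HK}}\log\Big(\dfrac1{|x-y|_2}\Big)+C_3N_{\mathrm{HK}}(\omega),&d=2,\\[1ex] C_4N_{\mathrm{HK}}(\omega)^{d-1}|x-y|_2^{2-d},&d\ge3,\end{cases}$$ where $N_{\mathrm{HK}}(\omega)=N_{\mathrm{HK}}(\omega,C_{\mathrm d}r_D)$. If $d\ge3$, the same bound also holds for $n^{d-2}g^\omega_{\mathbb Z^d}(\lfloor nx\rfloor,\lfloor ny\rfloor)$ and any $x,y\in D$.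
   Context: Environment. Let $E_d$ be the set of nearest-neighbour edges of $\mathbb{Z}^d$ ($x\sim y$ means $\{x,y\}\in E_d$). $\Omega=[0,\infty)^{E_d}$ carries the product Borel $\sigma$-algebra $\mathcal F$ and the shifts $(\tau_z\omega)(\{x,y\})=\omega(\{x+z,y+z\})$. $\mathbb P$ is a probability measure on $(\Omega,\mathcal F)$ with expectation $\mathbb E$. $\mathcal O(\omega)=\{e:\omega(e)>0\}$ is the set of open edges; $\mathcal C_\infty(\omega)$ is the infinite open cluster (infinite connected component of $(\mathbb Z^d,\mathcal O(\omega))$); $\Omega^*$ is the set of $\omega$ for which it is non-empty and connected (unique); $\Omega^*_0=\{\omega\in\Omega^*:0\in\mathcal C_\infty(\omega)\}$; $\theta_0=\mathbb P[0\in\mathcal C_\infty]$; $\mathbb P_0=\mathbb P[\,\cdot\,|\,0\in\mathcal C_\infty]$. $d^\omega$ is the graph distance on $\mathcal C_\infty(\omega)$ using open edges and $B^\omega(x,r)=\{y\in\mathcal C_\infty(\omega):d^\omega(x,y)\le\lfloor r\rfloor\}$. Assumption (Law): $\mathbb P$ is stationary and ergodic with respect to the shifts, $\mathbb P[\Omega^*]=1$ and $\theta_0>0$. Regular balls: for fixed constants $C_{\mathrm V}\in(0,1]$, $C_{\mathrm{riso}}\in(0,\infty)$, $C_{\mathrm W}\in[1,\infty)$, the ball $B^\omega(x,n)$ is regular if $C_{\mathrm V}n^d\le|B^\omega(x,n)|$ and there is a connected $\mathcal S\subset\mathcal C_\infty(\omega)$ with $B^\omega(x,n)\subset\mathcal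 S\subset B^\omega(x,C_{\mathrm W}n)$ and $|\partial^\omega_{\mathcal S}A|\ge C_{\mathrm{riso}}n^{-1}|A|$ for all $A\subset\mathcal S$ with $|A|\le\frac12|\mathcal S|$, where $\partial^\omega_{\mathcal S}A$ is the set of open edges between $A$ and $\mathcal S\setminus A$. Assumption (Cluster) with parameter $\theta$: for some fixed $\delta\in(0,1)$, $C_{\mathrm d}\in[1,\infty)$ and $C_{\mathrm V},C_{\mathrm{riso}},C_{\mathrm W}$ there exist $\Omega_{\mathrm{reg}}\in\mathcal F$ with $\mathbb P[\Omega_{\mathrm{reg}}]=1$ and a non-negative random variable $N_1$, finite on $\Omega_{\mathrm{reg}}\cap\Omega_0^*$, such that for $\omega\in\Omega_{\mathrm{reg}}\cap\Omega_0^*$ and all $n\ge N_1(\omega)$: (i) for every $x\in B^\omega(0,n)$ and $r\ge n^{\theta/d}$ the ball $B^\omega(x,r)$ is regular; (ii) $d^\omega(x,y)\le(C_{\mathrm d}|x-y|_\infty)\vee n^{1-\delta}$ for all $x,y\in[-n,n]^d\cap\mathcal C_\infty(\omega)$. Assumption (Moments) with parameters $\theta,p,q$: $\frac1p+\frac1q<\frac{2(1-\theta)}{d-\theta}$, and for every $e\in E_d$, $\mathbb E[\omega(e)^p]<\infty$ and $\mathbb E[\omega(e)^{-q}\mathbf 1_{\{e\in\mathcal O\}}]<\infty$ (convention $0/0=0$). Green's function. For $\omega\in\Omega^*$ let $X$ be the continuous-time random walk on $\mathcal C_\infty(\omega)$ with generator $(\mathcal L^\omega f)(x)=\sum_{y\sim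 x}\omega(\{x,y\})(f(y)-f(x))$ and law $\mathrm P^\omega_x$ when started from $x$. For $\Lambda\subseteq\mathbb R^d$ let $\tau_\Lambda=\inf\{t\ge0:X_t\notin\Lambda\}$ and $g^\omega_\Lambda(x,y)=\mathrm E^\omega_x\big[\int_0^{\tau_\Lambda}\mathbf 1_{\{X_t=y\}}\,dt\big]$ for $x,y\in\Lambda\cap\mathcal C_\infty(\omega)$, $g^\omega_\Lambda(x,y)=0$ otherwise ($g^\omega_{\mathbb Z^d}$: no killing). $nD=\{z:z/n\in D\}$; $r_D\in(0,\infty)$ is such that $nD\subset[-r_Dn,r_Dn]^d$ for all $n$; $\lfloor\cdot\rfloor$ acts componentwise. Random constants. $\mu^\omega(x)=\sum_{y\sim x}\omega(\{x,y\})$, $\nu^\omega(x)=\sum_{y\sim x}\omega(\{x,y\})^{-1}\mathbf 1_{\{\{x,y\}\in\mathcal O(\omega)\}}$; $\|f\|_{p,A}=(|A|^{-1}\sum_{x\in A}|f(x)|^p)^{1/p}$ (max for $p=\infty$); $\pi_n(x)$ is a closest point of $\mathcal C_\infty(\omega)$ to $nx$ (ties broken by a fixed ordering). Given $R\ge 1$, under the assumptions there exist $\Omega_c\in\mathcal F$ with $\mathbb P[\Omega_c]=1$, constants $\bar\mu,\bar\nu\in(0,\infty)$ and a random variable $N_2$, finite on $\Omega_{\mathrm{reg}}\cap\Omega_0^*\cap\Omega_c$, such that on this set, for all $x\in[-R,R]^d$ and $n\ge N_2(\omega)$, $\|1\vee\mu^\omega\|_{p,B^\omega(\pi_n(x),n)}\le\bar\mu$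 and $\|1\vee\nu^\omega\|_{q,B^\omega(\pi_n(x),n)}\le\bar\nu$. Heat kernel bound (known result defining $\kappa$ and $C_{\mathrm{HK}}$). Let $Y$ be the random walk on $\mathcal C_\infty(\omega)$ with generator $(1\vee\mu^\omega)^{-1}\mathcal L^\omega$ and $q^\omega_t(x,y)=\mathrm P^\omega_x[Y_t=y]/(1\vee\mu^\omega(y))$. There exist $\kappa\in(0,\infty)$ and constants $C_{\mathrm{HK}},c_1,\dots,c_4$ depending only on $d,p,q,\theta$ such that for $\omega\in\Omega_{\mathrm{reg}}\cap\Omega^*_0\cap\Omega_c$, $R\ge1$, $n\ge N_3(\omega,R):=N_1(\omega)\vee N_2(\omega)\vee R^\kappa$, $x,y\in B^\omega(0,Rn)$ and $t\ge N_{\mathrm{HK}}(\omega,R):=4N_3(\omega,R)^2\vee1$: $q^\omega_t(x,y)\le C_{\mathrm{HK}}t^{-d/2}\exp(-c_1d^\omega(x,y)^2/t)$ if $t\ge c_2d^\omega(x,y)$, and $q^\omega_t(x,y)\le C_{\mathrm{HK}}t^{-d/2}\exp\big(-c_3d^\omega(x,y)(1\vee\log\frac{d^\omega(x,y)}{t})\big)$ if $t\le c_4d^\omega(x,y)$.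
   Formalization: C_3, C_4 may also depend on the fixed background constants (δ, C_d, C_V, C_riso, C_W, κ, C_HK, c_i, and the bounds μ̄, ν̄), not only on r_D, θ, d, p, q; constant conductances ε→0 show that the literal uniformity fails. *)

theory Defs
  imports "HOL-Probability.Probability"
begin

section \<open>The lattice, environments and the open cluster\<close>

text \<open>The dimension is \<open>d = CARD('d)\<close>; vertices are the elements of \<open>int ^ 'd\<close>.\<close>

definition nbr :: "int ^ 'd \<Rightarrow> int ^ 'd \<Rightarrow> bool" where
  "nbr x y \<longleftrightarrow> (\<Sum>i\<in>UNIV. \<bar>x $ i - y $ i\<bar>) = 1"

definition lat_edges :: "(int ^ 'd) set set" where
  "lat_edges = {{x, y} | x y. nbr x y}"

text \<open>As in \<^const>\<open>PiM\<close>, an environment takes the value \<^const>\<open>undefined\<close> outside \<^const>\<open>lat_edges\<close>.\<close>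

type_synonym 'd env = "(int ^ 'd) set \<Rightarrow> real"

definition env_space :: "('d::finite) env measure" where
  "env_space = PiM lat_edges (\<lambda>_. restrict_space borel {0..})"

definition shift :: "int ^ 'd \<Rightarrow> ('d::finite) env \<Rightarrow> 'd env" where
  "shift z \<omega> = (\<lambda>e\<in>lat_edges. \<omega> ((\<lambda>v. v + z) ` e))"

definition open_edge :: "('d::finite) env \<Rightarrow> ((int ^ 'd) \<times> (int ^ 'd)) set" where
  "open_edge \<omega> = {(x, y). nbr x y \<and> \<omega> {x, y} > 0}"

text \<open>The set of all vertices in infinite open components; it is a single component
  exactly on \<open>Omega_star\<close> below.\<close>

definition Cinf :: "('d::finite) env \<Rightarrow> (int ^ 'd) set" where
  "Cinf \<omega> = {x. infinite {y. (x, y) \<in> (open_edge \<omega>)\<^sup>*}}"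

definition connected_in :: "('d::finite) env \<Rightarrow> (int ^ 'd) set \<Rightarrow> bool" where
  "connected_in \<omega> S \<longleftrightarrow> (\<forall>x\<in>S. \<forall>y\<in>S. (x, y) \<in> (open_edge \<omega> \<inter> S \<times> S)\<^sup>*)"

definition Omega_star :: "('d::finite) env set" where
  "Omega_star = {\<omega> \<in> space env_space. Cinf \<omega> \<noteq> {} \<and> connected_in \<omega> (Cinf \<omega>)}"

definition Omega_star0 :: "('d::finite) env set" where
  "Omega_star0 = {\<omega> \<in> Omega_star. 0 \<in> Cinf \<omega>}"

text \<open>Only used for \<open>x\<close>, \<open>y\<close> in the connected infinite cluster, where the minimum exists.\<close>

definition gdist :: "('d::finite) env \<Rightarrow> int ^ 'd \<Rightarrow> int ^ 'd \<Rightarrow> nat" where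
  "gdist \<omega> x y = (LEAST n. (x, y) \<in> open_edge \<omega> ^^ n)"

definition gball :: "('d::finite) env \<Rightarrow> int ^ 'd \<Rightarrow> real \<Rightarrow> (int ^ 'd) set" where
  "gball \<omega> x r = {y \<in> Cinf \<omega>. int (gdist \<omega> x y) \<le> \<lfloor>r\<rfloor>}"

definition infdist_lat :: "int ^ 'd \<Rightarrow> int ^ ('d::finite) \<Rightarrow> int" where
  "infdist_lat x y = Max (range (\<lambda>i. \<bar>x $ i - y $ i\<bar>))"

definition emb :: "int ^ 'd \<Rightarrow> real ^ ('d::finite)" where
  "emb z = (\<chi> i. real_of_int (z $ i))"

definition floor_vec :: "real ^ 'd \<Rightarrow> int ^ ('d::finite)" where
  "floor_vec x = (\<chi> i. \<lfloor>x $ i\<rfloor>)"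

definition cube :: "real \<Rightarrow> (real ^ ('d::finite)) set" where
  "cube r = {x. \<forall>i. - r \<le> x $ i \<and> x $ i \<le> r}"

definition dilate :: "nat \<Rightarrow> (real ^ ('d::finite)) set \<Rightarrow> (real ^ 'd) set" where
  "dilate n D = {z. z /\<^sub>R real n \<in> D}"

definition mu :: "('d::finite) env \<Rightarrow> int ^ 'd \<Rightarrow> real" where
  "mu \<omega> x = (\<Sum>y | nbr x y. \<omega> {x, y})"

definition nu :: "('d::finite) env \<Rightarrow> int ^ 'd \<Rightarrow> real" where
  "nu \<omega> x = (\<Sum>y | nbr x y. if \<omega> {x, y} > 0 then 1 / \<omega> {x, y} else 0)"


section \<open>Assumptions on the law\<close>

definition law_assm :: "('d::finite) env measure \<Rightarrow> bool" where
  "law_assm P \<longleftrightarrow>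
     prob_space P \<and> sets P = sets env_space \<and>
     (\<forall>z. distr P P (shift z) = P) \<and>
     (\<forall>A\<in>sets P. (\<forall>z. shift z -` A \<inter> space P = A) \<longrightarrow> measure P A = 0 \<or> measure P A = 1) \<and>
     measure P Omega_star = 1 \<and>
     measure P {\<omega> \<in> space P. 0 \<in> Cinf \<omega>} > 0"

definition bdry :: "('d::finite) env \<Rightarrow> (int ^ 'd) set \<Rightarrow> (int ^ 'd) set \<Rightarrow> (int ^ 'd) set set" where
  "bdry \<omega> S A = {{x, y} | x y. x \<in> A \<and> y \<in> S - A \<and> (x, y) \<in> open_edge \<omega>}"

definition regular_ball ::
  "real \<Rightarrow> real \<Rightarrow> real \<Rightarrow> ('d::finite) env \<Rightarrow> int ^ 'd \<Rightarrow> real \<Rightarrow> bool" where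
  "regular_ball CV Criso CW \<omega> x r \<longleftrightarrow>
     CV * r ^ CARD('d) \<le> real (card (gball \<omega> x r)) \<and>
     (\<exists>S \<subseteq> Cinf \<omega>. connected_in \<omega> S \<and> gball \<omega> x r \<subseteq> S \<and> S \<subseteq> gball \<omega> x (CW * r) \<and>
        (\<forall>A \<subseteq> S. real (card A) \<le> real (card S) / 2 \<longrightarrow>
           Criso / r * real (card A) \<le> real (card (bdry \<omega> S A))))"

definition cluster_assm ::
  "('d::finite) env measure \<Rightarrow> real \<Rightarrow> real \<Rightarrow> real \<Rightarrow> real \<Rightarrow> real \<Rightarrow> real \<Rightarrow>
   'd env set \<Rightarrow> ('d env \<Rightarrow> ereal) \<Rightarrow> bool" where
  "cluster_assm P \<theta> \<delta> Cd CV Criso CW Oreg N1 \<longleftrightarrow>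
     Oreg \<in> sets P \<and> measure P Oreg = 1 \<and>
     N1 \<in> borel_measurable P \<and> (\<forall>\<omega>\<in>space P. 0 \<le> N1 \<omega>) \<and>
     (\<forall>\<omega> \<in> Oreg \<inter> Omega_star0.
        N1 \<omega> < \<infinity> \<and>
        (\<forall>n::nat. N1 \<omega> \<le> ereal (real n) \<longrightarrow>
           (\<forall>x \<in> gball \<omega> 0 (real n). \<forall>r. real n powr (\<theta> / real CARD('d)) \<le> r \<longrightarrow>
              regular_ball CV Criso CW \<omega> x r) \<and>
           (\<forall>x \<in> Cinf \<omega>. \<forall>y \<in> Cinf \<omega>. emb x \<in> cube (real n) \<longrightarrow> emb y \<in> cube (real n) \<longrightarrow>
              real (gdist \<omega> x y)
                \<le> max (Cd * real_of_int (infdist_lat x y)) (real n powr (1 - \<delta>)))))"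

text \<open>For \<open>p = \<infinity>\<close> finiteness of the \<open>p\<close>-th moment means essential boundedness.\<close>

definition finite_moment :: "'a measure \<Rightarrow> ereal \<Rightarrow> ('a \<Rightarrow> real) \<Rightarrow> bool" where
  "finite_moment M p f \<longleftrightarrow>
     (if p = \<infinity> then \<exists>C. AE \<omega> in M. \<bar>f \<omega>\<bar> \<le> C
      else (\<integral>\<^sup>+ \<omega>. ennreal (\<bar>f \<omega>\<bar> powr real_of_ereal p) \<partial>M) < \<infinity>)"

definition moments_assm :: "('d::finite) env measure \<Rightarrow> real \<Rightarrow> ereal \<Rightarrow> ereal \<Rightarrow> bool" where
  "moments_assm P \<theta> p q \<longleftrightarrow>
     1 / p + 1 / q < ereal (2 * (1 - \<theta>) / (real CARD('d) - \<theta>)) \<and>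
     (\<forall>e\<in>lat_edges. finite_moment P p (\<lambda>\<omega>. \<omega> e) \<and>
        finite_moment P q (\<lambda>\<omega>. if \<omega> e > 0 then 1 / \<omega> e else 0))"


section \<open>Random walks\<close>

definition generator :: "('d::finite) env \<Rightarrow> (int ^ 'd \<Rightarrow> real) \<Rightarrow> int ^ 'd \<Rightarrow> real" where
  "generator \<omega> f x = (\<Sum>y | nbr x y. \<omega> {x, y} * (f y - f x))"

definition generatorY :: "('d::finite) env \<Rightarrow> (int ^ 'd \<Rightarrow> real) \<Rightarrow> int ^ 'd \<Rightarrow> real" where
  "generatorY \<omega> f x = generator \<omega> f x / max 1 (mu \<omega> x)"

text \<open>
  The (minimal) continuous-time Markov chain with generator \<open>G\<close> is realised by its jump chain
  \<open>Z\<close> and independent standard exponential variables \<open>E\<close>: the \<open>k\<close>-th holding time is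
  \<open>E k / rate G (Z k)\<close>.  The jump rate from \<open>x\<close> to \<open>y \<noteq> x\<close> is \<open>(G 1\<^sub>y)(x)\<close> and the total
  jump rate from \<open>x\<close> is \<open>- (G 1\<^sub>x)(x)\<close>.  An absorbing state is encoded by jumps from it to itself
  at rate 1.  After a possible explosion the walk is in the cemetery \<^const>\<open>None\<close>.
\<close>

definition total_rate :: "(('s \<Rightarrow> real) \<Rightarrow> 's \<Rightarrow> real) \<Rightarrow> 's \<Rightarrow> real" where
  "total_rate G x = - G (indicator {x}) x"

definition rate :: "(('s \<Rightarrow> real) \<Rightarrow> 's \<Rightarrow> real) \<Rightarrow> 's \<Rightarrow> real" where
  "rate G x = (if total_rate G x = 0 then 1 else total_rate G x)"

definition jump_kernel :: "(('s \<Rightarrow> real) \<Rightarrow> 's \<Rightarrow> real) \<Rightarrow> 's \<Rightarrow> 's measure" where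
  "jump_kernel G x =
     (if total_rate G x = 0 then return (count_space UNIV) x
      else point_measure UNIV
        (\<lambda>y. ennreal (if y = x then 0 else G (indicator {y}) x / total_rate G x)))"

definition chain_kernel ::
  "(('s \<Rightarrow> real) \<Rightarrow> 's \<Rightarrow> real) \<Rightarrow> 's \<Rightarrow> nat \<Rightarrow> (nat \<Rightarrow> 's) \<Rightarrow> 's measure" where
  "chain_kernel G x n h =
     (if n = 0 then return (count_space UNIV) x else jump_kernel G (h (n - 1)))"

text \<open>The law of the jump chain started in \<open>x\<close>, from the Ionescu-Tulcea construction.\<close>

definition chain_law :: "(('s \<Rightarrow> real) \<Rightarrow> 's \<Rightarrow> real) \<Rightarrow> 's \<Rightarrow> (nat \<Rightarrow> 's) measure" where
  "chain_law G x =
     projective_family.lim UNIV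
       (Ionescu_Tulcea.CI (chain_kernel G x) (\<lambda>_. count_space UNIV)) (\<lambda>_. count_space UNIV)"

definition walk_law ::
  "(('s \<Rightarrow> real) \<Rightarrow> 's \<Rightarrow> real) \<Rightarrow> 's \<Rightarrow> ((nat \<Rightarrow> 's) \<times> (nat \<Rightarrow> real)) measure" where
  "walk_law G x =
     chain_law G x \<Otimes>\<^sub>M PiM UNIV (\<lambda>_. density lborel (\<lambda>t. ennreal (exponential_density 1 t)))"

definition jump_time ::
  "(('s \<Rightarrow> real) \<Rightarrow> 's \<Rightarrow> real) \<Rightarrow> (nat \<Rightarrow> 's) \<times> (nat \<Rightarrow> real) \<Rightarrow> nat \<Rightarrow> real" where
  "jump_time G s k = (\<Sum>i<k. snd s i / rate G (fst s i))"

definition walk_at ::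
  "(('s \<Rightarrow> real) \<Rightarrow> 's \<Rightarrow> real) \<Rightarrow> (nat \<Rightarrow> 's) \<times> (nat \<Rightarrow> real) \<Rightarrow> real \<Rightarrow> 's option" where
  "walk_at G s t =
     (if \<exists>k. t < jump_time G s (Suc k)
      then Some (fst s (LEAST k. t < jump_time G s (Suc k))) else None)"

definition exit_time ::
  "((int ^ 'd \<Rightarrow> real) \<Rightarrow> int ^ 'd \<Rightarrow> real) \<Rightarrow> (real ^ ('d::finite)) set \<Rightarrow>
   (nat \<Rightarrow> int ^ 'd) \<times> (nat \<Rightarrow> real) \<Rightarrow> ereal" where
  "exit_time G \<Lambda> s =
     Inf (ereal ` {t. 0 \<le> t \<and> \<not> (\<exists>z. walk_at G s t = Some z \<and> emb z \<in> \<Lambda>)})"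

definition green ::
  "('d::finite) env \<Rightarrow> (real ^ 'd) set \<Rightarrow> int ^ 'd \<Rightarrow> int ^ 'd \<Rightarrow> ennreal" where
  "green \<omega> \<Lambda> x y =
     (if emb x \<in> \<Lambda> \<and> emb y \<in> \<Lambda> \<and> x \<in> Cinf \<omega> \<and> y \<in> Cinf \<omega>
      then \<integral>\<^sup>+ s. (\<integral>\<^sup>+ t. indicator
                {t. 0 \<le> t \<and> ereal t \<le> exit_time (generator \<omega>) \<Lambda> s \<and>
                    walk_at (generator \<omega>) s t = Some y} t \<partial>lborel)
             \<partial>walk_law (generator \<omega>) x
      else 0)"

definition heat_kernel :: "('d::finite) env \<Rightarrow> real \<Rightarrow> int ^ 'd \<Rightarrow> int ^ 'd \<Rightarrow> real" where
  "heat_kernel \<omega> t x y =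
     measure (walk_law (generatorY \<omega>) x)
       {s \<in> space (walk_law (generatorY \<omega>) x). walk_at (generatorY \<omega>) s t = Some y}
     / max 1 (mu \<omega> y)"


section \<open>Random constants and the heat kernel bound\<close>

definition avg_norm :: "ereal \<Rightarrow> ('s \<Rightarrow> real) \<Rightarrow> 's set \<Rightarrow> real" where
  "avg_norm p f A =
     (if p = \<infinity> then Max ((\<lambda>x. \<bar>f x\<bar>) ` A)
      else ((\<Sum>x\<in>A. \<bar>f x\<bar> powr real_of_ereal p) / real (card A)) powr (1 / real_of_ereal p))"

text \<open>Closest points of the cluster in Euclidean distance; \<open>ord\<close> is the order that breaks ties.\<close>

definition closest_pts :: "('d::finite) env \<Rightarrow> real ^ 'd \<Rightarrow> (int ^ 'd) set" where
  "closest_pts \<omega> v = {y \<in> Cinf \<omega>. \<forall>z\<in>Cinf \<omega>. dist (emb y) v \<le> dist (emb z) v}"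

definition nearest ::
  "((int ^ 'd) \<times> (int ^ 'd)) set \<Rightarrow> ('d::finite) env \<Rightarrow> nat \<Rightarrow> real ^ 'd \<Rightarrow> int ^ 'd" where
  "nearest ord \<omega> n x =
     (THE y. y \<in> closest_pts \<omega> (real n *\<^sub>R x) \<and>
        (\<forall>z \<in> closest_pts \<omega> (real n *\<^sub>R x). (y, z) \<in> ord))"

text \<open>
  The objects \<open>\<Omega>\<^sub>c\<close>, the bounds on the averages, and \<open>N\<^sub>2\<close> are obtained for each given \<open>R \<ge> 1\<close>;
  hence they are functions of \<open>R\<close> here.
\<close>

definition averages_bounded ::
  "('d::finite) env measure \<Rightarrow> ereal \<Rightarrow> ereal \<Rightarrow> ((int ^ 'd) \<times> (int ^ 'd)) set \<Rightarrow> 'd env set \<Rightarrow>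
   (real \<Rightarrow> 'd env set) \<Rightarrow> (real \<Rightarrow> real) \<Rightarrow> (real \<Rightarrow> real) \<Rightarrow> (real \<Rightarrow> 'd env \<Rightarrow> ereal) \<Rightarrow> bool" where
  "averages_bounded P p q ord Oreg Oc mubar nubar N2 \<longleftrightarrow>
     (\<forall>R\<ge>1. Oc R \<in> sets P \<and> measure P (Oc R) = 1 \<and> N2 R \<in> borel_measurable P \<and>
        (\<forall>\<omega> \<in> Oreg \<inter> Omega_star0 \<inter> Oc R.
           \<bar>N2 R \<omega>\<bar> \<noteq> \<infinity> \<and>
           (\<forall>x \<in> cube R. \<forall>n::nat. N2 R \<omega> \<le> ereal (real n) \<longrightarrow>
              avg_norm p (\<lambda>z. max 1 (mu \<omega> z)) (gball \<omega> (nearest ord \<omega> n x) (real n)) \<le> mubar R \<and>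
              avg_norm q (\<lambda>z. max 1 (nu \<omega> z)) (gball \<omega> (nearest ord \<omega> n x) (real n)) \<le> nubar R)))"

text \<open>
  \<open>N\<^sub>2\<close> is only meaningful for \<open>R \<ge> 1\<close>.  So that \<open>N\<^sub>3\<close> makes sense for every \<open>R > 0\<close>, we use
  the value of \<open>N\<^sub>2\<close> at 1 when \<open>R < 1\<close>.
\<close>

definition N3 ::
  "real \<Rightarrow> ('e \<Rightarrow> ereal) \<Rightarrow> (real \<Rightarrow> 'e \<Rightarrow> ereal) \<Rightarrow> real \<Rightarrow> 'e \<Rightarrow> ereal" where
  "N3 \<kappa> N1 N2 R \<omega> = max (max (N1 \<omega>) (N2 (max 1 R) \<omega>)) (ereal (R powr \<kappa>))"

definition NHK ::
  "real \<Rightarrow> ('e \<Rightarrow> ereal) \<Rightarrow> (real \<Rightarrow> 'e \<Rightarrow> ereal) \<Rightarrow> real \<Rightarrow> 'e \<Rightarrow> ereal" where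
  "NHK \<kappa> N1 N2 R \<omega> = max (4 * (N3 \<kappa> N1 N2 R \<omega>)\<^sup>2) 1"

definition heat_kernel_bound ::
  "('d::finite) env set \<Rightarrow> (real \<Rightarrow> 'd env set) \<Rightarrow> ('d env \<Rightarrow> ereal) \<Rightarrow> (real \<Rightarrow> 'd env \<Rightarrow> ereal) \<Rightarrow>
   real \<Rightarrow> real \<Rightarrow> real \<Rightarrow> real \<Rightarrow> real \<Rightarrow> real \<Rightarrow> bool" where
  "heat_kernel_bound Oreg Oc N1 N2 \<kappa> CHK c1 c2 c3 c4 \<longleftrightarrow>
     (\<forall>R\<ge>1. \<forall>\<omega> \<in> Oreg \<inter> Omega_star0 \<inter> Oc R. \<forall>n::nat. N3 \<kappa> N1 N2 R \<omega> \<le> ereal (real n) \<longrightarrow>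
        (\<forall>x \<in> gball \<omega> 0 (R * real n). \<forall>y \<in> gball \<omega> 0 (R * real n).
           \<forall>t::real. NHK \<kappa> N1 N2 R \<omega> \<le> ereal t \<longrightarrow>
             (c2 * real (gdist \<omega> x y) \<le> t \<longrightarrow>
                heat_kernel \<omega> t x y
                  \<le> CHK * t powr (- real CARD('d) / 2) * exp (- c1 * (real (gdist \<omega> x y))\<^sup>2 / t)) \<and>
             (t \<le> c4 * real (gdist \<omega> x y) \<longrightarrow>
                heat_kernel \<omega> t x y
                  \<le> CHK * t powr (- real CARD('d) / 2) *
                     exp (- c3 * real (gdist \<omega> x y) * max 1 (ln (real (gdist \<omega> x y) / t))))))"

end

theory Submission
  imports Defs "HOL-Real_Asymp.Real_Asymp"
begin

text \<open>
  The walk with generator \<open>\<L>\<close> and the walk \<open>Y\<close> of the heat kernel bound have the same jump chain, so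
  the Green function is the occupation time of \<open>Y\<close> divided by the speed \<open>max 1 \<mu>\<close>, that is, the
  time integral of the heat kernel.  As the hypothesis on the heat kernel holds for all large \<open>n\<close>,
  it bounds the kernel at all pairs of vertices of the cluster for times beyond \<open>N\<^sub>H\<^sub>K\<close> and beyond a
  multiple of the graph distance.  Times below \<open>N\<^sub>H\<^sub>K\<close> contribute at most \<open>N\<^sub>H\<^sub>K\<close>, and times below a
  multiple of the distance are controlled by a Combes-Thomas estimate for the resolvent.  In
  dimension two the integral diverges and killing has to be used: at time scale \<open>n\<^sup>2\<close> the walk leaves
  \<open>nD\<close> with probability at least one half, and comparing resolvents with parameters of order
  \<open>n\<^sup>-\<^sup>2\<close> through the maximum principle shows that larger times add only a constant to the logarithm.
\<close>

section \<open>The jump chain\<close>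

text \<open>The walk is never restarted at a random time. Its dynamics enter in only two ways:
  through the law of \<open>Y\<close> at a fixed time, integrated by Tonelli, and through a linear
  equation for discounted occupation times, obtained by summing over the number of jumps. Killing
  then becomes a zero boundary condition. The discount keeps occupation times finite, so that they
  can be subtracted; finiteness of the domain lets maxima be attained and double sums be exchanged.
  Monotone limits remove the discount and, where necessary, the finiteness.

  The factor \<open>2 * CHK\<close> of the logarithm allows no loss: \<open>CHK / t\<close> has to
  be integrated exactly from the squared distance, up to a constant factor, to a multiple of
  \<open>n^2\<close>, and all else must be of order \<open>N_HK\<close>. Comparing the discounts
  \<open>\<beta>\<close> and \<open>2 * \<beta>\<close> serves this, since \<open>exp (- \<beta> *
  t) - exp (- 2 * \<beta> * t) \<le> \<beta> * t * exp (- \<beta> * t)\<close> cancels the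
  \<open>1 / t\<close> of the planar kernel and leaves no logarithm.

  In higher dimension the power \<open>d - 1\<close> of \<open>N_HK\<close> is
  \<open>1 + (d - 2)\<close>: a time window of length \<open>N_HK\<close> is weighed against the
  decay of order \<open>d - 2\<close> in the distance.\<close>

abbreviation std_exponential :: "real measure" where
  "std_exponential \<equiv> density lborel (\<lambda>t. ennreal (exponential_density 1 t))"

lemma prob_space_std_exponential:
  "prob_space std_exponential"
  by (rule prob_space_exponential_density) simp

text \<open>Tilting: the rate one density times \<open>exp (- c * t)\<close> is
  \<open>1 / (1 + c)\<close> times the density of rate \<open>1 + c\<close>, which has mass one. It
  is the discount picked up over one holding time.\<close>

lemma nn_integral_exponential_exp:
  assumes "c > -1"
  shows "(\<integral>\<^sup>+t. ennreal (exp (- c * t)) \<partial>std_exponential)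
    = ennreal (1 / (1 + c))"
proof -
  interpret p: prob_space "density lborel (\<lambda>t. ennreal (exponential_density (1 + c) t))"
    by (rule prob_space_exponential_density) (use assms in simp)
  have "(\<integral>\<^sup>+t. ennreal (exp (- c * t)) \<partial>std_exponential)
    = (\<integral>\<^sup>+t. ennreal (1 / (1 + c)) * ennreal (exponential_density (1 + c) t) \<partial>lborel)"
    using assms
  proof (subst nn_integral_density)
    have "ennreal (exponential_density 1 t) * ennreal (exp (- c * t))
      = ennreal (1 / (1 + c)) * ennreal (exponential_density (1 + c) t)" for t
    proof (cases "t < 0")
      case False
      have "exp (- t) * exp (- c * t) = 1 / (1 + c) * ((1 + c) * exp (- t * (1 + c)))"
        using assms by (simp add: exp_add[symmetric] field_simps)
      then show ?thesis
        using assms False by (simp add: exponential_density_def ennreal_mult[symmetric])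
    qed (simp add: exponential_density_def)
    then show "(\<integral>\<^sup>+t. ennreal (exponential_density 1 t) * ennreal (exp (- c * t)) \<partial>lborel)
      = (\<integral>\<^sup>+t. ennreal (1 / (1 + c)) * ennreal (exponential_density (1 + c) t) \<partial>lborel)"
      by simp
  qed auto
  also have "\<dots> = ennreal (1 / (1 + c)) * (\<integral>\<^sup>+t. ennreal (exponential_density (1 + c) t) \<partial>lborel)"
    by (rule nn_integral_cmult) simp
  also have "(\<integral>\<^sup>+t. ennreal (exponential_density (1 + c) t) \<partial>lborel) = 1"
    using p.emeasure_space_1 by (simp add: emeasure_density)
  finally show ?thesis by simp
qed

text \<open>This factor comes from the last holding interval. The complementary integral is added to
  reach the total mass one and is then cancelled as a finite term.\<close>

lemma nn_integral_exponential_one_minus_exp: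
  assumes "c > 0"
  shows "(\<integral>\<^sup>+t. ennreal (1 - exp (- c * t)) \<partial>std_exponential)
    = ennreal (c / (1 + c))"
proof -
  interpret p: prob_space std_exponential by (rule prob_space_std_exponential)
  have AE: "AE t in std_exponential. 0 \<le> t"
    by (subst AE_density) (auto simp: exponential_density_def)
  have "(\<integral>\<^sup>+t. ennreal (1 - exp (- c * t)) \<partial>std_exponential) + (\<integral>\<^sup>+t. ennreal (exp (- c * t)) \<partial>std_exponential)
     = (\<integral>\<^sup>+t. ennreal (1 - exp (- c * t)) + ennreal (exp (- c * t)) \<partial>std_exponential)"
    by (rule nn_integral_add[symmetric]) auto
  also have "\<dots> = (\<integral>\<^sup>+t. 1 \<partial>std_exponential)"
    by (intro nn_integral_cong_AE eventually_mono[OF AE])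
       (use assms in \<open>auto simp: ennreal_plus[symmetric] simp del: ennreal_plus\<close>)
  also have "\<dots> = 1" using p.emeasure_space_1 by simp
  finally have *: "(\<integral>\<^sup>+t. ennreal (1 - exp (- c * t)) \<partial>std_exponential) + ennreal (1 / (1 + c)) = 1"
    using assms by (subst (asm) nn_integral_exponential_exp) auto
  have "(\<integral>\<^sup>+t. ennreal (1 - exp (- c * t)) \<partial>std_exponential)
    = (\<integral>\<^sup>+t. ennreal (1 - exp (- c * t)) \<partial>std_exponential) + ennreal (1 / (1 + c)) - ennreal (1 / (1 + c))"
    by simp
  also have "\<dots> = ennreal (c / (1 + c))"
    using assms unfolding * by (simp add: ennreal_minus flip: ennreal_1) (simp add: field_simps)
  finally show ?thesis .
qed

locale jump_chain =
  fixes G :: "(('s::countable) \<Rightarrow> real) \<Rightarrow> 's \<Rightarrow> real"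
  assumes prob_space_jump_kernel: "prob_space (jump_kernel G x)"
    and rate_pos: "0 < rate G x"
begin

lemma sets_jump_kernel [simp]: "sets (jump_kernel G x) = UNIV"
  by (auto simp: jump_kernel_def sets_point_measure)

lemma borel_measurable_jump_kernel [simp]: "f \<in> borel_measurable (jump_kernel G x)"
  by (simp add: measurable_def)

lemma measurable_jump_kernel [measurable]:
  "jump_kernel G \<in> measurable (count_space UNIV) (subprob_algebra (count_space UNIV))"
  using prob_space_jump_kernel
  by (auto simp: space_subprob_algebra intro: prob_space_imp_subprob_space)

lemma measurable_chain_kernel [measurable]:
  "chain_kernel G x i \<in> measurable (PiM {0..<i} (\<lambda>_. count_space UNIV)) (subprob_algebra (count_space UNIV))"
proof (cases "i = 0")
  case True
  then show ?thesis
    by (auto simp: chain_kernel_def[abs_def] space_subprob_algebra intro!: measurable_const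
        prob_space_imp_subprob_space prob_space_return)
next
  case False
  then have [measurable]: "(\<lambda>h. h (i - 1)) \<in> measurable (PiM {0..<i} (\<lambda>_. count_space UNIV)) (count_space (UNIV::'s set))"
    by (intro measurable_component_singleton) auto
  show ?thesis using False unfolding chain_kernel_def[abs_def] by simp
qed

lemma Ionescu_Tulcea_chain: "Ionescu_Tulcea (chain_kernel G x) (\<lambda>_. count_space UNIV)"
  by (rule Ionescu_Tulcea.intro)
     (simp_all add: measurable_chain_kernel, simp add: chain_kernel_def prob_space_jump_kernel prob_space_return)

interpretation IT: Ionescu_Tulcea "chain_kernel G x" "\<lambda>_. count_space UNIV" for x
  by (rule Ionescu_Tulcea_chain)

lemma chain_law_eq: "chain_law G x = IT.PF.lim x"
  by (simp add: chain_law_def)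

lemma sets_chain_law [simp, measurable_cong]: "sets (chain_law G x) = sets (PiM UNIV (\<lambda>_. count_space UNIV))"
  by (simp add: chain_law_eq)

lemma space_chain_law [simp]: "space (chain_law G x) = UNIV"
  using sets_eq_imp_space_eq[OF sets_chain_law] by (simp add: space_PiM)

lemma up_to_ivl: "IT.up_to {0..<n::nat} = n"
proof (rule antisym)
  show "IT.up_to {0..<n} \<le> n"
    by (subst IT.up_to_iff) auto
  show "n \<le> IT.up_to {0..<n}"
    using IT.up_to_less[of "{0..<n}" "n - 1"] by (cases "n = 0") auto
qed

text \<open>The marginal of the projective limit on the first \<open>n\<close> coordinates is the
  \<open>n\<close>-fold composition of the kernels. All quantitative information about
  \<open>chain_law\<close> passes through this identity.\<close>

lemma nn_integral_chain_law_C: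
  assumes [measurable]: "g \<in> borel_measurable (PiM {0..<n} (\<lambda>_. count_space UNIV))"
  shows "(\<integral>\<^sup>+Z. g (restrict Z {0..<n}) \<partial>chain_law G x) = (\<integral>\<^sup>+h. g h \<partial>IT.C x 0 n (\<lambda>_. undefined))"
proof -
  have "(\<integral>\<^sup>+Z. g (restrict Z {0..<n}) \<partial>chain_law G x) =
     (\<integral>\<^sup>+h. g h \<partial>distr (chain_law G x) (PiM {0..<n} (\<lambda>_. count_space UNIV)) (\<lambda>Z. restrict Z {0..<n}))"
    by (subst nn_integral_distr) (auto intro!: measurable_restrict simp: measurable_cong_sets[OF sets_chain_law refl])
  also have "\<dots> = (\<integral>\<^sup>+h. g h \<partial>IT.CI x {0..<n})"
    unfolding chain_law_eq by (subst IT.distr_lim) simp_all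
  also have "IT.CI x {0..<n} = IT.C x 0 n (\<lambda>_. undefined)"
    unfolding IT.CI_def up_to_ivl using IT.distr_C[of n n "\<lambda>_. undefined" 0 x] by simp
  finally show ?thesis .
qed

lemma prob_space_chain_law: "prob_space (chain_law G x)"
proof
  interpret C: prob_space "IT.C x 0 0 (\<lambda>_. undefined)" by (rule IT.prob_space_C) simp
  show "emeasure (chain_law G x) (space (chain_law G x)) = 1"
    using nn_integral_chain_law_C[of "\<lambda>_. 1" 0 x] C.emeasure_space_1 by simp
qed

text \<open>The composition of \<open>Suc n\<close> kernels is a bind whose last stage adds
  coordinate \<open>n\<close>; undoing that bind integrates the coordinate out. The restrictions
  appear because the compositions live on extensional functions.\<close>

lemma nn_integral_chain_law_step:
  assumes [measurable]: "g \<in> borel_measurable (PiM {0..<Suc n} (\<lambda>_. count_space UNIV))"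
  shows "(\<integral>\<^sup>+Z. g (restrict Z {0..<Suc n}) \<partial>chain_law G x)
    = (\<integral>\<^sup>+Z. (\<integral>\<^sup>+z. g ((restrict Z {0..<n})(n := z)) \<partial>chain_kernel G x n (restrict Z {0..<n})) \<partial>chain_law G x)"
proof -
  have [measurable]: "(\<lambda>h. \<integral>\<^sup>+z. g (h(n := z)) \<partial>chain_kernel G x n h) \<in> borel_measurable (PiM {0..<n} (\<lambda>_. count_space UNIV))"
  proof (rule nn_integral_measurable_subprob_algebra2[OF _ measurable_chain_kernel])
    have "(\<lambda>p. (fst p)(n := snd p)) \<in> measurable (PiM {0..<n} (\<lambda>_. count_space UNIV) \<Otimes>\<^sub>M count_space (UNIV::'s set)) (PiM {0..<Suc n} (\<lambda>_. count_space UNIV))"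
      by (rule measurable_fun_upd[where J="{0..<n}"]) auto
    then show "(\<lambda>(h, z). g (h(n := z))) \<in> borel_measurable (PiM {0..<n} (\<lambda>_. count_space UNIV) \<Otimes>\<^sub>M count_space UNIV)"
      by (simp add: case_prod_beta')
  qed
  have "(\<integral>\<^sup>+Z. g (restrict Z {0..<Suc n}) \<partial>chain_law G x) = (\<integral>\<^sup>+h. g h \<partial>IT.C x 0 (Suc n) (\<lambda>_. undefined))"
    by (rule nn_integral_chain_law_C) fact
  also have "\<dots> = (\<integral>\<^sup>+h. (\<integral>\<^sup>+z. g (h(n := z)) \<partial>chain_kernel G x n h) \<partial>IT.C x 0 n (\<lambda>_. undefined))"
  proof -
    have "(\<integral>\<^sup>+h. g h \<partial>IT.C x 0 (Suc n) (\<lambda>_. undefined))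
      = (\<integral>\<^sup>+h. \<integral>\<^sup>+h'. g h' \<partial>IT.eP x n h \<partial>IT.C x 0 n (\<lambda>_. undefined))"
      unfolding IT.C.simps add_0
      by (rule nn_integral_bind[where B="PiM {0..<Suc n} (\<lambda>_. count_space UNIV)"])
         (use IT.measurable_eP[of x n] in \<open>simp_all add: IT.sets_C cong: measurable_cong_sets\<close>)
    also have "\<dots> = (\<integral>\<^sup>+h. (\<integral>\<^sup>+z. g (h(n := z)) \<partial>chain_kernel G x n h) \<partial>IT.C x 0 n (\<lambda>_. undefined))"
      by (intro nn_integral_cong IT.nn_integral_eP) (simp_all add: IT.space_C)
    finally show ?thesis .
  qed
  also have "\<dots> = (\<integral>\<^sup>+Z. (\<integral>\<^sup>+z. g ((restrict Z {0..<n})(n := z)) \<partial>chain_kernel G x n (restrict Z {0..<n})) \<partial>chain_law G x)"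
    by (rule nn_integral_chain_law_C[symmetric]) measurable
  finally show ?thesis .
qed

text \<open>Conditioning on the last step rather than the first one matches the Ionescu-Tulcea
  construction, so no shift of the path space is needed.\<close>

lemma nn_integral_chain_law_prod:
  fixes a b :: "'s \<Rightarrow> ennreal"
  shows "(\<integral>\<^sup>+Z. (\<Prod>i<k. a (Z i)) * b (Z k) \<partial>chain_law G x)
    = ((\<lambda>f z. a z * (\<integral>\<^sup>+w. f w \<partial>jump_kernel G z)) ^^ k) b x"
proof (induction k arbitrary: b)
  case 0
  show ?case
    using nn_integral_chain_law_step[of "\<lambda>h. b (h 0)" 0 x]
    by (simp add: chain_kernel_def nn_integral_return prob_space.emeasure_space_1[OF prob_space_chain_law, simplified])
next
  case (Suc k)
  let ?T = "\<lambda>f z. a z * (\<integral>\<^sup>+w. f w \<partial>jump_kernel G z)"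
  have [measurable]: "(\<lambda>h. h i) \<in> measurable (PiM {0..<Suc (Suc k)} (\<lambda>_. count_space UNIV)) (count_space (UNIV::'s set))"
    if "i < Suc (Suc k)" for i using that by (intro measurable_component_singleton) auto
  have cmult: "(\<integral>\<^sup>+z. c * f z \<partial>jump_kernel G w) = c * (\<integral>\<^sup>+z. f z \<partial>jump_kernel G w)" for c w f
    by (rule nn_integral_cmult) simp
  have m: "(\<lambda>h. (\<Prod>i<Suc k. a (h i)) * b (h (Suc k))) \<in> borel_measurable (PiM {0..<Suc (Suc k)} (\<lambda>_. count_space UNIV))"
    by (intro borel_measurable_times_ennreal borel_measurable_prod_ennreal measurable_compose[OF measurable_component_singleton]) auto
  have "(\<integral>\<^sup>+Z. (\<Prod>i<Suc k. a (Z i)) * b (Z (Suc k)) \<partial>chain_law G x)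
    = (\<integral>\<^sup>+Z. (\<integral>\<^sup>+z. (\<Prod>i<Suc k. a (Z i)) * b z \<partial>jump_kernel G (Z k)) \<partial>chain_law G x)"
    using nn_integral_chain_law_step[OF m, of x]
    by (simp add: chain_kernel_def del: prod.lessThan_Suc)
  \<comment> \<open>The factor \<open>a (Z k)\<close> and the integral over the new state merge into
    one application of the operator to \<open>b\<close>, now evaluated at time \<open>k\<close>. The
    induction therefore needs \<open>b\<close> arbitrary.\<close>
  also have "\<dots> = (\<integral>\<^sup>+Z. (\<Prod>i<k. a (Z i)) * ?T b (Z k) \<partial>chain_law G x)"
    by (intro nn_integral_cong) (simp add: cmult mult.assoc)
  also have "\<dots> = (?T ^^ k) (?T b) x" by (rule Suc.IH)
  also have "\<dots> = (?T ^^ Suc k) b x" by (simp only: funpow_Suc_right comp_def)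
  finally show ?case .
qed

end

section \<open>Holding times and occupation times\<close>

definition holding_law :: "(nat \<Rightarrow> real) measure" where
  "holding_law = PiM UNIV (\<lambda>_. std_exponential)"

abbreviation walk_space :: "((nat \<Rightarrow> 's) \<times> (nat \<Rightarrow> real)) measure" where
  "walk_space \<equiv> PiM UNIV (\<lambda>_. count_space UNIV) \<Otimes>\<^sub>M PiM UNIV (\<lambda>_. borel)"

abbreviation hold :: "(('s \<Rightarrow> real) \<Rightarrow> 's \<Rightarrow> real) \<Rightarrow> (real \<Rightarrow> ennreal) \<Rightarrow> (nat \<Rightarrow> 's) \<times> (nat \<Rightarrow> real) \<Rightarrow> nat \<Rightarrow> ennreal" where
  "hold G f s k \<equiv> \<integral>\<^sup>+t. f t * indicator {jump_time G s k..<jump_time G s (Suc k)} t \<partial>lborel"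

definition path_in :: "'s set \<Rightarrow> 's \<Rightarrow> nat \<Rightarrow> (nat \<Rightarrow> 's) \<Rightarrow> bool" where
  "path_in A y k Z \<longleftrightarrow> Z k = y \<and> (\<forall>i\<le>k. Z i \<in> A)"

text \<open>The integral of \<open>f\<close> over the time that the walk from \<open>x\<close> spends in \<open>y\<close> before leaving \<open>A\<close>.\<close>

definition occ :: "(('s \<Rightarrow> real) \<Rightarrow> 's \<Rightarrow> real) \<Rightarrow> 's set \<Rightarrow> (real \<Rightarrow> ennreal) \<Rightarrow> 's \<Rightarrow> 's \<Rightarrow> ennreal" where
  "occ G A f y x = (\<integral>\<^sup>+s. (\<Sum>k. if path_in A y k (fst s) then hold G f s k else 0) \<partial>walk_law G x)"

lemma sets_holding_law [measurable_cong]: "sets holding_law = sets (PiM UNIV (\<lambda>_. borel))"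
  unfolding holding_law_def by (intro sets_PiM_cong) auto

lemma space_holding_law [simp]: "space holding_law = UNIV"
  by (simp add: holding_law_def space_PiM)

interpretation hl: product_prob_space "\<lambda>_::nat. std_exponential" UNIV
  by (rule product_prob_spaceI) (rule prob_space_std_exponential)

lemma prob_space_holding_law: "prob_space holding_law"
  unfolding holding_law_def by (rule prob_space_PiM) (rule prob_space_std_exponential)

text \<open>Positive holding times make the jump times strictly increasing, so the holding intervals
  are disjoint and none is empty. Pathwise arguments below are carried out on this event.\<close>

lemma AE_holding_law_pos: "AE E in holding_law. \<forall>i. 0 < E i"
proof (subst AE_all_countable, rule allI)
  fix i :: nat
  have "AE t in std_exponential. 0 < t"
    using AE_lborel_singleton[of "0::real"]
    by (subst AE_density) (auto simp: exponential_density_def elim!: eventually_mono)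
  then show "AE E in holding_law. 0 < E i"
    unfolding holding_law_def by (rule AE_PiM_component[rotated 2]) (auto intro: prob_space_std_exponential)
qed

lemma nn_integral_holding_law_prod:
  assumes [measurable]: "\<And>i. \<phi> i \<in> borel_measurable borel"
  shows "(\<integral>\<^sup>+E. (\<Prod>i<n. \<phi> i (E i)) \<partial>holding_law)
    = (\<Prod>i<n. \<integral>\<^sup>+t. \<phi> i t \<partial>std_exponential)"
proof -
  have "(\<integral>\<^sup>+E. (\<Prod>i<n. \<phi> i (E i)) \<partial>holding_law) = (\<integral>\<^sup>+E. (\<Prod>i<n. \<phi> i (restrict E {..<n} i)) \<partial>holding_law)"
    by simp
  also have "\<dots> = (\<integral>\<^sup>+h. (\<Prod>i<n. \<phi> i (h i)) \<partial>distr holding_law (PiM {..<n} (\<lambda>_. std_exponential)) (\<lambda>E. restrict E {..<n}))"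
    unfolding holding_law_def by (subst nn_integral_distr) (auto intro!: measurable_restrict)
  also have "distr holding_law (PiM {..<n} (\<lambda>_. std_exponential)) (\<lambda>E. restrict E {..<n}) = PiM {..<n} (\<lambda>_. std_exponential)"
    unfolding holding_law_def by (rule hl.distr_PiM_restrict_finite) auto
  also have "(\<integral>\<^sup>+h. (\<Prod>i<n. \<phi> i (h i)) \<partial>PiM {..<n} (\<lambda>_. std_exponential)) = (\<Prod>i<n. \<integral>\<^sup>+t. \<phi> i t \<partial>std_exponential)"
    by (rule hl.product_nn_integral_prod) auto
  finally show ?thesis .
qed

lemma nn_integral_exp_Ico:
  fixes a b \<alpha> :: real
  assumes "0 < \<alpha>" "a \<le> b"
  shows "(\<integral>\<^sup>+t. ennreal (exp (- \<alpha> * t)) * indicator {a..<b} t \<partial>lborel)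
    = ennreal ((exp (- \<alpha> * a) - exp (- \<alpha> * b)) / \<alpha>)"
proof -
  have "(\<integral>\<^sup>+t. ennreal (exp (- \<alpha> * t)) * indicator {a..<b} t \<partial>lborel)
    = (\<integral>\<^sup>+t. ennreal (exp (- \<alpha> * t)) * indicator {a..b} t \<partial>lborel)"
    by (intro nn_integral_cong_AE eventually_mono[OF AE_lborel_singleton[of b]])
       (auto split: split_indicator)
  also have "\<dots> = ennreal (- exp (- \<alpha> * b) / \<alpha> - (- exp (- \<alpha> * a) / \<alpha>))"
    using assms by (intro nn_integral_FTC_Icc) (auto intro!: derivative_eq_intros)
  finally show ?thesis by (simp add: diff_divide_distrib)
qed

text \<open>Replaces \<open>LEAST\<close> by countable quantifiers over comparisons of jump times, a
  form from which measurability can be read off.\<close>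

lemma walk_at_eq_Some_iff:
  "walk_at G s t = Some y \<longleftrightarrow>
    (\<exists>k. t < jump_time G s (Suc k) \<and> (\<forall>j<k. \<not> t < jump_time G s (Suc j)) \<and> fst s k = y)"
proof
  assume "walk_at G s t = Some y"
  then obtain k where k: "t < jump_time G s (Suc k)" and y: "fst s (LEAST k. t < jump_time G s (Suc k)) = y"
    by (auto simp: walk_at_def split: if_splits)
  show "\<exists>k. t < jump_time G s (Suc k) \<and> (\<forall>j<k. \<not> t < jump_time G s (Suc j)) \<and> fst s k = y"
    using LeastI[of "\<lambda>k. t < jump_time G s (Suc k)", OF k] not_less_Least y by blast
next
  assume "\<exists>k. t < jump_time G s (Suc k) \<and> (\<forall>j<k. \<not> t < jump_time G s (Suc j)) \<and> fst s k = y"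
  then obtain k where k: "t < jump_time G s (Suc k)" "\<And>j. j < k \<Longrightarrow> \<not> t < jump_time G s (Suc j)" "fst s k = y"
    by blast
  have "(LEAST k. t < jump_time G s (Suc k)) = k"
    by (rule Least_equality) (use k in \<open>auto simp: not_less[symmetric]\<close>)
  then show "walk_at G s t = Some y" using k by (auto simp: walk_at_def)
qed

context jump_chain begin

lemma walk_law_eq: "walk_law G x = chain_law G x \<Otimes>\<^sub>M holding_law"
  by (simp add: walk_law_def holding_law_def)

lemma sets_walk_law [measurable_cong, simp]:
  "sets (walk_law G x) = sets walk_space"
  unfolding walk_law_eq by (intro sets_pair_measure_cong) (simp_all add: sets_holding_law)

lemma space_walk_law [simp]: "space (walk_law G x) = UNIV"
  by (simp add: walk_law_eq space_pair_measure)

lemma pair_prob_space_walk: "pair_prob_space (chain_law G x) holding_law"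
  by (intro pair_prob_space.intro pair_sigma_finite.intro prob_space_imp_sigma_finite prob_space_chain_law prob_space_holding_law)

lemma prob_space_walk_law: "prob_space (walk_law G x)"
  unfolding walk_law_eq
  by (rule prob_space_pair) (rule prob_space_chain_law prob_space_holding_law)+

lemma AE_walk_law_pos: "AE s in walk_law G x. \<forall>i. 0 < snd s i"
proof -
  interpret pair_prob_space "chain_law G x" holding_law by (rule pair_prob_space_walk)
  show ?thesis unfolding walk_law_eq
  proof (rule AE_pair_measure)
    show "{s \<in> space (chain_law G x \<Otimes>\<^sub>M holding_law). \<forall>i. 0 < snd s i} \<in> sets (chain_law G x \<Otimes>\<^sub>M holding_law)"
      by measurable
  qed (use AE_holding_law_pos in auto)
qed

lemma nn_integral_walk_law:
  assumes "F \<in> borel_measurable (walk_law G x)"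
  shows "(\<integral>\<^sup>+s. F s \<partial>walk_law G x) = (\<integral>\<^sup>+Z. \<integral>\<^sup>+E. F (Z, E) \<partial>holding_law \<partial>chain_law G x)"
proof -
  interpret pair_prob_space "chain_law G x" holding_law by (rule pair_prob_space_walk)
  show ?thesis
    using assms unfolding walk_law_eq by (simp add: M2.nn_integral_fst)
qed

lemma measurable_jump_time [measurable]: "(\<lambda>s. jump_time G s k) \<in> borel_measurable walk_space"
  unfolding jump_time_def by measurable

lemma measurable_path_in [measurable]: "Measurable.pred walk_space (\<lambda>s. path_in (A :: 's set) y k (fst s))"
  unfolding path_in_def by measurable

lemma measurable_hold [measurable]:
  assumes [measurable]: "f \<in> borel_measurable borel"
  shows "(\<lambda>s. hold G f s k) \<in> borel_measurable walk_space"
proof -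
  have "(\<lambda>s. hold G f s k)
    = (\<lambda>s. \<integral>\<^sup>+t. (if jump_time G s k \<le> t \<and> t < jump_time G s (Suc k) then f t else 0) \<partial>lborel)"
    by (intro ext nn_integral_cong) (auto split: split_indicator)
  also have "\<dots> \<in> borel_measurable walk_space"
    by measurable
  finally show ?thesis .
qed

lemma jump_time_Suc: "jump_time G s (Suc k) = jump_time G s k + snd s k / rate G (fst s k)"
  by (simp add: jump_time_def)

lemma jump_time_less_Suc: "0 < snd s k \<Longrightarrow> jump_time G s k < jump_time G s (Suc k)"
  by (simp add: jump_time_Suc rate_pos)

lemma jump_time_mono:
  assumes "\<forall>i. 0 < snd s i" "j \<le> k"
  shows "jump_time G s j \<le> jump_time G s k"
  using assms(2)
  by (rule lift_Suc_mono_le[rotated]) (simp add: assms(1) jump_time_less_Suc less_imp_le)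

lemma jump_time_nonneg: "\<forall>i. 0 < snd s i \<Longrightarrow> 0 \<le> jump_time G s k"
  using jump_time_mono[of s 0 k] by (simp add: jump_time_def)

text \<open>Jump times are almost surely nonnegative, so integrands have to be compared for
  nonnegative times only. Later splittings of the time axis may behave arbitrarily at negative
  times.\<close>

lemma occ_mono:
  assumes "A \<subseteq> B" "\<And>t. 0 \<le> t \<Longrightarrow> f t \<le> g t"
  shows "occ G A f y x \<le> occ G B g y x"
  unfolding occ_def
proof (intro nn_integral_mono_AE eventually_mono[OF AE_walk_law_pos])
  fix s :: "(nat \<Rightarrow> 's) \<times> (nat \<Rightarrow> real)" assume pos: "\<forall>i. 0 < snd s i"
  have "path_in B y k Z" if "path_in A y k Z" for k and Z :: "nat \<Rightarrow> 's"
    using that assms(1) by (auto simp: path_in_def)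
  moreover have "hold G f s k \<le> hold G g s k" for k
    using jump_time_nonneg[OF pos, of k] assms(2)
    by (intro nn_integral_mono) (auto split: split_indicator)
  ultimately show "(\<Sum>k. if path_in A y k (fst s) then hold G f s k else 0)
    \<le> (\<Sum>k. if path_in B y k (fst s) then hold G g s k else 0)"
    by (intro suminf_le) auto
qed

lemma occ_cong:
  assumes "\<And>t. 0 \<le> t \<Longrightarrow> f t = g t"
  shows "occ G A f y x = occ G A g y x"
  by (intro antisym occ_mono) (simp_all add: assms)

lemma occ_add:
  assumes [measurable]: "f \<in> borel_measurable borel" "g \<in> borel_measurable borel"
  shows "occ G A (\<lambda>t. f t + g t) y x = occ G A f y x + occ G A g y x"
  unfolding occ_def
proof (subst nn_integral_add[symmetric], measurable, rule nn_integral_cong)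
  fix s :: "(nat \<Rightarrow> 's) \<times> (nat \<Rightarrow> real)"
  have "(\<integral>\<^sup>+t. (f t + g t) * indicator I t \<partial>lborel)
    = (\<integral>\<^sup>+t. f t * indicator I t \<partial>lborel) + (\<integral>\<^sup>+t. g t * indicator I t \<partial>lborel)"
    if [measurable]: "I \<in> sets borel" for I
    by (subst nn_integral_add[symmetric]) (auto simp: distrib_right)
  then show "(\<Sum>k. if path_in A y k (fst s) then hold G (\<lambda>t. f t + g t) s k else 0)
    = (\<Sum>k. if path_in A y k (fst s) then hold G f s k else 0)
    + (\<Sum>k. if path_in A y k (fst s) then hold G g s k else 0)"
    by (subst suminf_add[OF summableI summableI]) (auto intro!: suminf_cong)
qed

text \<open>A path with \<open>k\<close> jumps meets finitely many states, so if it lies in the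
  union of an increasing sequence it lies in one member; monotone convergence does the rest. Used to
  exhaust the lattice by boxes and to let a discount tend to zero.\<close>

lemma occ_SUP:
  assumes [measurable]: "\<And>n. f n \<in> borel_measurable borel"
    and f: "incseq f" and A: "incseq A"
  shows "occ G (\<Union>n. A n) (\<lambda>t. SUP n. f n t) y x = (SUP n. occ G (A n) (f n) y x)"
proof -
  let ?H = "\<lambda>n s k. hold G (f n) s k"
  let ?c = "\<lambda>n s k. if path_in (A n) y k (fst s) then ?H n s k else 0"
  have H_mono: "?H m s k \<le> ?H n s k" if "m \<le> n" for m n s k
    using f that by (intro nn_integral_mono mult_right_mono) (auto simp: incseq_def le_fun_def)
  have path_mono: "path_in (A n) y k Z" if "path_in (A m) y k Z" "m \<le> n" for m n k and Z :: "nat \<Rightarrow> 's"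
    using A that by (auto simp: path_in_def incseq_def)
  have c_mono: "?c m s k \<le> ?c n s k" if "m \<le> n" for m n s k
    using H_mono[OF that, of s k] path_mono[OF _ that, of k "fst s"] by auto
  have c: "(if path_in (\<Union>n. A n) y k (fst s) then hold G (\<lambda>t. SUP n. f n t) s k else 0)
     = (SUP n. ?c n s k)" for s k
  proof (cases "path_in (\<Union>n. A n) y k (fst s)")
    case True
    then have "\<forall>i\<in>{..k}. \<exists>n. fst s i \<in> A n"
      by (auto simp: path_in_def)
    from bchoice[OF this] obtain N where N: "\<And>i. i \<le> k \<Longrightarrow> fst s i \<in> A (N i)"
      by auto
    define n0 where "n0 = Max (N ` {..k})"
    have "N i \<le> n0" if "i \<le> k" for i unfolding n0_def using that by (intro Max_ge) auto
    then have "fst s i \<in> A n0" if "i \<le> k" for i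
      using N[OF that] A that unfolding incseq_def by blast
    then have n0: "path_in (A n0) y k (fst s)"
      using True by (auto simp: path_in_def)
    have "hold G (\<lambda>t. SUP n. f n t) s k = (SUP n. ?H n s k)"
      using f by (subst nn_integral_monotone_convergence_SUP[symmetric])
        (auto simp: incseq_def le_fun_def SUP_mult_right_ennreal intro!: mult_right_mono)
    also have "\<dots> = (SUP n. ?c n s k)"
    proof (rule antisym)
      show "(SUP n. ?H n s k) \<le> (SUP n. ?c n s k)"
      proof (rule SUP_least)
        fix m
        have "?H m s k \<le> ?H (max m n0) s k" by (rule H_mono) simp
        also have "\<dots> = ?c (max m n0) s k" using path_mono[OF n0] by simp
        also have "\<dots> \<le> (SUP n. ?c n s k)" by (rule SUP_upper) simp
        finally show "?H m s k \<le> (SUP n. ?c n s k)" .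
      qed
      show "(SUP n. ?c n s k) \<le> (SUP n. ?H n s k)" by (rule SUP_mono) auto
    qed
    finally show ?thesis using True by simp
  next
    case False
    then have "\<not> path_in (A n) y k (fst s)" for n by (auto simp: path_in_def)
    with False show ?thesis by simp
  qed
  have "occ G (\<Union>n. A n) (\<lambda>t. SUP n. f n t) y x = (\<integral>\<^sup>+s. (SUP n. \<Sum>k. ?c n s k) \<partial>walk_law G x)"
    unfolding occ_def c
    by (intro nn_integral_cong ennreal_suminf_SUP_eq) (auto intro!: incseq_SucI c_mono)
  also have "\<dots> = (SUP n. \<integral>\<^sup>+s. (\<Sum>k. ?c n s k) \<partial>walk_law G x)"
  proof (rule nn_integral_monotone_convergence_SUP)
    show "incseq (\<lambda>n s. \<Sum>k. ?c n s k)"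
      by (intro incseq_SucI le_funI suminf_le c_mono summableI) simp
  qed measurable
  finally show ?thesis unfolding occ_def .
qed

end

section \<open>Occupation times as time integrals, and the equation for their discounted
  versions\<close>

context jump_chain begin

lemma walk_at_eqI:
  assumes "\<forall>i. 0 < snd s i" "jump_time G s k \<le> t" "t < jump_time G s (Suc k)"
  shows "walk_at G s t = Some (fst s k)"
  unfolding walk_at_eq_Some_iff
proof (intro exI[of _ k] conjI allI impI)
  fix j assume "j < k"
  then show "\<not> t < jump_time G s (Suc j)"
    using jump_time_mono[OF assms(1), of "Suc j" k] assms(2) by simp
qed (use assms in auto)

lemma walk_at_SomeE:
  assumes "walk_at G s t = Some y" "0 \<le> t"
  obtains k where "jump_time G s k \<le> t" "t < jump_time G s (Suc k)" "fst s k = y"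
proof -
  from assms(1) obtain k where k: "t < jump_time G s (Suc k)" "\<forall>j<k. \<not> t < jump_time G s (Suc j)" "fst s k = y"
    unfolding walk_at_eq_Some_iff by blast
  moreover have "jump_time G s k \<le> t"
    using k(2) assms(2) by (cases k) (auto simp: jump_time_def)
  ultimately show ?thesis using that by blast
qed

lemma measurable_walk_at [measurable]:
  "Measurable.pred (walk_space \<Otimes>\<^sub>M borel)
    (\<lambda>p. walk_at G (fst p) (snd p) = Some y)"
  unfolding walk_at_eq_Some_iff by measurable

text \<open>The holding intervals are disjoint, so at most one summand survives. After an explosion
  no interval contains \<open>t\<close>, which agrees with the walk being at
  \<open>None\<close>.\<close>

lemma suminf_hold_eq:
  fixes f :: "real \<Rightarrow> ennreal"
  assumes pos: "\<forall>i. 0 < snd s i"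
  shows "(\<Sum>k. if fst s k = y then f t * indicator {jump_time G s k..<jump_time G s (Suc k)} t else 0)
    = f t * indicator {0..} t * indicator {t. walk_at G s t = Some y} t"
proof (cases "0 \<le> t \<and> walk_at G s t = Some y")
  case True
  then obtain k where k: "jump_time G s k \<le> t" "t < jump_time G s (Suc k)" "fst s k = y"
    using walk_at_SomeE by blast
  have "\<not> (jump_time G s j \<le> t \<and> t < jump_time G s (Suc j))" if "j \<noteq> k" for j
    using jump_time_mono[OF pos, of "Suc j" k] jump_time_mono[OF pos, of "Suc k" j] k that
    by (cases "j < k") (auto simp: Suc_le_eq)
  then have "(\<Sum>k. if fst s k = y then f t * indicator {jump_time G s k..<jump_time G s (Suc k)} t else 0)
    = (\<Sum>j\<in>{k}. if fst s j = y then f t * indicator {jump_time G s j..<jump_time G s (Suc j)} t else 0)"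
    by (intro suminf_finite) auto
  then show ?thesis using k True by simp
next
  case False
  have "(if fst s k = y then f t * indicator {jump_time G s k..<jump_time G s (Suc k)} t else 0) = 0" for k
    using False walk_at_eqI[OF pos, of k t] jump_time_nonneg[OF pos, of k] by (auto split: split_indicator)
  then show ?thesis using False by (auto split: split_indicator)
qed

text \<open>Tonelli over paths and times. The law at a fixed time does not see killing, hence the
  identity concerns \<open>UNIV\<close>; killed walks are compared with it by monotonicity. This is
  where heat kernel bounds can enter.\<close>

lemma occ_UNIV_eq:
  assumes [measurable]: "f \<in> borel_measurable borel"
  shows "occ G UNIV f y x = (\<integral>\<^sup>+t. f t * indicator {0..} t *
    emeasure (walk_law G x) {s \<in> space (walk_law G x). walk_at G s t = Some y} \<partial>lborel)"
proof -
  interpret W: prob_space "walk_law G x" by (rule prob_space_walk_law)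
  interpret P: pair_sigma_finite "walk_law G x" lborel ..
  have "occ G UNIV f y x
    = (\<integral>\<^sup>+s. \<integral>\<^sup>+t. f t * indicator {0..} t * indicator {t. walk_at G s t = Some y} t \<partial>lborel \<partial>walk_law G x)"
    unfolding occ_def
  proof (intro nn_integral_cong_AE eventually_mono[OF AE_walk_law_pos])
    fix s :: "(nat \<Rightarrow> 's) \<times> (nat \<Rightarrow> real)" assume pos: "\<forall>i. 0 < snd s i"
    have "(\<Sum>k. if path_in UNIV y k (fst s) then hold G f s k else 0)
      = (\<Sum>k. \<integral>\<^sup>+t. (if fst s k = y then f t * indicator {jump_time G s k..<jump_time G s (Suc k)} t else 0) \<partial>lborel)"
      by (intro suminf_cong) (auto simp: path_in_def)
    also have "\<dots> = (\<integral>\<^sup>+t. (\<Sum>k. if fst s k = y then f t * indicator {jump_time G s k..<jump_time G s (Suc k)} t else 0) \<partial>lborel)"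
      by (rule nn_integral_suminf[symmetric]) measurable
    finally show "(\<Sum>k. if path_in UNIV y k (fst s) then hold G f s k else 0)
      = (\<integral>\<^sup>+t. f t * indicator {0..} t * indicator {t. walk_at G s t = Some y} t \<partial>lborel)"
      by (simp only: suminf_hold_eq[OF pos])
  qed
  also have "\<dots> = (\<integral>\<^sup>+t. \<integral>\<^sup>+s. f t * indicator {0..} t * indicator {t. walk_at G s t = Some y} t \<partial>walk_law G x \<partial>lborel)"
  proof (rule P.Fubini'[symmetric])
    have "(\<lambda>p. f (snd p) * indicator {0..} (snd p) * (if walk_at G (fst p) (snd p) = Some y then 1 else 0))
      \<in> borel_measurable (walk_law G x \<Otimes>\<^sub>M lborel)"
      by measurable
    then show "case_prod (\<lambda>s t. f t * indicator {0..} t * indicator {t. walk_at G s t = Some y} t)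
      \<in> borel_measurable (walk_law G x \<Otimes>\<^sub>M lborel)"
      by (rule back_subst[of "\<lambda>h. h \<in> _"]) (auto split: split_indicator)
  qed
  also have "\<dots> = (\<integral>\<^sup>+t. f t * indicator {0..} t *
    emeasure (walk_law G x) {s \<in> space (walk_law G x). walk_at G s t = Some y} \<partial>lborel)"
  proof (intro nn_integral_cong)
    fix t :: real
    have meas: "{s. walk_at G s t = Some y} \<in> sets (walk_law G x)"
    proof -
      have "Measurable.pred (walk_law G x) (\<lambda>s. walk_at G (fst (s, t)) (snd (s, t)) = Some y)"
        by (rule measurable_compose[OF _ measurable_walk_at]) measurable
      then show ?thesis by (simp add: pred_def)
    qed
    have "(\<integral>\<^sup>+s. f t * indicator {0..} t * indicator {t. walk_at G s t = Some y} t \<partial>walk_law G x)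
      = (\<integral>\<^sup>+s. (f t * indicator {0..} t) * indicator {s. walk_at G s t = Some y} s \<partial>walk_law G x)"
      by (intro nn_integral_cong) (auto split: split_indicator)
    then show "(\<integral>\<^sup>+s. f t * indicator {0..} t * indicator {t. walk_at G s t = Some y} t \<partial>walk_law G x)
      = f t * indicator {0..} t * emeasure (walk_law G x) {s \<in> space (walk_law G x). walk_at G s t = Some y}"
      by (simp add: nn_integral_cmult_indicator[OF meas])
  qed
  finally show ?thesis .
qed

text \<open>Given the jump chain, the discounted length of the \<open>k\<close>-th holding interval
  is \<open>1 / \<alpha>\<close> times a product of functions of distinct holding times: one
  discount for each earlier interval and \<open>1 - exp (- c k * E k)\<close> for the current one.
  Independence turns the expectation into a product.\<close>

lemma nn_integral_holding_law_exp:
  assumes "0 < \<alpha>"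
  shows "(\<integral>\<^sup>+E. hold G (\<lambda>t. ennreal (exp (- \<alpha> * t))) (Z, E) k \<partial>holding_law)
    = (\<Prod>i<k. ennreal (rate G (Z i) / (rate G (Z i) + \<alpha>))) * ennreal (1 / (rate G (Z k) + \<alpha>))"
proof -
  define c where "c i = \<alpha> / rate G (Z i)" for i
  let ?\<phi> = "\<lambda>i t. if i < k then ennreal (exp (- c i * t)) else ennreal (1 - exp (- c i * t))"
  have c: "0 < c i" for i using assms rate_pos by (simp add: c_def)
  have eq: "hold G (\<lambda>t. ennreal (exp (- \<alpha> * t))) (Z, E) k
    = ennreal (1 / \<alpha>) * (\<Prod>i<Suc k. ?\<phi> i (E i))" if pos: "\<forall>i. 0 < E i" for E
  proof -
    have J: "exp (- \<alpha> * jump_time G (Z, E) k) = (\<Prod>i<k. exp (- c i * E i))"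
    proof -
      have "\<alpha> * jump_time G (Z, E) k = (\<Sum>i<k. c i * E i)"
        unfolding jump_time_def sum_distrib_left by (intro sum.cong) (auto simp: c_def)
      then show ?thesis by (simp add: exp_sum[symmetric] sum_negf)
    qed
    have "exp (- \<alpha> * jump_time G (Z, E) k) - exp (- \<alpha> * jump_time G (Z, E) (Suc k))
      = (\<Prod>i<k. exp (- c i * E i)) * (1 - exp (- c k * E k))"
      unfolding J[symmetric] jump_time_Suc by (simp add: c_def algebra_simps exp_add[symmetric])
    moreover have "0 \<le> 1 - exp (- c k * E k)"
      using c[of k] pos by (simp add: less_imp_le)
    ultimately have "ennreal ((exp (- \<alpha> * jump_time G (Z, E) k) - exp (- \<alpha> * jump_time G (Z, E) (Suc k))) / \<alpha>)
       = ennreal (1 / \<alpha>) * ((\<Prod>i<k. ennreal (exp (- c i * E i))) * ennreal (1 - exp (- c k * E k)))"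
      using assms by (simp add: prod_ennreal ennreal_mult[symmetric] prod_nonneg)
    moreover have "jump_time G (Z, E) k \<le> jump_time G (Z, E) (Suc k)"
      using jump_time_less_Suc[of "(Z, E)" k] pos by simp
    ultimately show ?thesis
      by (simp add: nn_integral_exp_Ico[OF assms, simplified])
  qed
  have "(\<integral>\<^sup>+E. hold G (\<lambda>t. ennreal (exp (- \<alpha> * t))) (Z, E) k \<partial>holding_law)
    = (\<integral>\<^sup>+E. ennreal (1 / \<alpha>) * (\<Prod>i<Suc k. ?\<phi> i (E i)) \<partial>holding_law)"
    by (intro nn_integral_cong_AE eventually_mono[OF AE_holding_law_pos] eq)
  also have "\<dots> = ennreal (1 / \<alpha>) * (\<integral>\<^sup>+E. (\<Prod>i<Suc k. ?\<phi> i (E i)) \<partial>holding_law)"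
    by (rule nn_integral_cmult) measurable
  also have "(\<integral>\<^sup>+E. (\<Prod>i<Suc k. ?\<phi> i (E i)) \<partial>holding_law) = (\<Prod>i<Suc k. \<integral>\<^sup>+t. ?\<phi> i t \<partial>std_exponential)"
    by (rule nn_integral_holding_law_prod) measurable
  also have "\<dots> = (\<Prod>i<k. ennreal (1 / (1 + c i))) * ennreal (c k / (1 + c k))"
  proof -
    have "(\<integral>\<^sup>+t. ennreal (exp (- c i * t)) \<partial>std_exponential) = ennreal (1 / (1 + c i))" for i
      using c[of i] by (intro nn_integral_exponential_exp) simp
    moreover have "(\<integral>\<^sup>+t. ennreal (1 - exp (- c k * t)) \<partial>std_exponential) = ennreal (c k / (1 + c k))"
      using c[of k] by (intro nn_integral_exponential_one_minus_exp) simp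
    ultimately show ?thesis by simp
  qed
  also have "ennreal (1 / \<alpha>) * \<dots> = (\<Prod>i<k. ennreal (1 / (1 + c i))) * (ennreal (1 / \<alpha>) * ennreal (c k / (1 + c k)))"
    by (rule mult.left_commute)
  also have "ennreal (1 / \<alpha>) * ennreal (c k / (1 + c k)) = ennreal (1 / \<alpha> * (c k / (1 + c k)))"
    using assms c[of k] by (intro ennreal_mult[symmetric]) (auto simp: less_imp_le)
  also have "1 / \<alpha> * (c k / (1 + c k)) = 1 / (rate G (Z k) + \<alpha>)"
    using assms rate_pos[of "Z k"] by (simp add: c_def divide_simps add_pos_pos)
  also have "(\<Prod>i<k. ennreal (1 / (1 + c i))) = (\<Prod>i<k. ennreal (rate G (Z i) / (rate G (Z i) + \<alpha>)))"
  proof (rule prod.cong)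
    show "ennreal (1 / (1 + c i)) = ennreal (rate G (Z i) / (rate G (Z i) + \<alpha>))" for i
      using assms rate_pos[of "Z i"] by (simp add: c_def divide_simps)
  qed simp
  finally show ?thesis .
qed

text \<open>With \<open>b\<close> the discounted stay at \<open>y\<close> and \<open>T\<close> one
  discounted jump inside \<open>A\<close>, the contribution of visits after exactly \<open>k\<close>
  jumps is \<open>T^k b\<close>. The sum \<open>u\<close> of this Neumann series satisfies
  \<open>u = b + T u\<close>, which gives first step analysis without a Markov property on path
  space.\<close>

lemma occ_exp_eq:
  fixes A :: "'s set" and y :: 's
  assumes \<alpha>: "0 < \<alpha>"
  defines "u \<equiv> occ G A (\<lambda>t. ennreal (exp (- \<alpha> * t))) y"
  shows "u x = indicator A x * (ennreal (1 / (rate G x + \<alpha>)) * indicator {y} x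
    + ennreal (rate G x / (rate G x + \<alpha>)) * (\<integral>\<^sup>+z. u z \<partial>jump_kernel G x))"
proof -
  define a where "a z = indicator A z * ennreal (rate G z / (rate G z + \<alpha>))" for z
  define b where "b z = indicator A z * (ennreal (1 / (rate G z + \<alpha>)) * indicator {y} z)" for z
  define T where "T f z = a z * (\<integral>\<^sup>+w. f w \<partial>jump_kernel G z)" for f z
  let ?H = "\<lambda>k s. hold G (\<lambda>t. ennreal (exp (- \<alpha> * t))) s k"
  have H: "(\<integral>\<^sup>+s. (if path_in A y k (fst s) then ?H k s else 0) \<partial>walk_law G x) = (T ^^ k) b x" for k x
  proof -
    have "(\<lambda>s. if path_in A y k (fst s) then ?H k s else 0) \<in> borel_measurable (walk_law G x)"
      by measurable
    then have "(\<integral>\<^sup>+s. (if path_in A y k (fst s) then ?H k s else 0) \<partial>walk_law G x)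
      = (\<integral>\<^sup>+Z. \<integral>\<^sup>+E. (if path_in A y k Z then ?H k (Z, E) else 0) \<partial>holding_law \<partial>chain_law G x)"
      by (subst nn_integral_walk_law) simp_all
    also have "\<dots> = (\<integral>\<^sup>+Z. (\<Prod>i<k. a (Z i)) * b (Z k) \<partial>chain_law G x)"
    proof (rule nn_integral_cong)
      fix Z :: "nat \<Rightarrow> 's"
      have "(\<integral>\<^sup>+E. (if path_in A y k Z then ?H k (Z, E) else 0) \<partial>holding_law)
        = (if path_in A y k Z then (\<Prod>i<k. ennreal (rate G (Z i) / (rate G (Z i) + \<alpha>))) * ennreal (1 / (rate G (Z k) + \<alpha>)) else 0)"
        using nn_integral_holding_law_exp[OF \<alpha>, of Z k] by (cases "path_in A y k Z") simp_all
      also have "\<dots> = (\<Prod>i<k. a (Z i)) * b (Z k)"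
      proof (cases "\<forall>i\<le>k. Z i \<in> A")
        case True
        then show ?thesis by (simp add: a_def b_def path_in_def split: split_indicator)
      next
        case False
        then obtain i where i: "i \<le> k" "Z i \<notin> A" by blast
        have "(\<Prod>i<k. a (Z i)) * b (Z k) = 0"
        proof (cases "i = k")
          case True
          then show ?thesis using i by (simp add: b_def)
        next
          case False
          then have "(\<Prod>i<k. a (Z i)) = 0"
            using i by (intro prod_zero bexI[of _ i]) (auto simp: a_def)
          then show ?thesis by simp
        qed
        moreover have "\<not> path_in A y k Z" using i by (auto simp: path_in_def)
        ultimately show ?thesis by (simp only: if_False)
      qed
      finally show "(\<integral>\<^sup>+E. (if path_in A y k Z then ?H k (Z, E) else 0) \<partial>holding_law) = (\<Prod>i<k. a (Z i)) * b (Z k)" .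
    qed
    also have "\<dots> = (T ^^ k) b x"
      using nn_integral_chain_law_prod[where a=a and b=b and k=k and x=x] unfolding T_def[abs_def] by simp
    finally show ?thesis .
  qed
  have u: "u x = (\<Sum>k. (T ^^ k) b x)" for x
    unfolding u_def occ_def H[symmetric] by (rule nn_integral_suminf) measurable
  have "u x = (T ^^ 0) b x + (\<Sum>k. (T ^^ Suc k) b x)"
    unfolding u using suminf_offset[of "\<lambda>k. (T ^^ k) b x" 1] by (simp add: add.commute)
  also have "(\<Sum>k. (T ^^ Suc k) b x) = (\<Sum>k. a x * (\<integral>\<^sup>+w. (T ^^ k) b w \<partial>jump_kernel G x))"
    by (simp add: T_def)
  also have "\<dots> = a x * (\<Sum>k. \<integral>\<^sup>+w. (T ^^ k) b w \<partial>jump_kernel G x)"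
    by simp
  also have "(\<Sum>k. \<integral>\<^sup>+w. (T ^^ k) b w \<partial>jump_kernel G x) = (\<integral>\<^sup>+w. u w \<partial>jump_kernel G x)"
    unfolding u by (rule nn_integral_suminf[symmetric]) simp
  finally show ?thesis
    by (auto simp: a_def b_def split: split_indicator)
qed

lemma occ_exp_le:
  assumes "0 < \<alpha>"
  shows "occ G A (\<lambda>t. ennreal (exp (- \<alpha> * t))) y x \<le> ennreal (1 / \<alpha>)"
proof -
  interpret W: prob_space "walk_law G x" by (rule prob_space_walk_law)
  have "occ G A (\<lambda>t. ennreal (exp (- \<alpha> * t))) y x \<le> occ G UNIV (\<lambda>t. ennreal (exp (- \<alpha> * t))) y x"
    by (rule occ_mono) auto
  also have "\<dots> \<le> (\<integral>\<^sup>+t. ennreal (exp (- \<alpha> * t)) * indicator {0..} t * 1 \<partial>lborel)"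
    by (subst occ_UNIV_eq) (simp, intro nn_integral_mono mult_left_mono W.emeasure_le_1, simp)
  also have "\<dots> = ennreal (1 / \<alpha>)"
  proof -
    have "(\<integral>\<^sup>+t. ennreal (exp (- \<alpha> * t)) * indicator {0..} t \<partial>lborel) = ennreal (0 - (- exp (- \<alpha> * 0) / \<alpha>))"
    proof (rule nn_integral_FTC_atLeast)
      show "((\<lambda>t. - exp (- \<alpha> * t) / \<alpha>) \<longlongrightarrow> 0) at_top"
        using assms by real_asymp
    qed (use assms in \<open>auto intro!: derivative_eq_intros\<close>)
    then show ?thesis by simp
  qed
  finally show ?thesis .
qed

lemma occ_one_eq_SUP:
  "occ G A (\<lambda>_. 1) y x = (SUP n. occ G A (\<lambda>t. ennreal (exp (- (1 / real (Suc n)) * t))) y x)"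
proof -
  \<comment> \<open>At negative times the exponentials decrease in \<open>n\<close>. Replacing
    \<open>t\<close> by \<open>max 0 t\<close> makes the sequence monotone on the whole line and
    changes nothing at the times that matter.\<close>
  let ?f = "\<lambda>n t. ennreal (exp (- (1 / real (Suc n)) * max 0 t))"
  have inc: "incseq ?f"
    by (intro incseq_SucI le_funI ennreal_leI) (auto simp: divide_simps intro!: mult_left_mono)
  have "(SUP n. ?f n t) = 1" for t
  proof (rule LIMSEQ_unique[OF LIMSEQ_SUP])
    show "incseq (\<lambda>n. ?f n t)" using inc by (auto simp: incseq_def le_fun_def)
    have "(\<lambda>n. exp (- (1 / real (Suc n)) * max 0 t)) \<longlonglongrightarrow> exp (- 0 * max 0 t)"
      by (intro tendsto_intros LIMSEQ_inverse_real_of_nat[unfolded inverse_eq_divide])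
    then show "(\<lambda>n. ?f n t) \<longlonglongrightarrow> 1" by (simp flip: ennreal_1)
  qed
  then have "occ G A (\<lambda>_. 1) y x = occ G (\<Union>n::nat. A) (\<lambda>t. SUP n. ?f n t) y x" by simp
  also have "\<dots> = (SUP n. occ G A (?f n) y x)"
    by (rule occ_SUP) (use inc in \<open>auto simp: incseq_def\<close>)
  also have "\<dots> = (SUP n. occ G A (\<lambda>t. ennreal (exp (- (1 / real (Suc n)) * t))) y x)"
    by (intro SUP_cong occ_cong) auto
  finally show ?thesis .
qed

end

section \<open>Change of time, and the exit time in the Green function\<close>

lemma nn_integral_hold_one:
  assumes "jump_chain G" "0 < snd s k"
  shows "hold G (\<lambda>_. 1) s k = ennreal (snd s k / rate G (fst s k))"
  using jump_chain.jump_time_less_Suc[OF assms] jump_chain.jump_time_Suc[OF assms(1), of s k]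
  by simp

text \<open>Both walks are functions of the same jump chain and holding variables. With a constant
  integrand only the lengths of the stays at \<open>y\<close> count, not when they occur, so the
  ratio of the rates at the single state \<open>y\<close> suffices.\<close>

lemma occ_time_change:
  assumes G: "jump_chain G" and H: "jump_chain H"
    and kernel: "jump_kernel G = jump_kernel H" and rate: "rate G y = c * rate H y" and c: "0 < c"
  shows "occ H A (\<lambda>_. 1) y x = ennreal c * occ G A (\<lambda>_. 1) y x"
proof -
  have "chain_kernel G x = chain_kernel H x"
    by (intro ext) (simp add: chain_kernel_def kernel)
  then have law: "walk_law G x = walk_law H x"
    by (simp add: walk_law_def chain_law_def)
  have "occ H A (\<lambda>_. 1) y x = (\<integral>\<^sup>+s. ennreal c * (\<Sum>k. if path_in A y k (fst s) then hold G (\<lambda>_. 1) s k else 0) \<partial>walk_law G x)"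
    unfolding occ_def law[symmetric]
  proof (intro nn_integral_cong_AE eventually_mono[OF jump_chain.AE_walk_law_pos[OF G]])
    fix s :: "(nat \<Rightarrow> 'a) \<times> (nat \<Rightarrow> real)" assume pos: "\<forall>i. 0 < snd s i"
    have "ennreal (snd s k / rate H (fst s k)) = ennreal c * ennreal (snd s k / rate G (fst s k))"
      if "path_in A y k (fst s)" for k
      using that rate c jump_chain.rate_pos[OF H, of y] pos
      by (subst ennreal_mult[symmetric]) (auto simp: path_in_def less_imp_le field_simps)
    then have "(if path_in A y k (fst s) then ennreal (snd s k / rate H (fst s k)) else 0)
      = ennreal c * (if path_in A y k (fst s) then ennreal (snd s k / rate G (fst s k)) else 0)" for k
      by (cases "path_in A y k (fst s)") auto
    then show "(\<Sum>k. if path_in A y k (fst s) then hold H (\<lambda>_. 1) s k else 0)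
      = ennreal c * (\<Sum>k. if path_in A y k (fst s) then hold G (\<lambda>_. 1) s k else 0)"
      using pos
      by (simp only: nn_integral_hold_one[OF G] nn_integral_hold_one[OF H] ennreal_suminf_cmult spec[OF pos])
  qed
  also have "\<dots> = ennreal c * occ G A (\<lambda>_. 1) y x"
  proof -
    interpret jump_chain G by fact
    show ?thesis unfolding occ_def by (rule nn_integral_cmult) measurable
  qed
  finally show ?thesis .
qed

text \<open>Every visit before the exit time happens along a path that has stayed in \<open>\<Lambda>\<close>, because
  each holding time is positive.\<close>

lemma nn_integral_exit_le_occ:
  fixes G :: "(int ^ 'd \<Rightarrow> real) \<Rightarrow> int ^ ('d::finite) \<Rightarrow> real"
  assumes G: "jump_chain G" and y: "emb y \<in> \<Lambda>"
  shows "(\<integral>\<^sup>+s. (\<integral>\<^sup>+t. indicator {t. 0 \<le> t \<and> ereal t \<le> exit_time G \<Lambda> s \<and> walk_at G s t = Some y} t \<partial>lborel)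
     \<partial>walk_law G x) \<le> occ G (emb -` \<Lambda>) (\<lambda>_. 1) y x"
  unfolding occ_def
proof (intro nn_integral_mono_AE eventually_mono[OF jump_chain.AE_walk_law_pos[OF G]])
  interpret jump_chain G by fact
  fix s :: "(nat \<Rightarrow> int ^ 'd) \<times> (nat \<Rightarrow> real)" assume pos: "\<forall>i. 0 < snd s i"
  let ?I = "\<lambda>k t. if path_in (emb -` \<Lambda>) y k (fst s)
    then 1 * indicator {jump_time G s k..<jump_time G s (Suc k)} t else 0 :: ennreal"
  have "indicator {t. 0 \<le> t \<and> ereal t \<le> exit_time G \<Lambda> s \<and> walk_at G s t = Some y} t \<le> (\<Sum>k. ?I k t)" for t
  proof (cases "0 \<le> t \<and> ereal t \<le> exit_time G \<Lambda> s \<and> walk_at G s t = Some y")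
    case True
    then obtain k where k: "jump_time G s k \<le> t" "t < jump_time G s (Suc k)" "fst s k = y"
      using walk_at_SomeE by blast
    have "emb (fst s i) \<in> \<Lambda>" if "i \<le> k" for i
    proof (rule ccontr)
      assume i: "emb (fst s i) \<notin> \<Lambda>"
      with y k that have "i < k" by (auto simp: le_less)
      have J: "jump_time G s i < jump_time G s (Suc i)"
        using jump_time_less_Suc pos by simp
      then have "walk_at G s (jump_time G s i) = Some (fst s i)"
        by (intro walk_at_eqI[OF pos]) auto
      with i jump_time_nonneg[OF pos, of i]
      have "exit_time G \<Lambda> s \<le> ereal (jump_time G s i)"
        unfolding exit_time_def by (intro Inf_lower) auto
      also have "\<dots> < ereal (jump_time G s (Suc i))" using J by simp
      also have "\<dots> \<le> ereal (jump_time G s k)"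
        using \<open>i < k\<close> jump_time_mono[OF pos, of "Suc i" k] by (simp add: Suc_le_eq)
      also have "\<dots> \<le> ereal t" using k by simp
      finally show False using True leD by blast
    qed
    then have "?I k t = 1" using k by (auto simp: path_in_def)
    moreover have "(\<Sum>j\<in>{k}. ?I j t) \<le> (\<Sum>k. ?I k t)"
      by (rule sum_le_suminf) (auto intro: summableI)
    ultimately show ?thesis using True by simp
  qed simp
  then have "(\<integral>\<^sup>+t. indicator {t. 0 \<le> t \<and> ereal t \<le> exit_time G \<Lambda> s \<and> walk_at G s t = Some y} t \<partial>lborel)
    \<le> (\<integral>\<^sup>+t. (\<Sum>k. ?I k t) \<partial>lborel)"
    by (intro nn_integral_mono)
  also have "\<dots> = (\<Sum>k. \<integral>\<^sup>+t. ?I k t \<partial>lborel)"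
    by (rule nn_integral_suminf) measurable
  also have "\<dots> = (\<Sum>k. if path_in (emb -` \<Lambda>) y k (fst s) then hold G (\<lambda>_. 1) s k else 0)"
    by (intro suminf_cong) simp
  finally show "(\<integral>\<^sup>+t. indicator {t. 0 \<le> t \<and> ereal t \<le> exit_time G \<Lambda> s \<and> walk_at G s t = Some y} t \<partial>lborel)
    \<le> (\<Sum>k. if path_in (emb -` \<Lambda>) y k (fst s) then hold G (\<lambda>_. 1) s k else 0)" .
qed

section \<open>The resolvent of the walk on the lattice\<close>

lemma finite_int_box:
  fixes l u :: "'d::finite \<Rightarrow> int"
  shows "finite {y :: int ^ 'd. \<forall>i. l i \<le> y $ i \<and> y $ i \<le> u i}"
    and "card {y :: int ^ 'd. \<forall>i. l i \<le> y $ i \<and> y $ i \<le> u i} \<le> (\<Prod>i\<in>UNIV. nat (u i - l i + 1))"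
proof -
  let ?B = "{y :: int ^ 'd. \<forall>i. l i \<le> y $ i \<and> y $ i \<le> u i}"
  have sub: "?B \<subseteq> vec_lambda ` (PiE UNIV (\<lambda>i. {l i..u i}))"
  proof
    fix y assume "y \<in> ?B"
    then show "y \<in> vec_lambda ` (PiE UNIV (\<lambda>i. {l i..u i}))"
      by (intro image_eqI[of _ _ "vec_nth y"]) auto
  qed
  have fin: "finite (PiE (UNIV :: 'd set) (\<lambda>i. {l i..u i}))"
    by (intro finite_PiE) auto
  from finite_subset[OF sub] fin show "finite ?B" by blast
  have "card ?B \<le> card (vec_lambda ` (PiE (UNIV :: 'd set) (\<lambda>i. {l i..u i})))"
    using sub fin by (intro card_mono) auto
  also have "\<dots> \<le> card (PiE (UNIV :: 'd set) (\<lambda>i. {l i..u i}))"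
    by (rule card_image_le[OF fin])
  also have "\<dots> = (\<Prod>i\<in>UNIV. nat (u i - l i + 1))"
    by (subst card_PiE) auto
  finally show "card ?B \<le> (\<Prod>i\<in>UNIV. nat (u i - l i + 1))" .
qed

lemma nbr_commute: "nbr x y \<longleftrightarrow> nbr y x"
  by (simp add: nbr_def abs_minus_commute)

lemma not_nbr_self [simp]: "\<not> nbr x x"
  by (simp add: nbr_def)

lemma finite_nbr [simp]: "finite {y. nbr (x :: int ^ ('d::finite)) y}"
proof (rule finite_subset[OF _ finite_int_box(1)])
  show "{y. nbr x y} \<subseteq> {y. \<forall>i. x $ i - 1 \<le> y $ i \<and> y $ i \<le> x $ i + 1}"
  proof (intro subsetI CollectI allI)
    fix y i assume "y \<in> {y. nbr x y}"
    then have "\<bar>x $ i - y $ i\<bar> \<le> 1"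
      using member_le_sum[of i UNIV "\<lambda>i. \<bar>x $ i - y $ i\<bar>"] by (simp add: nbr_def)
    then show "x $ i - 1 \<le> y $ i \<and> y $ i \<le> x $ i + 1" by auto
  qed
qed

text \<open>The reversing measure of \<open>Y\<close>, with respect to which
  \<open>heat_kernel\<close> is a density. Being at least one, it dominates counting
  measure.\<close>

definition speed :: "('d::finite) env \<Rightarrow> int ^ 'd \<Rightarrow> real" where
  "speed \<omega> x = max 1 (mu \<omega> x)"

lemma speed_ge_1: "1 \<le> speed \<omega> x"
  and speed_pos [simp]: "0 < speed \<omega> x"
  and speed_neq_0 [simp]: "speed \<omega> x \<noteq> 0"
  and mu_le_speed: "mu \<omega> x \<le> speed \<omega> x"
  by (auto simp: speed_def)

lemma generatorY_eq: "generatorY \<omega> f x = generator \<omega> f x / speed \<omega> x"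
  by (simp add: generatorY_def speed_def)

lemma total_rate_generator: "total_rate (generator \<omega>) x = mu \<omega> x"
proof -
  have "(\<Sum>y | nbr x y. \<omega> {x, y} * (indicator {x} y - indicator {x} x)) = (\<Sum>y | nbr x y. - \<omega> {x, y})"
    by (intro sum.cong) (auto split: split_indicator)
  then show ?thesis by (simp add: total_rate_def generator_def mu_def sum_negf)
qed

lemma total_rate_generatorY: "total_rate (generatorY \<omega>) x = mu \<omega> x / speed \<omega> x"
  using total_rate_generator[of \<omega> x] by (simp add: total_rate_def generatorY_eq minus_divide_left)

lemma generator_indicator:
  assumes "y \<noteq> x"
  shows "generator \<omega> (indicator {y}) x = (if nbr x y then \<omega> {x, y} else 0)"
proof -
  have "(\<Sum>z | nbr x z. \<omega> {x, z} * (indicator {y} z - indicator {y} x)) = (\<Sum>z | nbr x z. if z = y then \<omega> {x, y} else 0)"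
    using assms by (intro sum.cong) (auto split: split_indicator)
  then show ?thesis by (simp add: generator_def)
qed

lemma jump_kernel_generatorY: "jump_kernel (generatorY \<omega>) = jump_kernel (generator \<omega>)"
proof
  fix x
  have "generatorY \<omega> (indicator {y}) x / total_rate (generatorY \<omega>) x
      = generator \<omega> (indicator {y}) x / total_rate (generator \<omega>) x" for y
    using speed_pos[of \<omega> x] by (simp add: generatorY_eq total_rate_generatorY total_rate_generator)
  moreover have "total_rate (generatorY \<omega>) x = 0 \<longleftrightarrow> total_rate (generator \<omega>) x = 0"
    using speed_pos[of \<omega> x] by (simp add: total_rate_generatorY total_rate_generator)
  ultimately show "jump_kernel (generatorY \<omega>) x = jump_kernel (generator \<omega>) x"
    by (simp add: jump_kernel_def cong: if_cong)
qed

text \<open>A bound for twice the hyperbolic cosine with no first order term, from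
  \<open>exp s \<le> 1 + s + s^2\<close> and
  \<open>exp (- s) \<le> 1 / (1 + s) \<le> 1 - s + s^2\<close> on the unit interval.\<close>

lemma exp_add_exp_minus_le:
  fixes s :: real
  assumes "\<bar>s\<bar> \<le> l" "l \<le> 1"
  shows "exp s + exp (- s) \<le> 2 + 2 * l\<^sup>2"
proof -
  have *: "exp s + exp (- s) \<le> 2 + 2 * s\<^sup>2" if "0 \<le> s" "s \<le> 1" for s :: real
  proof -
    have "exp (- s) \<le> 1 / (1 + s)"
      using exp_ge_add_one_self[of s] that by (simp add: exp_minus field_simps)
    also have "\<dots> \<le> 1 - s + s\<^sup>2"
      using that by (simp add: field_simps power2_eq_square)
    finally show ?thesis using exp_bound[OF that] by simp
  qed
  have "exp s + exp (- s) \<le> 2 + 2 * s\<^sup>2"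
    using *[of s] *[of "- s"] assms by (cases "0 \<le> s") auto
  also have "s\<^sup>2 \<le> l\<^sup>2"
    using power_mono[OF assms(1), of 2] by simp
  finally show ?thesis by simp
qed

locale environment =
  fixes \<omega> :: "('d::finite) env"
  assumes edge_nonneg: "e \<in> lat_edges \<Longrightarrow> 0 \<le> \<omega> e"
begin

lemma conductance_nonneg: "nbr x y \<Longrightarrow> 0 \<le> \<omega> {x, y}"
  by (rule edge_nonneg) (auto simp: lat_edges_def)

lemma mu_nonneg: "0 \<le> mu \<omega> x"
  unfolding mu_def by (intro sum_nonneg) (auto intro: conductance_nonneg)

lemma conductance_eq_0: "mu \<omega> x = 0 \<Longrightarrow> nbr x y \<Longrightarrow> \<omega> {x, y} = 0"
  unfolding mu_def by (subst (asm) sum_nonneg_eq_0_iff) (auto intro: conductance_nonneg)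

lemma nn_integral_jump_kernel_generator:
  fixes f :: "int ^ 'd \<Rightarrow> ennreal"
  assumes "mu \<omega> x \<noteq> 0"
  shows "(\<integral>\<^sup>+y. f y \<partial>jump_kernel (generator \<omega>) x) = (\<Sum>y | nbr x y. ennreal (\<omega> {x, y} / mu \<omega> x) * f y)"
proof -
  let ?w = "\<lambda>y. ennreal (if y = x then 0 else generator \<omega> (indicator {y}) x / total_rate (generator \<omega>) x)"
  have "(\<integral>\<^sup>+y. f y \<partial>jump_kernel (generator \<omega>) x) = (\<integral>\<^sup>+y. ?w y * f y \<partial>count_space UNIV)"
    using assms by (simp add: jump_kernel_def total_rate_generator point_measure_def nn_integral_density)
  also have "\<dots> = (\<Sum>y | nbr x y. ?w y * f y)"
    by (rule nn_integral_count_space') (auto simp: generator_indicator)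
  also have "\<dots> = (\<Sum>y | nbr x y. ennreal (\<omega> {x, y} / mu \<omega> x) * f y)"
    by (intro sum.cong) (auto simp: generator_indicator total_rate_generator)
  finally show ?thesis .
qed

lemma prob_space_jump_kernel_generator: "prob_space (jump_kernel (generator \<omega>) x)"
proof (cases "mu \<omega> x = 0")
  case True
  then show ?thesis by (simp add: jump_kernel_def total_rate_generator prob_space_return)
next
  case False
  have sp: "space (jump_kernel (generator \<omega>) x) = UNIV"
    by (auto simp: jump_kernel_def space_point_measure)
  have "emeasure (jump_kernel (generator \<omega>) x) UNIV = (\<integral>\<^sup>+y. 1 \<partial>jump_kernel (generator \<omega>) x)"
    using sp by simp
  also have "\<dots> = (\<Sum>y | nbr x y. ennreal (\<omega> {x, y} / mu \<omega> x))"
    by (subst nn_integral_jump_kernel_generator[OF False]) simp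
  also have "\<dots> = ennreal (\<Sum>y | nbr x y. \<omega> {x, y} / mu \<omega> x)"
    by (intro sum_ennreal) (auto intro: conductance_nonneg mu_nonneg divide_nonneg_nonneg)
  also have "(\<Sum>y | nbr x y. \<omega> {x, y} / mu \<omega> x) = 1"
    using False by (simp add: sum_divide_distrib[symmetric] mu_def)
  finally show ?thesis using sp by (intro prob_spaceI) simp
qed

sublocale X: jump_chain "generator \<omega>"
proof (rule jump_chain.intro)
  show "0 < rate (generator \<omega>) x" for x
    using mu_nonneg[of x] by (auto simp: rate_def total_rate_generator less_le)
qed (rule prob_space_jump_kernel_generator)

sublocale Y: jump_chain "generatorY \<omega>"
proof (rule jump_chain.intro)
  show "prob_space (jump_kernel (generatorY \<omega>) x)" for x
    by (simp add: jump_kernel_generatorY prob_space_jump_kernel_generator)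
  show "0 < rate (generatorY \<omega>) x" for x
    using mu_nonneg[of x] by (cases "mu \<omega> x = 0") (auto simp: rate_def total_rate_generatorY)
qed

text \<open>The rate of the walk generated by \<open>generator\<close> at \<open>y\<close> is
  \<open>speed \<omega> y\<close> times that of \<open>Y\<close>. The Green function is defined with
  the former, the heat kernel with the latter, and the time change costs exactly this
  factor.\<close>

lemma green_le_occ:
  assumes y: "mu \<omega> y \<noteq> 0"
  shows "green \<omega> \<Lambda> x y \<le> occ (generatorY \<omega>) (emb -` \<Lambda>) (\<lambda>_. 1) y x / ennreal (speed \<omega> y)"
proof (cases "emb y \<in> \<Lambda>")
  case True
  have "occ (generatorY \<omega>) (emb -` \<Lambda>) (\<lambda>_. 1) y x = ennreal (speed \<omega> y) * occ (generator \<omega>) (emb -` \<Lambda>) (\<lambda>_. 1) y x"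
    using y by (intro occ_time_change[OF X.jump_chain_axioms Y.jump_chain_axioms])
      (auto simp: jump_kernel_generatorY rate_def total_rate_generator total_rate_generatorY)
  then have "occ (generatorY \<omega>) (emb -` \<Lambda>) (\<lambda>_. 1) y x / ennreal (speed \<omega> y) = occ (generator \<omega>) (emb -` \<Lambda>) (\<lambda>_. 1) y x"
    using mult_divide_eq_ennreal[of "ennreal (speed \<omega> y)"] speed_pos[of \<omega> y]
    by (simp add: not_le mult.commute[of "ennreal (speed \<omega> y)"] del: speed_pos)
  then show ?thesis
    using nn_integral_exit_le_occ[OF X.jump_chain_axioms True] by (simp add: green_def)
qed (simp add: green_def)

text \<open>Real-valued so that differences of resolvents make sense; nothing is lost, as discounted
  occupation times are at most \<open>1 / \<alpha>\<close>. The target \<open>y\<close> comes before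
  the starting point, which makes \<open>resolvent \<alpha> A y\<close> the function to which the
  generator is applied.\<close>

definition resolvent :: "real \<Rightarrow> (int ^ 'd) set \<Rightarrow> int ^ 'd \<Rightarrow> int ^ 'd \<Rightarrow> real" where
  "resolvent \<alpha> A y x = enn2real (occ (generatorY \<omega>) A (\<lambda>t. ennreal (exp (- \<alpha> * t))) y x)"

lemma occ_eq_resolvent:
  assumes "0 < \<alpha>"
  shows "occ (generatorY \<omega>) A (\<lambda>t. ennreal (exp (- \<alpha> * t))) y x = ennreal (resolvent \<alpha> A y x)"
  unfolding resolvent_def
  using Y.occ_exp_le[OF assms, of A y x] by (subst ennreal_enn2real) (auto simp: top_unique less_top[symmetric])

lemma resolvent_nonneg [simp]: "0 \<le> resolvent \<alpha> A y x"
  by (simp add: resolvent_def)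

lemma resolvent_le: "0 < \<alpha> \<Longrightarrow> resolvent \<alpha> A y x \<le> 1 / \<alpha>"
  using Y.occ_exp_le[of \<alpha> A y x] by (simp only: occ_eq_resolvent) simp

lemma resolvent_outside:
  assumes "0 < \<alpha>" "x \<notin> A"
  shows "resolvent \<alpha> A y x = 0"
  using Y.occ_exp_eq[OF assms(1), of A y x] assms unfolding occ_eq_resolvent[OF assms(1)] by simp

text \<open>The equation of \<open>occ_exp_eq\<close> cleared of denominators. Multiplying by
  \<open>speed\<close> leaves the symmetric conductances as coefficients, which both the energy
  estimate and the maximum principle rely on.\<close>

lemma resolvent_eq:
  assumes \<alpha>: "0 < \<alpha>" and x: "x \<in> A"
  shows "\<alpha> * speed \<omega> x * resolvent \<alpha> A y x
    = speed \<omega> x * indicator {y} x + (\<Sum>z | nbr x z. \<omega> {x, z} * (resolvent \<alpha> A y z - resolvent \<alpha> A y x))"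
proof (cases "mu \<omega> x = 0")
  case True
  \<comment> \<open>An isolated site is encoded by jumps to itself at rate one. These cancel in the
    equation and leave \<open>\<alpha> * R = 1\<close> at the target and zero elsewhere, in
    agreement with the generator vanishing there.\<close>
  have "rate (generatorY \<omega>) x = 1" "jump_kernel (generatorY \<omega>) x = return (count_space UNIV) x"
    using True by (auto simp: rate_def jump_kernel_def total_rate_generatorY)
  then have "ennreal (resolvent \<alpha> A y x)
    = ennreal (1 / (1 + \<alpha>)) * indicator {y} x + ennreal (1 / (1 + \<alpha>)) * ennreal (resolvent \<alpha> A y x)"
    using Y.occ_exp_eq[OF \<alpha>, of A y x] x unfolding occ_eq_resolvent[OF \<alpha>] by (simp add: nn_integral_return)
  also have "\<dots> = ennreal (1 / (1 + \<alpha>) * indicator {y} x + 1 / (1 + \<alpha>) * resolvent \<alpha> A y x)"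
    using \<alpha> by (simp add: ennreal_mult[symmetric] ennreal_plus[symmetric] indicator_def del: ennreal_plus)
  finally have "resolvent \<alpha> A y x = 1 / (1 + \<alpha>) * indicator {y} x + 1 / (1 + \<alpha>) * resolvent \<alpha> A y x"
    using \<alpha> by (subst (asm) ennreal_inj) auto
  then have "\<alpha> * resolvent \<alpha> A y x = indicator {y} x"
  proof -
    have "(1 + \<alpha>) * resolvent \<alpha> A y x = indicator {y} x + resolvent \<alpha> A y x"
      using \<open>resolvent \<alpha> A y x = _\<close> \<alpha> by (simp add: add_divide_distrib[symmetric] eq_divide_eq mult.commute)
    then show ?thesis by (simp add: distrib_right)
  qed
  moreover have "(\<Sum>z | nbr x z. \<omega> {x, z} * (resolvent \<alpha> A y z - resolvent \<alpha> A y x)) = 0"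
    using conductance_eq_0[OF True] by (intro sum.neutral) auto
  ultimately show ?thesis by (simp add: mult.assoc mult.left_commute[of \<alpha>])
next
  case False
  let ?R = "resolvent \<alpha> A y" and ?s = "speed \<omega> x" and ?m = "mu \<omega> x"
  have m: "0 < ?m" using False mu_nonneg[of x] by simp
  let ?r = "?m / ?s"
  have r: "0 < ?r" using m by simp
  have r_rate: "rate (generatorY \<omega>) x = ?r"
    using False speed_pos[of \<omega> x] by (simp add: rate_def total_rate_generatorY del: speed_pos)
  define S where "S = (\<Sum>z | nbr x z. \<omega> {x, z} / ?m * ?R z)"
  have S0: "0 \<le> S"
    using m unfolding S_def by (intro sum_nonneg mult_nonneg_nonneg divide_nonneg_pos) (auto intro: conductance_nonneg)
  define r where "r = ?r"
  have r0: "0 < r" using r by (simp add: r_def)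
  have "(\<Sum>z | nbr x z. ennreal (\<omega> {x, z} / ?m) * ennreal (?R z)) = ennreal S"
  proof -
    have "0 \<le> \<omega> {x, z} / ?m" if "nbr x z" for z
      using m conductance_nonneg[OF that] by simp
    then show ?thesis
      unfolding S_def by (subst sum_ennreal[symmetric]) (auto simp only: ennreal_mult resolvent_nonneg mem_Collect_eq mult_nonneg_nonneg intro!: sum.cong)
  qed
  then have "ennreal (?R x) = ennreal (1 / (r + \<alpha>)) * indicator {y} x + ennreal (r / (r + \<alpha>)) * ennreal S"
    using Y.occ_exp_eq[OF \<alpha>, of A y x] x unfolding r_rate r_def[symmetric] occ_eq_resolvent[OF \<alpha>]
    by (simp add: jump_kernel_generatorY nn_integral_jump_kernel_generator[OF False])
  also have "\<dots> = ennreal (1 / (r + \<alpha>) * indicator {y} x + r / (r + \<alpha>) * S)"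
    using \<alpha> r0 S0 by (subst ennreal_plus) (auto simp: ennreal_mult indicator_def simp del: times_divide_eq_left)
  finally have "?R x = 1 / (r + \<alpha>) * indicator {y} x + r / (r + \<alpha>) * S"
    using \<alpha> r0 S0 by (subst (asm) ennreal_inj) (auto intro!: add_nonneg_nonneg mult_nonneg_nonneg)
  then have "(r + \<alpha>) * ?R x = (r + \<alpha>) * (1 / (r + \<alpha>)) * indicator {y} x + (r + \<alpha>) * (r / (r + \<alpha>)) * S"
    by (simp only: distrib_left mult.assoc)
  then have "(r + \<alpha>) * ?R x = indicator {y} x + r * S"
    using \<alpha> r0 by simp
  then have "?s * ((r + \<alpha>) * ?R x) = ?s * (indicator {y} x + r * S)" by simp
  moreover have "?s * r = ?m" by (simp add: r_def)
  moreover have "?m * S = (\<Sum>z | nbr x z. \<omega> {x, z} * ?R z)"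
    using m by (simp add: S_def sum_distrib_left)
  ultimately have "?m * ?R x + \<alpha> * ?s * ?R x = ?s * indicator {y} x + (\<Sum>z | nbr x z. \<omega> {x, z} * ?R z)"
    by (simp add: distrib_left distrib_right mult.assoc[symmetric]) (simp add: mult_ac)
  moreover have "(\<Sum>z | nbr x z. \<omega> {x, z} * (?R z - ?R x)) = (\<Sum>z | nbr x z. \<omega> {x, z} * ?R z) - ?m * ?R x"
    by (simp add: right_diff_distrib sum_subtractf mu_def sum_distrib_right)
  ultimately show ?thesis by simp
qed

text \<open>At a site of \<open>A\<close> where a positive maximum is attained, the weighted sum of
  differences is nonpositive while the left side of \<open>sub\<close> is positive. The values
  outside \<open>A\<close> are covered by \<open>out\<close>, so the maximum over \<open>A\<close>
  dominates all neighbours.\<close>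

lemma maximum_principle:
  fixes v :: "int ^ 'd \<Rightarrow> real"
  assumes A: "finite A" and \<alpha>: "0 < \<alpha>" and out: "\<And>x. x \<notin> A \<Longrightarrow> v x \<le> 0"
    and sub: "\<And>x. x \<in> A \<Longrightarrow> \<alpha> * speed \<omega> x * v x \<le> (\<Sum>z | nbr x z. \<omega> {x, z} * (v z - v x))"
  shows "v x \<le> 0"
proof (cases "A = {}")
  case True
  then show ?thesis using out by simp
next
  case False
  define M where "M = Max (v ` A)"
  obtain x0 where x0: "x0 \<in> A" "v x0 = M"
    using Max_in[of "v ` A"] A False unfolding M_def by fastforce
  have le: "v z \<le> M" if "z \<in> A" for z
    using A that unfolding M_def by (intro Max_ge) auto
  have "M \<le> 0"
  proof (rule ccontr)
    assume M: "\<not> M \<le> 0"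
    have "v z \<le> M" for z using le[of z] out[of z] M by (cases "z \<in> A") auto
    then have "(\<Sum>z | nbr x0 z. \<omega> {x0, z} * (v z - v x0)) \<le> 0"
      unfolding x0(2) by (intro sum_nonpos) (auto intro!: mult_nonneg_nonpos conductance_nonneg)
    moreover have "0 < \<alpha> * speed \<omega> x0 * v x0"
      using M \<alpha> x0(2) by simp
    ultimately show False using sub[OF x0(1)] by linarith
  qed
  then show ?thesis using le[of x] out[of x] by (cases "x \<in> A") auto
qed

text \<open>A Combes-Thomas estimate: conjugating the resolvent equation by \<open>exp \<psi>\<close> costs at most
  \<open>l\<^sup>2\<close> in the spectral parameter, since the first order terms cancel by symmetry.\<close>

lemma resolvent_combes_thomas:
  assumes A: "finite A" and \<alpha>: "0 < \<alpha>" and l: "l \<le> 1" "l\<^sup>2 \<le> \<alpha> / 2"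
    and lip: "\<And>x z. nbr x z \<Longrightarrow> 0 < \<omega> {x, z} \<Longrightarrow> \<bar>\<psi> x - \<psi> z\<bar> \<le> l" and \<psi>y: "\<psi> y = 0"
  shows "resolvent \<alpha> A y x \<le> sqrt 2 / \<alpha> * exp (- \<psi> x) * speed \<omega> y"
proof (cases "x \<in> A")
  case False
  then show ?thesis using resolvent_outside[OF \<alpha> False] \<alpha> by (simp add: less_imp_le)
next
  case xA: True
  define R where "R = resolvent \<alpha> A y"
  define v where "v z = exp (\<psi> z) * R z" for z
  \<comment> \<open>Conductances extended by zero to all pairs, so that sums over \<open>A\<close>
    times \<open>A\<close> can be exchanged.\<close>
  define c where "c z w = (if nbr z w then \<omega> {z, w} else 0)" for z w
  have half: "\<alpha> / 2 * X \<le> Y" if "\<alpha> * X \<le> Y + \<alpha> / 2 * X" for X Y :: real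
  proof -
    have "\<alpha> * X = \<alpha> / 2 * X + \<alpha> / 2 * X" by simp
    then show ?thesis using that by linarith
  qed
  have R0: "0 \<le> R z" for z by (simp add: R_def)
  have v0: "0 \<le> v z" for z by (simp add: v_def R0)
  have c0: "0 \<le> c z w" for z w by (simp add: c_def conductance_nonneg)
  have c_sym: "c z w = c w z" for z w by (simp add: c_def nbr_commute[of z] insert_commute)
  have c_mu: "(\<Sum>w\<in>A. c z w) \<le> mu \<omega> z" for z
  proof -
    have "(\<Sum>w\<in>A. c z w) = (\<Sum>w\<in>A \<inter> {w. nbr z w}. c z w)"
      using A by (intro sum.mono_neutral_right) (auto simp: c_def)
    also have "\<dots> = (\<Sum>w\<in>A \<inter> {w. nbr z w}. \<omega> {z, w})"
      by (intro sum.cong) (auto simp: c_def)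
    also have "\<dots> \<le> mu \<omega> z"
      unfolding mu_def by (intro sum_mono2) (auto intro: conductance_nonneg)
    finally show ?thesis .
  qed
  have eq: "\<alpha> * speed \<omega> z * R z = speed \<omega> z * indicator {y} z + ((\<Sum>w\<in>A. c z w * R w) - mu \<omega> z * R z)" if "z \<in> A" for z
  proof -
    have "(\<Sum>w | nbr z w. \<omega> {z, w} * R w) = (\<Sum>w\<in>A. c z w * R w)"
    proof -
      have "(\<Sum>w | nbr z w. \<omega> {z, w} * R w) = (\<Sum>w\<in>{w. nbr z w} \<inter> A. \<omega> {z, w} * R w)"
        using resolvent_outside[OF \<alpha>] by (intro sum.mono_neutral_right) (auto simp: R_def)
      also have "\<dots> = (\<Sum>w\<in>{w. nbr z w} \<inter> A. c z w * R w)"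
        by (intro sum.cong) (auto simp: c_def)
      also have "\<dots> = (\<Sum>w\<in>A. c z w * R w)"
        using A by (intro sum.mono_neutral_left) (auto simp: c_def)
      finally show ?thesis .
    qed
    moreover have "(\<Sum>w | nbr z w. \<omega> {z, w} * (R w - R z)) = (\<Sum>w | nbr z w. \<omega> {z, w} * R w) - mu \<omega> z * R z"
      by (simp add: right_diff_distrib sum_subtractf mu_def sum_distrib_right)
    ultimately show ?thesis
      using resolvent_eq[OF \<alpha> that, of y] by (simp add: R_def)
  qed
  \<comment> \<open>Adding the double sum to its transpose replaces
    \<open>exp (\<psi> z - \<psi> w)\<close> by twice a hyperbolic cosine, at most
    \<open>2 + 2 * l^2\<close>. The surplus over the \<open>mu\<close> term is later absorbed by
    half of the \<open>\<alpha>\<close> term, whence the condition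
    \<open>l^2 \<le> \<alpha> / 2\<close>.\<close>
  have sym: "(\<Sum>z\<in>A. \<Sum>w\<in>A. c z w * exp (\<psi> z - \<psi> w) * (v z * v w)) \<le> (1 + l\<^sup>2) * (\<Sum>z\<in>A. mu \<omega> z * (v z)\<^sup>2)"
  proof -
    let ?S = "\<Sum>z\<in>A. \<Sum>w\<in>A. c z w * exp (\<psi> z - \<psi> w) * (v z * v w)"
    have swap: "?S = (\<Sum>z\<in>A. \<Sum>w\<in>A. c z w * exp (- (\<psi> z - \<psi> w)) * (v z * v w))"
      by (subst sum.swap) (intro sum.cong refl, simp add: c_sym mult.commute)
    have "?S + ?S = (\<Sum>z\<in>A. \<Sum>w\<in>A. c z w * (exp (\<psi> z - \<psi> w) + exp (- (\<psi> z - \<psi> w))) * (v z * v w))"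
      by (subst (2) swap) (simp only: sum.distrib[symmetric] distrib_left[symmetric] distrib_right[symmetric])
    also have "\<dots> \<le> (\<Sum>z\<in>A. \<Sum>w\<in>A. c z w * ((1 + l\<^sup>2) * ((v z)\<^sup>2 + (v w)\<^sup>2)))"
    proof (intro sum_mono)
      fix z w
      show "c z w * (exp (\<psi> z - \<psi> w) + exp (- (\<psi> z - \<psi> w))) * (v z * v w) \<le> c z w * ((1 + l\<^sup>2) * ((v z)\<^sup>2 + (v w)\<^sup>2))"
      proof (cases "nbr z w \<and> 0 < \<omega> {z, w}")
        case True
        then have "exp (\<psi> z - \<psi> w) + exp (- (\<psi> z - \<psi> w)) \<le> 2 + 2 * l\<^sup>2"
          using lip l(1) by (intro exp_add_exp_minus_le) auto
        then have "(exp (\<psi> z - \<psi> w) + exp (- (\<psi> z - \<psi> w))) * (v z * v w) \<le> (2 + 2 * l\<^sup>2) * (v z * v w)"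
          using v0 by (intro mult_right_mono) auto
        also have "\<dots> = (1 + l\<^sup>2) * (2 * v z * v w)" by (simp add: algebra_simps)
        also have "\<dots> \<le> (1 + l\<^sup>2) * ((v z)\<^sup>2 + (v w)\<^sup>2)"
          using sum_squares_bound[of "v z" "v w"] by (intro mult_left_mono) auto
        finally show ?thesis
          using mult_left_mono[OF _ c0[of z w]] by (simp add: mult.assoc)
      next
        case False
        then have "c z w = 0" using conductance_nonneg[of z w] by (auto simp: c_def)
        then show ?thesis by simp
      qed
    qed
    also have "\<dots> = (\<Sum>z\<in>A. \<Sum>w\<in>A. (1 + l\<^sup>2) * (c z w * (v z)\<^sup>2)) + (\<Sum>z\<in>A. \<Sum>w\<in>A. (1 + l\<^sup>2) * (c z w * (v w)\<^sup>2))"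
      unfolding sum.distrib[symmetric] by (intro sum.cong refl) (simp add: algebra_simps)
    also have "(\<Sum>z\<in>A. \<Sum>w\<in>A. (1 + l\<^sup>2) * (c z w * (v w)\<^sup>2)) = (\<Sum>z\<in>A. \<Sum>w\<in>A. (1 + l\<^sup>2) * (c z w * (v z)\<^sup>2))"
      by (subst sum.swap) (intro sum.cong refl, simp add: c_sym)
    finally have "?S \<le> (\<Sum>z\<in>A. \<Sum>w\<in>A. (1 + l\<^sup>2) * (c z w * (v z)\<^sup>2))" by simp
    also have "\<dots> = (1 + l\<^sup>2) * (\<Sum>z\<in>A. (\<Sum>w\<in>A. c z w) * (v z)\<^sup>2)"
      by (simp only: sum_distrib_left[symmetric] sum_distrib_right[symmetric])
    also have "\<dots> \<le> (1 + l\<^sup>2) * (\<Sum>z\<in>A. mu \<omega> z * (v z)\<^sup>2)"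
      by (intro mult_left_mono sum_mono mult_right_mono c_mu) auto
    finally show ?thesis .
  qed
  \<comment> \<open>The resolvent equation is tested against \<open>exp (2 * \<psi>) * R\<close>.
    Since \<open>\<psi> y = 0\<close>, the source contributes \<open>R y * speed \<omega> y\<close>,
    for which the crude bound \<open>1 / \<alpha>\<close> on \<open>R y\<close> is enough.\<close>
  have "\<alpha> * (\<Sum>z\<in>A. speed \<omega> z * (v z)\<^sup>2) = (\<Sum>z\<in>A. (exp (\<psi> z))\<^sup>2 * R z * (\<alpha> * speed \<omega> z * R z))"
    unfolding sum_distrib_left by (intro sum.cong refl) (simp add: v_def power2_eq_square algebra_simps)
  also have "\<dots> = (\<Sum>z\<in>A. (exp (\<psi> z))\<^sup>2 * R z * (speed \<omega> z * indicator {y} z))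
     + ((\<Sum>z\<in>A. \<Sum>w\<in>A. c z w * exp (\<psi> z - \<psi> w) * (v z * v w)) - (\<Sum>z\<in>A. mu \<omega> z * (v z)\<^sup>2))"
    unfolding sum.distrib[symmetric] sum_subtractf[symmetric]
  proof (intro sum.cong refl)
    fix z assume "z \<in> A"
    have "(\<Sum>w\<in>A. c z w * exp (\<psi> z - \<psi> w) * (v z * v w)) = (exp (\<psi> z))\<^sup>2 * R z * (\<Sum>w\<in>A. c z w * R w)"
      unfolding sum_distrib_left by (intro sum.cong refl) (simp add: v_def exp_diff power2_eq_square)
    then show "(exp (\<psi> z))\<^sup>2 * R z * (\<alpha> * speed \<omega> z * R z) = (exp (\<psi> z))\<^sup>2 * R z * (speed \<omega> z * indicator {y} z)
       + ((\<Sum>w\<in>A. c z w * exp (\<psi> z - \<psi> w) * (v z * v w)) - mu \<omega> z * (v z)\<^sup>2)"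
      unfolding eq[OF \<open>z \<in> A\<close>] by (simp add: v_def power2_eq_square algebra_simps)
  qed
  also have "(\<Sum>z\<in>A. (exp (\<psi> z))\<^sup>2 * R z * (speed \<omega> z * indicator {y} z)) \<le> speed \<omega> y / \<alpha>"
  proof -
    have "(\<Sum>z\<in>A. (exp (\<psi> z))\<^sup>2 * R z * (speed \<omega> z * indicator {y} z)) = (\<Sum>z\<in>A. if z = y then R y * speed \<omega> y else 0)"
      by (intro sum.cong refl) (auto simp: \<psi>y)
    also have "\<dots> \<le> R y * speed \<omega> y"
      using A R0 by (simp add: less_imp_le)
    also have "\<dots> \<le> 1 / \<alpha> * speed \<omega> y"
      using resolvent_le[OF \<alpha>, of A y y] by (intro mult_right_mono) (auto simp: R_def less_imp_le)
    finally show ?thesis by simp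
  qed
  also have "(\<Sum>z\<in>A. \<Sum>w\<in>A. c z w * exp (\<psi> z - \<psi> w) * (v z * v w)) - (\<Sum>z\<in>A. mu \<omega> z * (v z)\<^sup>2)
    \<le> \<alpha> / 2 * (\<Sum>z\<in>A. speed \<omega> z * (v z)\<^sup>2)"
  proof -
    have "l\<^sup>2 * (\<Sum>z\<in>A. mu \<omega> z * (v z)\<^sup>2) \<le> \<alpha> / 2 * (\<Sum>z\<in>A. speed \<omega> z * (v z)\<^sup>2)"
      using l(2) \<alpha> by (intro mult_mono sum_mono mult_right_mono sum_nonneg mult_nonneg_nonneg) (auto simp: mu_le_speed mu_nonneg)
    then show ?thesis using sym by (simp add: algebra_simps)
  qed
  finally have "\<alpha> * (\<Sum>z\<in>A. speed \<omega> z * (v z)\<^sup>2) \<le> speed \<omega> y / \<alpha> + \<alpha> / 2 * (\<Sum>z\<in>A. speed \<omega> z * (v z)\<^sup>2)"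
    by simp
  then have bd: "\<alpha> / 2 * (\<Sum>z\<in>A. speed \<omega> z * (v z)\<^sup>2) \<le> speed \<omega> y / \<alpha>"
    by (rule half)
  \<comment> \<open>From the weighted square sum to a point: one term is at most the sum, and
    \<open>speed\<close> is at least one.\<close>
  have "(v x)\<^sup>2 \<le> speed \<omega> x * (v x)\<^sup>2"
    using speed_ge_1[of \<omega> x] mult_right_mono[of 1 "speed \<omega> x" "(v x)\<^sup>2"] by simp
  also have "\<dots> \<le> (\<Sum>z\<in>A. speed \<omega> z * (v z)\<^sup>2)"
    using A xA by (intro member_le_sum) (auto simp: less_imp_le)
  also have "\<dots> \<le> 2 * speed \<omega> y / \<alpha>\<^sup>2"
    using bd \<alpha> by (simp add: field_simps power2_eq_square)
  also have "\<dots> \<le> 2 * (speed \<omega> y)\<^sup>2 / \<alpha>\<^sup>2"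
    using speed_ge_1[of \<omega> y] \<alpha> by (intro divide_right_mono mult_left_mono) (auto simp: power2_eq_square)
  also have "\<dots> = (sqrt 2 / \<alpha> * speed \<omega> y)\<^sup>2"
    by (simp add: power_mult_distrib power_divide)
  finally have "v x \<le> sqrt 2 / \<alpha> * speed \<omega> y"
    by (rule power2_le_imp_le) (use \<alpha> speed_ge_1[of \<omega> y] in simp)
  then have "exp (- \<psi> x) * v x \<le> exp (- \<psi> x) * (sqrt 2 / \<alpha> * speed \<omega> y)"
    by (intro mult_left_mono) auto
  moreover have "exp (- \<psi> x) * v x = R x"
    by (simp add: v_def exp_minus)
  ultimately show ?thesis by (simp add: R_def mult_ac)
qed

end

section \<open>Graph distance and the short-time regime\<close>

lemma sym_open_edge: "sym (open_edge \<omega>)"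
  by (auto simp: sym_def open_edge_def nbr_commute insert_commute)

lemma relpow_sym: "sym R \<Longrightarrow> (x, y) \<in> R ^^ n \<Longrightarrow> (y, x) \<in> R ^^ n"
proof (induction n arbitrary: y)
  case (Suc n)
  from Suc.prems(2) obtain z where "(x, z) \<in> R ^^ n" "(z, y) \<in> R" by (auto elim: relpow_Suc_E)
  then have "(y, z) \<in> R" "(z, x) \<in> R ^^ n"
    using Suc by (auto dest: symD)
  then show ?case by (rule relpow_Suc_I2)
qed simp

lemma gdist_commute: "gdist \<omega> x y = gdist \<omega> y x"
  unfolding gdist_def using relpow_sym[OF sym_open_edge] by (intro arg_cong[where f=Least] ext) blast

lemma gdist_self [simp]: "gdist \<omega> x x = 0"
  unfolding gdist_def by (rule Least_eq_0) simp

lemma Cinf_step: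
  assumes "x \<in> Cinf \<omega>" "(x, y) \<in> open_edge \<omega>"
  shows "y \<in> Cinf \<omega>"
proof -
  have "(y, x) \<in> open_edge \<omega>" using assms(2) sym_open_edge by (auto dest: symD)
  then have "{z. (x, z) \<in> (open_edge \<omega>)\<^sup>*} \<subseteq> {z. (y, z) \<in> (open_edge \<omega>)\<^sup>*}"
    by (auto intro: converse_rtrancl_into_rtrancl)
  then show ?thesis using assms(1) by (auto simp: Cinf_def dest: finite_subset)
qed

lemma gdist_attained:
  assumes "\<omega> \<in> Omega_star" "x \<in> Cinf \<omega>" "y \<in> Cinf \<omega>"
  shows "(x, y) \<in> open_edge \<omega> ^^ gdist \<omega> x y"
proof -
  have "(x, y) \<in> (open_edge \<omega> \<inter> Cinf \<omega> \<times> Cinf \<omega>)\<^sup>*"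
    using assms by (auto simp: Omega_star_def connected_in_def)
  then have "(x, y) \<in> (open_edge \<omega>)\<^sup>*"
    by (rule rtrancl_mono[THEN subsetD, rotated]) auto
  then obtain n where "(x, y) \<in> open_edge \<omega> ^^ n"
    using rtrancl_imp_relpow by blast
  then show ?thesis unfolding gdist_def by (rule LeastI)
qed

lemma gdist_le_Suc:
  assumes "\<omega> \<in> Omega_star" "y \<in> Cinf \<omega>" "x \<in> Cinf \<omega>" "(x, z) \<in> open_edge \<omega>"
  shows "gdist \<omega> y z \<le> Suc (gdist \<omega> y x)"
proof -
  have "(y, z) \<in> open_edge \<omega> ^^ Suc (gdist \<omega> y x)"
    using gdist_attained[OF assms(1-3)] assms(4) by (rule relpow_Suc_I)
  then show ?thesis unfolding gdist_def[of \<omega> y z] by (rule Least_le)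
qed

text \<open>Each step changes a single coordinate by one. This is the link from graph distance back
  to the geometry of the lattice.\<close>

lemma relpow_open_edge_l1:
  "(x, y) \<in> open_edge \<omega> ^^ n \<Longrightarrow> (\<Sum>i\<in>UNIV. \<bar>x $ i - y $ i\<bar>) \<le> int n"
proof (induction n arbitrary: y)
  case (Suc n)
  from Suc.prems obtain z where z: "(x, z) \<in> open_edge \<omega> ^^ n" "(z, y) \<in> open_edge \<omega>"
    by (auto elim: relpow_Suc_E)
  have "(\<Sum>i\<in>UNIV. \<bar>x $ i - y $ i\<bar>) \<le> (\<Sum>i\<in>UNIV. \<bar>x $ i - z $ i\<bar> + \<bar>z $ i - y $ i\<bar>)"
    by (intro sum_mono) auto
  also have "\<dots> = (\<Sum>i\<in>UNIV. \<bar>x $ i - z $ i\<bar>) + 1"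
    using z(2) by (simp add: sum.distrib open_edge_def nbr_def)
  finally show ?case using Suc.IH[OF z(1)] by simp
qed simp

lemma gdist_ge_l1:
  assumes "\<omega> \<in> Omega_star" "x \<in> Cinf \<omega>" "y \<in> Cinf \<omega>"
  shows "(\<Sum>i\<in>UNIV. \<bar>x $ i - y $ i\<bar>) \<le> int (gdist \<omega> x y)"
  by (rule relpow_open_edge_l1[OF gdist_attained[OF assms]])

lemma (in environment) mu_Cinf:
  assumes "x \<in> Cinf \<omega>"
  shows "mu \<omega> x \<noteq> 0"
proof
  assume 0: "mu \<omega> x = 0"
  have "{z. (x, z) \<in> (open_edge \<omega>)\<^sup>*} \<subseteq> {x}"
  proof
    fix z assume "z \<in> {z. (x, z) \<in> (open_edge \<omega>)\<^sup>*}"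
    then have "(x, z) \<in> (open_edge \<omega>)\<^sup>*" by simp
    then show "z \<in> {x}"
      by (cases rule: converse_rtranclE) (use conductance_eq_0[OF 0] in \<open>auto simp: open_edge_def\<close>)
  qed
  then show False using assms by (auto simp: Cinf_def dest: finite_subset)
qed

text \<open>One term of the exponential series is at most the whole; the free exponent
  \<open>n\<close> trades exponential decay for any polynomial one.\<close>

lemma exp_minus_le_fact:
  fixes s :: real
  assumes "0 < s"
  shows "exp (- s) \<le> fact n / s ^ n"
proof -
  have "(\<Sum>i\<in>{n}. s ^ i /\<^sub>R fact i) \<le> (\<Sum>i. s ^ i /\<^sub>R fact i)"
    using assms by (intro sum_le_suminf summable_exp_generic) auto
  then have "s ^ n / fact n \<le> exp s"
    by (simp add: exp_def divide_inverse mult.commute)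
  then show ?thesis using assms by (simp add: exp_minus field_simps)
qed

section \<open>Environments with a heat kernel bound, and times up to a multiple of the
  distance\<close>

context jump_chain begin

lemma occ_cmult:
  assumes [measurable]: "f \<in> borel_measurable borel"
  shows "occ G A (\<lambda>t. c * f t) y x = c * occ G A f y x"
proof -
  have "(\<integral>\<^sup>+t. c * f t * indicator I t \<partial>lborel) = c * (\<integral>\<^sup>+t. f t * indicator I t \<partial>lborel)"
    if [measurable]: "I \<in> sets borel" for I
    unfolding mult.assoc by (rule nn_integral_cmult) measurable
  then have "(if path_in A y k (fst s) then hold G (\<lambda>t. c * f t) s k else 0)
    = c * (if path_in A y k (fst s) then hold G f s k else 0)" for k s
    by simp
  then have "occ G A (\<lambda>t. c * f t) y x = (\<integral>\<^sup>+s. c * (\<Sum>k. if path_in A y k (fst s) then hold G f s k else 0) \<partial>walk_law G x)"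
    unfolding occ_def by (simp only: ennreal_suminf_cmult)
  also have "\<dots> = c * occ G A f y x"
    unfolding occ_def by (rule nn_integral_cmult) measurable
  finally show ?thesis .
qed

lemma occ_le_nn_integral:
  assumes [measurable]: "f \<in> borel_measurable borel"
  shows "occ G A f y x \<le> (\<integral>\<^sup>+t. f t * indicator {0..} t \<partial>lborel)"
proof -
  interpret W: prob_space "walk_law G x" by (rule prob_space_walk_law)
  have "occ G A f y x \<le> occ G UNIV f y x" by (rule occ_mono) auto
  also have "\<dots> \<le> (\<integral>\<^sup>+t. f t * indicator {0..} t * 1 \<partial>lborel)"
    unfolding occ_UNIV_eq[OF assms] by (intro nn_integral_mono mult_left_mono W.emeasure_le_1) simp
  finally show ?thesis by simp
qed

end

text \<open>One fixed environment with deterministic constants: the scales \<open>N_1\<close>,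
  \<open>N_2\<close> and \<open>N_HK\<close> have been condensed into the single time
  \<open>H\<close>, and the heat kernel bound holds for every pair of cluster vertices. All analytic
  estimates are made here; randomness returns only at the end.\<close>

locale percolation_env =
  fixes \<omega> :: "('d::finite) env" and H CHK c1 c2 :: real
  assumes star: "\<omega> \<in> Omega_star0"
    and H: "1 \<le> H" and pos_consts: "0 < CHK" "0 < c1" "0 < c2"
    and heat_kernel_le: "\<And>x y t. x \<in> Cinf \<omega> \<Longrightarrow> y \<in> Cinf \<omega> \<Longrightarrow> H \<le> t \<Longrightarrow> c2 * real (gdist \<omega> x y) \<le> t \<Longrightarrow>
      heat_kernel \<omega> t x y \<le> CHK * t powr (- real CARD('d) / 2) * exp (- c1 * (real (gdist \<omega> x y))\<^sup>2 / t)"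
begin

lemma omega_star: "\<omega> \<in> Omega_star" and zero_Cinf: "0 \<in> Cinf \<omega>"
  using star by (auto simp: Omega_star0_def)

sublocale environment \<omega>
proof
  have "\<omega> \<in> space env_space" using omega_star by (simp add: Omega_star_def)
  then show "0 \<le> \<omega> e" if "e \<in> lat_edges" for e
    using that by (auto simp: env_space_def space_PiM PiE_iff space_restrict_space)
qed

abbreviation occY :: "(int ^ 'd) set \<Rightarrow> (real \<Rightarrow> ennreal) \<Rightarrow> int ^ 'd \<Rightarrow> int ^ 'd \<Rightarrow> ennreal" where
  "occY \<equiv> occ (generatorY \<omega>)"

abbreviation gaussian :: "int ^ 'd \<Rightarrow> int ^ 'd \<Rightarrow> real \<Rightarrow> real" where
  "gaussian x y t \<equiv> CHK * t powr (- real CARD('d) / 2) * exp (- c1 * (real (gdist \<omega> x y))\<^sup>2 / t)"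

lemma occY_le_heat_kernel:
  assumes xy: "x \<in> Cinf \<omega>" "y \<in> Cinf \<omega>"
    and [measurable]: "f \<in> borel_measurable borel"
    and f: "\<And>t. 0 \<le> t \<Longrightarrow> f t \<noteq> 0 \<Longrightarrow> H \<le> t \<and> c2 * real (gdist \<omega> x y) \<le> t"
  shows "occY A f y x \<le> ennreal (speed \<omega> y) * (\<integral>\<^sup>+t. f t * ennreal (gaussian x y t) * indicator {0..} t \<partial>lborel)"
proof -
  interpret W: prob_space "walk_law (generatorY \<omega>) x" by (rule Y.prob_space_walk_law)
  let ?h = "\<lambda>t. gaussian x y t"
  have "occY A f y x \<le> occY UNIV f y x" by (rule Y.occ_mono) auto
  also have "\<dots> = (\<integral>\<^sup>+t. f t * indicator {0..} t * emeasure (walk_law (generatorY \<omega>) x)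
      {s \<in> space (walk_law (generatorY \<omega>) x). walk_at (generatorY \<omega>) s t = Some y} \<partial>lborel)"
    by (rule Y.occ_UNIV_eq) measurable
  also have "\<dots> \<le> (\<integral>\<^sup>+t. ennreal (speed \<omega> y) * (f t * ennreal (?h t) * indicator {0..} t) \<partial>lborel)"
  proof (rule nn_integral_mono)
    fix t :: real
    let ?E = "{s \<in> space (walk_law (generatorY \<omega>) x). walk_at (generatorY \<omega>) s t = Some y}"
    show "f t * indicator {0..} t * emeasure (walk_law (generatorY \<omega>) x) ?E
      \<le> ennreal (speed \<omega> y) * (f t * ennreal (?h t) * indicator {0..} t)"
    proof (cases "0 \<le> t \<and> f t \<noteq> 0")
      case True
      then have "heat_kernel \<omega> t x y \<le> ?h t"
        using f[of t] by (intro heat_kernel_le xy) auto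
      then have "W.prob ?E \<le> ?h t * speed \<omega> y"
        using speed_pos[of \<omega> y] unfolding heat_kernel_def speed_def[symmetric] by (subst (asm) pos_divide_le_eq)
      then have "emeasure (walk_law (generatorY \<omega>) x) ?E \<le> ennreal (?h t * speed \<omega> y)"
        unfolding W.emeasure_eq_measure by (rule ennreal_leI)
      also have "\<dots> = ennreal (speed \<omega> y) * ennreal (?h t)"
        using pos_consts speed_ge_1[of \<omega> y] by (subst ennreal_mult) (auto simp: mult.commute)
      finally have "f t * emeasure (walk_law (generatorY \<omega>) x) ?E \<le> f t * (ennreal (speed \<omega> y) * ennreal (?h t))"
        by (intro mult_left_mono) auto
      then show ?thesis using True by (simp add: mult_ac)
    qed (auto split: split_indicator)
  qed
  also have "\<dots> = ennreal (speed \<omega> y) * (\<integral>\<^sup>+t. f t * ennreal (?h t) * indicator {0..} t \<partial>lborel)"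
    by (rule nn_integral_cmult) measurable
  finally show ?thesis .
qed

text \<open>The estimate for finite sets is applied in boxes and passed to the limit by
  \<open>occ_SUP\<close>; its constant does not depend on the box. The weight is a multiple of the
  distance to \<open>y\<close>, with the largest slope that \<open>l^2 \<le> \<alpha> / 2\<close>
  permits.\<close>

lemma occY_exp_le_combes_thomas:
  assumes xy: "x \<in> Cinf \<omega>" "y \<in> Cinf \<omega>" and \<alpha>: "0 < \<alpha>" "\<alpha> \<le> 2"
  shows "occY A (\<lambda>t. ennreal (exp (- \<alpha> * t))) y x
    \<le> ennreal (sqrt 2 / \<alpha> * exp (- (sqrt (\<alpha> / 2) * real (gdist \<omega> x y))) * speed \<omega> y)"
proof -
  define B where "B N = {z :: int ^ 'd. \<forall>i. - int N \<le> z $ i \<and> z $ i \<le> int N}" for N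
  define l where "l = sqrt (\<alpha> / 2)"
  \<comment> \<open>Open edges never leave the cluster, so the jump of \<open>\<psi>\<close> to zero
    outside it does not spoil the Lipschitz bound.\<close>
  define \<psi> where "\<psi> z = (if z \<in> Cinf \<omega> then l * real (gdist \<omega> y z) else 0)" for z
  have l: "0 \<le> l" "l \<le> 1" "l\<^sup>2 = \<alpha> / 2" using \<alpha> by (auto simp: l_def)
  have lip: "\<bar>\<psi> z - \<psi> w\<bar> \<le> l" if "nbr z w" "0 < \<omega> {z, w}" for z w
  proof -
    have e: "(z, w) \<in> open_edge \<omega>" "(w, z) \<in> open_edge \<omega>"
      using that by (auto simp: open_edge_def nbr_commute insert_commute)
    show ?thesis
    proof (cases "z \<in> Cinf \<omega>")
      case True
      then have w: "w \<in> Cinf \<omega>" using Cinf_step e by blast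
      have "\<bar>real (gdist \<omega> y z) - real (gdist \<omega> y w)\<bar> \<le> 1"
        using gdist_le_Suc[OF omega_star xy(2) True e(1)] gdist_le_Suc[OF omega_star xy(2) w e(2)] by linarith
      then have "l * \<bar>real (gdist \<omega> y z) - real (gdist \<omega> y w)\<bar> \<le> l * 1"
        using l by (intro mult_left_mono) auto
      then show ?thesis using True w l by (simp add: \<psi>_def right_diff_distrib[symmetric] abs_mult)
    next
      case False
      then have "w \<notin> Cinf \<omega>" using Cinf_step e by blast
      then show ?thesis using False l by (simp add: \<psi>_def)
    qed
  qed
  have UN: "(\<Union>N. B N) = UNIV"
  proof -
    have "z \<in> B (nat (\<Sum>i\<in>UNIV. \<bar>z $ i\<bar>))" for z
    proof -
      have "\<bar>z $ i\<bar> \<le> (\<Sum>i\<in>UNIV. \<bar>z $ i\<bar>)" for i by (rule member_le_sum) auto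
      moreover have "0 \<le> (\<Sum>i\<in>UNIV. \<bar>z $ i\<bar>)" by (rule sum_nonneg) auto
      ultimately have "- int (nat (\<Sum>i\<in>UNIV. \<bar>z $ i\<bar>)) \<le> z $ i \<and> z $ i \<le> int (nat (\<Sum>i\<in>UNIV. \<bar>z $ i\<bar>))" for i
        by (simp add: abs_le_iff minus_le_iff)
      then show ?thesis by (simp add: B_def)
    qed
    then show ?thesis by blast
  qed
  have inc: "incseq B"
  proof (intro incseq_SucI subsetI)
    fix n z assume "z \<in> B n"
    have "- int (Suc n) \<le> z $ i \<and> z $ i \<le> int (Suc n)" for i
    proof -
      have "- int n \<le> z $ i \<and> z $ i \<le> int n" using \<open>z \<in> B n\<close> by (auto simp: B_def)
      then show ?thesis by linarith
    qed
    then show "z \<in> B (Suc n)" by (auto simp: B_def)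
  qed
  have "occY A (\<lambda>t. ennreal (exp (- \<alpha> * t))) y x \<le> occY (\<Union>N. B N) (\<lambda>t. SUP N::nat. ennreal (exp (- \<alpha> * t))) y x"
    unfolding UN by (rule Y.occ_mono) auto
  also have "\<dots> = (SUP N. occY (B N) (\<lambda>t. ennreal (exp (- \<alpha> * t))) y x)"
    by (rule Y.occ_SUP) (use inc in \<open>auto simp: incseq_def\<close>)
  also have "\<dots> \<le> ennreal (sqrt 2 / \<alpha> * exp (- \<psi> x) * speed \<omega> y)"
  proof (rule SUP_least)
    fix N
    have "resolvent \<alpha> (B N) y x \<le> sqrt 2 / \<alpha> * exp (- \<psi> x) * speed \<omega> y"
      using l xy \<alpha> lip by (intro resolvent_combes_thomas[where l=l]) (auto simp: B_def finite_int_box \<psi>_def)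
    then show "occY (B N) (\<lambda>t. ennreal (exp (- \<alpha> * t))) y x \<le> ennreal (sqrt 2 / \<alpha> * exp (- \<psi> x) * speed \<omega> y)"
      unfolding occ_eq_resolvent[OF \<alpha>(1)] by (rule ennreal_leI)
  qed
  finally show ?thesis using xy by (simp add: \<psi>_def l_def gdist_commute[of \<omega> y x])
qed

text \<open>The heat kernel hypothesis says nothing at times below \<open>N\<^sub>H\<^sub>K\<close> or between \<open>c4 * gdist\<close> and
  \<open>c2 * gdist\<close>; the Combes-Thomas estimate at \<open>\<alpha> = 1 / (c * gdist)\<close> covers all times below \<open>c * gdist\<close>.\<close>

lemma occY_short_time:
  fixes c :: real and m :: nat
  assumes xy: "x \<in> Cinf \<omega>" "y \<in> Cinf \<omega>" and c: "1 \<le> c" and D: "1 \<le> gdist \<omega> x y"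
  defines "D \<equiv> real (gdist \<omega> x y)"
  shows "occY A (indicator {..c * D}) y x
    \<le> ennreal (speed \<omega> y * (exp 1 * sqrt 2 * c * (fact (2 * Suc m) * (2 * c) ^ Suc m) / D ^ m))"
proof -
  have D1: "1 \<le> D" using D by (simp add: D_def)
  define \<alpha> where "\<alpha> = 1 / (c * D)"
  have cD: "1 \<le> c * D" using mult_mono[of 1 c 1 D] c D1 by simp
  have \<alpha>: "0 < \<alpha>" "\<alpha> \<le> 2" using cD by (auto simp: \<alpha>_def field_simps)
  define s where "s = sqrt (\<alpha> / 2) * D"
  have s: "0 < s" using \<alpha> D1 by (simp add: s_def)
  have s2: "s\<^sup>2 = D / (2 * c)"
  proof -
    have "s\<^sup>2 = \<alpha> / 2 * D\<^sup>2" using \<alpha> by (simp add: s_def power_mult_distrib)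
    also have "\<dots> = D / (2 * c)" using D1 by (simp add: \<alpha>_def power2_eq_square)
    finally show ?thesis .
  qed
  have "occY A (indicator {..c * D}) y x \<le> occY A (\<lambda>t. ennreal (exp 1) * ennreal (exp (- \<alpha> * t))) y x"
  proof (rule Y.occ_mono)
    fix t :: real assume "0 \<le> t"
    have "1 \<le> exp 1 * exp (- \<alpha> * t)" if "t \<le> c * D"
    proof -
      have "\<alpha> * t \<le> 1" using that cD by (simp add: \<alpha>_def divide_simps)
      then show ?thesis by (simp add: exp_add[symmetric])
    qed
    then show "indicator {..c * D} t \<le> ennreal (exp 1) * ennreal (exp (- \<alpha> * t))"
      by (auto simp: ennreal_mult[symmetric] ennreal_1[symmetric] split: split_indicator simp del: ennreal_1 intro!: ennreal_leI)
  qed simp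
  also have "\<dots> = ennreal (exp 1) * occY A (\<lambda>t. ennreal (exp (- \<alpha> * t))) y x"
    by (rule Y.occ_cmult) simp
  also have "\<dots> \<le> ennreal (exp 1) * ennreal (sqrt 2 / \<alpha> * exp (- s) * speed \<omega> y)"
    unfolding s_def D_def by (intro mult_left_mono occY_exp_le_combes_thomas xy \<alpha>) simp
  also have "\<dots> = ennreal (exp 1 * (sqrt 2 / \<alpha> * exp (- s) * speed \<omega> y))"
    using \<alpha> speed_ge_1[of \<omega> y] by (intro ennreal_mult[symmetric]) auto
  also have "\<dots> \<le> ennreal (speed \<omega> y * (exp 1 * sqrt 2 * c * (fact (2 * Suc m) * (2 * c) ^ Suc m) / D ^ m))"
  proof (rule ennreal_leI)
    \<comment> \<open>The exponent \<open>2 * Suc m\<close> in \<open>s\<close> means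
      \<open>Suc m\<close> powers of \<open>D\<close>; one of them is spent on the prefactor
      \<open>1 / \<alpha> = c * D\<close>.\<close>
    have "exp (- s) \<le> fact (2 * Suc m) / s ^ (2 * Suc m)" by (rule exp_minus_le_fact[OF s])
    also have "s ^ (2 * Suc m) = (D / (2 * c)) ^ Suc m" unfolding power_mult s2 ..
    also have "fact (2 * Suc m) / (D / (2 * c)) ^ Suc m = fact (2 * Suc m) * (2 * c) ^ Suc m / D ^ Suc m"
      by (simp add: power_divide del: power_Suc)
    finally have *: "exp (- s) \<le> fact (2 * Suc m) * (2 * c) ^ Suc m / D ^ Suc m" .
    have "exp 1 * (sqrt 2 / \<alpha> * exp (- s) * speed \<omega> y) = speed \<omega> y * (exp 1 * sqrt 2 * c * D * exp (- s))"
      by (simp add: \<alpha>_def)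
    also have "\<dots> \<le> speed \<omega> y * (exp 1 * sqrt 2 * c * D * (fact (2 * Suc m) * (2 * c) ^ Suc m / D ^ Suc m))"
      using c D1 speed_ge_1[of \<omega> y] * by (intro mult_left_mono) auto
    also have "\<dots> = speed \<omega> y * (exp 1 * sqrt 2 * c * (fact (2 * Suc m) * (2 * c) ^ Suc m) / D ^ m)"
      using D1 by simp
    finally show "exp 1 * (sqrt 2 / \<alpha> * exp (- s) * speed \<omega> y)
      \<le> speed \<omega> y * (exp 1 * sqrt 2 * c * (fact (2 * Suc m) * (2 * c) ^ Suc m) / D ^ m)" .
  qed
  finally show ?thesis .
qed

end

section \<open>Occupation times in dimension at least three\<close>

lemma nn_integral_powr_tail:
  fixes a b :: real
  assumes "0 < a" "1 < b"
  shows "(\<integral>\<^sup>+t. ennreal (t powr - b) * indicator {a..} t \<partial>lborel) = ennreal (a powr (1 - b) / (b - 1))"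
proof -
  have "(\<integral>\<^sup>+t. ennreal (t powr - b) * indicator {a..} t \<partial>lborel)
    = ennreal (0 - (- (a powr (1 - b) / (b - 1))))"
  proof (rule nn_integral_FTC_atLeast)
    fix t assume t: "a \<le> t"
    show "((\<lambda>t. - (t powr (1 - b) / (b - 1))) has_real_derivative t powr - b) (at t)"
      using assms t by (auto intro!: derivative_eq_intros simp: divide_simps) (simp add: algebra_simps)
  next
    show "((\<lambda>t. - (t powr (1 - b) / (b - 1))) \<longlongrightarrow> 0) at_top"
      using assms by real_asymp
  qed auto
  then show ?thesis by simp
qed

lemma nn_integral_exp_tail:
  fixes a \<beta> :: real
  assumes "0 < \<beta>"
  shows "(\<integral>\<^sup>+t. ennreal (exp (- \<beta> * t)) * indicator {a..} t \<partial>lborel) = ennreal (exp (- \<beta> * a) / \<beta>)"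
proof -
  have "(\<integral>\<^sup>+t. ennreal (exp (- \<beta> * t)) * indicator {a..} t \<partial>lborel) = ennreal (0 - (- exp (- \<beta> * a) / \<beta>))"
  proof (rule nn_integral_FTC_atLeast)
    show "((\<lambda>t. - exp (- \<beta> * t) / \<beta>) \<longlongrightarrow> 0) at_top"
      using assms by real_asymp
  qed (use assms in \<open>auto intro!: derivative_eq_intros\<close>)
  then show ?thesis by simp
qed

lemma nn_integral_inverse_Icc:
  fixes a b :: real
  assumes "0 < a" "a \<le> b"
  shows "(\<integral>\<^sup>+t. ennreal (1 / t) * indicator {a..b} t \<partial>lborel) = ennreal (ln (b / a))"
proof -
  have "(\<integral>\<^sup>+t. ennreal (1 / t) * indicator {a..b} t \<partial>lborel) = ennreal (ln b - ln a)"
    using assms by (intro nn_integral_FTC_Icc) (auto intro!: derivative_eq_intros simp: divide_simps)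
  then show ?thesis using assms by (simp add: ln_div)
qed

context jump_chain begin

lemma sets_walk_at: "{s \<in> space (walk_law G x). walk_at G s t = Some y} \<in> sets (walk_law G x)"
proof -
  have "Measurable.pred (walk_law G x) (\<lambda>s. walk_at G (fst (s, t)) (snd (s, t)) = Some y)"
    by (rule measurable_compose[OF _ measurable_walk_at]) measurable
  then show ?thesis by (simp add: pred_def)
qed

lemma measurable_emeasure_walk_at:
  "(\<lambda>t. emeasure (walk_law G x) {s \<in> space (walk_law G x). walk_at G s t = Some y}) \<in> borel_measurable borel"
proof -
  interpret W: prob_space "walk_law G x" by (rule prob_space_walk_law)
  have "(\<lambda>p. (snd p, fst p)) \<in> measurable (borel \<Otimes>\<^sub>M walk_law G x) (walk_space \<Otimes>\<^sub>M (borel :: real measure))"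
    by measurable
  from measurable_compose[OF this measurable_walk_at[of y]]
  have [measurable]: "Measurable.pred (borel \<Otimes>\<^sub>M walk_law G x) (\<lambda>p. walk_at G (snd p) (fst p) = Some y)"
    by simp
  have "(\<lambda>t. \<integral>\<^sup>+s. (if walk_at G (snd (t, s)) (fst (t, s)) = Some y then 1 else 0) \<partial>walk_law G x) \<in> borel_measurable borel"
    by (rule W.borel_measurable_nn_integral) measurable
  moreover have "(\<integral>\<^sup>+s. (if walk_at G s t = Some y then 1 else 0) \<partial>walk_law G x)
    = emeasure (walk_law G x) {s \<in> space (walk_law G x). walk_at G s t = Some y}" for t
    by (subst nn_integral_indicator[OF sets_walk_at, symmetric]) (intro nn_integral_cong, auto split: split_indicator)
  ultimately show ?thesis by simp
qed

text \<open>At a fixed time the walk is in at most one state, so the probabilities of different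
  targets add up to at most one. This bounds the time spent in a whole set, where targetwise bounds
  would lose its cardinality.\<close>

lemma sum_occ_le:
  assumes [measurable]: "f \<in> borel_measurable borel" and F: "finite F"
  shows "(\<Sum>y\<in>F. occ G A f y x) \<le> (\<integral>\<^sup>+t. f t * indicator {0..} t \<partial>lborel)"
proof -
  interpret W: prob_space "walk_law G x" by (rule prob_space_walk_law)
  let ?E = "\<lambda>t y. {s \<in> space (walk_law G x). walk_at G s t = Some y}"
  note measurable_emeasure_walk_at[measurable]
  have "(\<Sum>y\<in>F. occ G A f y x) \<le> (\<Sum>y\<in>F. occ G UNIV f y x)"
    by (intro sum_mono occ_mono) auto
  also have "\<dots> = (\<Sum>y\<in>F. \<integral>\<^sup>+t. f t * indicator {0..} t * emeasure (walk_law G x) (?E t y) \<partial>lborel)"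
    by (intro sum.cong refl occ_UNIV_eq) measurable
  also have "\<dots> = (\<integral>\<^sup>+t. (\<Sum>y\<in>F. f t * indicator {0..} t * emeasure (walk_law G x) (?E t y)) \<partial>lborel)"
    by (rule nn_integral_sum[symmetric]) measurable
  also have "\<dots> \<le> (\<integral>\<^sup>+t. f t * indicator {0..} t * 1 \<partial>lborel)"
  proof (rule nn_integral_mono)
    fix t :: real
    have "(\<Sum>y\<in>F. emeasure (walk_law G x) (?E t y)) = emeasure (walk_law G x) (\<Union>y\<in>F. ?E t y)"
      using F sets_walk_at by (intro sum_emeasure) (auto simp: disjoint_family_on_def)
    also have "\<dots> \<le> 1" by (rule W.emeasure_le_1)
    finally have "f t * indicator {0..} t * (\<Sum>y\<in>F. emeasure (walk_law G x) (?E t y)) \<le> f t * indicator {0..} t * 1"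
      by (rule mult_left_mono) simp
    then show "(\<Sum>y\<in>F. f t * indicator {0..} t * emeasure (walk_law G x) (?E t y)) \<le> f t * indicator {0..} t * 1"
      by (simp add: sum_distrib_left)
  qed
  finally show ?thesis by simp
qed

end

definition short_time_const :: "real \<Rightarrow> nat \<Rightarrow> real" where
  "short_time_const c m = exp 1 * sqrt 2 * c * (fact (2 * Suc m) * (2 * c) ^ Suc m)"

text \<open>The summands stem from times below a multiple of the distance, from the remaining times
  below \<open>H\<close>, and from the heat kernel integral.\<close>

definition transient_const :: "nat \<Rightarrow> real \<Rightarrow> real \<Rightarrow> real \<Rightarrow> real" where
  "transient_const d CHK c1 c2 = short_time_const (max 1 c2) (d - 2) + 1 + CHK * (fact d / c1 ^ d + 2)"

lemma short_time_const_nonneg: "1 \<le> c \<Longrightarrow> 0 \<le> short_time_const c m"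
  by (simp add: short_time_const_def)

context percolation_env begin

text \<open>For distance zero the window contains no positive time, so it contributes nothing;
  \<open>max 1\<close> then lets both cases share one formula.\<close>

lemma occY_short_time':
  assumes xy: "x \<in> Cinf \<omega>" "y \<in> Cinf \<omega>" and c: "1 \<le> c"
  shows "occY A (indicator {..c * real (gdist \<omega> x y)}) y x
    \<le> ennreal (speed \<omega> y * (short_time_const c m / max 1 (real (gdist \<omega> x y)) ^ m))"
proof (cases "1 \<le> gdist \<omega> x y")
  case True
  then show ?thesis
    using occY_short_time[OF xy c True, of A m] by (simp add: short_time_const_def)
next
  case False
  then have "gdist \<omega> x y = 0" by simp
  then have "occY A (indicator {..c * real (gdist \<omega> x y)}) y x \<le> (\<integral>\<^sup>+t. indicator {..0} t * indicator {0..} (t :: real) \<partial>lborel)"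
    using Y.occ_le_nn_integral[of "indicator {..0}" A y x] by simp
  also have "\<dots> = (\<integral>\<^sup>+t. indicator {0::real} t \<partial>lborel)"
    by (intro nn_integral_cong) (auto split: split_indicator)
  also have "\<dots> = 0" by simp
  finally show ?thesis by simp
qed

text \<open>The time is bounded by the length of the window alone. The factor \<open>speed\<close>,
  which is at least one, is inserted because the Green function divides every contribution by
  it.\<close>

lemma occY_le_length:
  assumes "0 \<le> b"
  shows "occY A (indicator {..<b}) y x \<le> ennreal (speed \<omega> y * b)"
proof -
  have "occY A (indicator {..<b}) y x \<le> (\<integral>\<^sup>+t. indicator {..<b} t * indicator {0..} t \<partial>lborel)"
    by (rule Y.occ_le_nn_integral) simp
  also have "\<dots> = (\<integral>\<^sup>+t. indicator {0..<b} t \<partial>lborel)"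
    by (intro nn_integral_cong) (auto split: split_indicator)
  also have "\<dots> = ennreal b" using assms by simp
  also have "\<dots> \<le> ennreal (speed \<omega> y * b)"
    using assms speed_ge_1[of \<omega> y] mult_right_mono[of 1 "speed \<omega> y" b] by (intro ennreal_leI) simp
  finally show ?thesis .
qed

text \<open>The integral is split at \<open>D^2\<close>. Below,
  \<open>exp (- u) \<le> fact d / u^d\<close> with \<open>u = c1 * D^2 / t\<close> beats the
  singular power of \<open>t\<close>, and the integrand is of order \<open>D^(- d)\<close> on an
  interval of length \<open>D^2\<close>. Above, the integral of \<open>t^(- d / 2)\<close> is
  \<open>D^(2 - d) / (d / 2 - 1)\<close>, and \<open>d / 2 - 1\<close> is at least one half.\<close>

lemma heat_tail_transient:
  assumes d: "3 \<le> CARD('d)" and D: "0 < D"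
  shows "(\<integral>\<^sup>+t. indicator {1..} t * ennreal (CHK * t powr (- real CARD('d) / 2) * exp (- c1 * D\<^sup>2 / t)) * indicator {0..} t \<partial>lborel)
    \<le> ennreal (CHK * (fact CARD('d) / c1 ^ CARD('d) + 2) / D ^ (CARD('d) - 2))"
proof -
  define d where "d = CARD('d)"
  have d3: "3 \<le> d" using d by (simp add: d_def)
  define a where "a = CHK * (fact d / c1 ^ d / D ^ d)"
  have a0: "0 \<le> a" using pos_consts D by (simp add: a_def)
  have "indicator {1..} t * ennreal (CHK * t powr (- real d / 2) * exp (- c1 * D\<^sup>2 / t)) * indicator {0..} t
     \<le> ennreal a * indicator {0..D\<^sup>2} t + ennreal CHK * (ennreal (t powr - (real d / 2)) * indicator {D\<^sup>2..} t)" for t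
  proof (cases "1 \<le> t")
    case t: True
    show ?thesis
    proof (cases "t \<le> D\<^sup>2")
      case True
      define u where "u = c1 * D\<^sup>2 / t"
      have u: "0 < u" using t D pos_consts by (simp add: u_def)
      have "t powr (- real d / 2) * exp (- u) \<le> t powr (- real d / 2) * (fact d / u ^ d)"
        by (intro mult_left_mono exp_minus_le_fact u) simp
      also have "\<dots> = t powr (- real d / 2) * t powr (real d) * (fact d / (c1 ^ d * D ^ d * D ^ d))"
        using t by (simp add: u_def power_divide power_mult_distrib powr_realpow power2_eq_square mult_ac)
      also have "t powr (- real d / 2) * t powr (real d) = t powr (real d / 2)"
        by (simp add: powr_add[symmetric])
      also have "t powr (real d / 2) \<le> (D\<^sup>2) powr (real d / 2)"
        using t True by (intro powr_mono2) auto
      also have "(D\<^sup>2) powr (real d / 2) = D ^ d"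
      proof -
        have "D\<^sup>2 = D powr 2" using D by simp
        then show ?thesis using D by (simp only: powr_powr) (simp add: powr_realpow)
      qed
      also have "D ^ d * (fact d / (c1 ^ d * D ^ d * D ^ d)) = fact d / c1 ^ d / D ^ d"
        using D by simp
      finally have "t powr (- real d / 2) * exp (- u) \<le> fact d / c1 ^ d / D ^ d"
        using pos_consts D by (simp add: divide_right_mono mult_right_mono)
      then have "CHK * (t powr (- real d / 2) * exp (- u)) \<le> a"
        unfolding a_def using pos_consts by (intro mult_left_mono) auto
      then have "ennreal (CHK * t powr (- real d / 2) * exp (- c1 * D\<^sup>2 / t)) \<le> ennreal a"
        by (intro ennreal_leI) (simp add: u_def mult.assoc)
      then have "indicator {1..} t * ennreal (CHK * t powr (- real d / 2) * exp (- c1 * D\<^sup>2 / t)) * indicator {0..} t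
        \<le> ennreal a * indicator {0..D\<^sup>2} t"
        using t True by simp
      then show ?thesis by (rule order_trans) simp
    next
      case False
      have "CHK * t powr (- real d / 2) * exp (- c1 * D\<^sup>2 / t) \<le> CHK * t powr (- real d / 2) * 1"
        using t pos_consts by (intro mult_left_mono) auto
      then have "ennreal (CHK * t powr (- real d / 2) * exp (- c1 * D\<^sup>2 / t)) \<le> ennreal CHK * ennreal (t powr - (real d / 2))"
        using pos_consts by (subst ennreal_mult[symmetric]) (auto intro!: ennreal_leI)
      then show ?thesis using False t by simp
    qed
  qed simp
  then have "(\<integral>\<^sup>+t. indicator {1..} t * ennreal (CHK * t powr (- real d / 2) * exp (- c1 * D\<^sup>2 / t)) * indicator {0..} t \<partial>lborel)
    \<le> (\<integral>\<^sup>+t. ennreal a * indicator {0..D\<^sup>2} t + ennreal CHK * (ennreal (t powr - (real d / 2)) * indicator {D\<^sup>2..} t) \<partial>lborel)"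
    by (rule nn_integral_mono)
  also have "\<dots> = ennreal a * ennreal (D\<^sup>2) + ennreal CHK * ennreal ((D\<^sup>2) powr (1 - real d / 2) / (real d / 2 - 1))"
    using D d3 by (subst nn_integral_add) (auto simp: nn_integral_cmult nn_integral_cmult_indicator nn_integral_powr_tail)
  also have "\<dots> = ennreal (a * D\<^sup>2 + CHK * ((D\<^sup>2) powr (1 - real d / 2) / (real d / 2 - 1)))"
    using a0 d3 pos_consts
    by (subst ennreal_plus) (auto simp: ennreal_mult simp del: times_divide_eq_right)
  also have "\<dots> \<le> ennreal (CHK * (fact d / c1 ^ d + 2) / D ^ (d - 2))"
  proof (rule ennreal_leI)
    have Dd: "D ^ d = D ^ (d - 2) * D\<^sup>2"
    proof -
      have "d - 2 + 2 = d" using d3 by simp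
      then show ?thesis using power_add[of D "d - 2" 2] by (simp only:)
    qed
    have 1: "a * D\<^sup>2 = CHK * (fact d / c1 ^ d) / D ^ (d - 2)"
      using D by (simp add: a_def Dd)
    have "(D\<^sup>2) powr (1 - real d / 2) = 1 / D ^ (d - 2)"
    proof -
      have "D\<^sup>2 = D powr 2" using D by simp
      then have "(D\<^sup>2) powr (1 - real d / 2) = D powr (2 * (1 - real d / 2))" by (simp only: powr_powr)
      also have "2 * (1 - real d / 2) = - real (d - 2)" using d3 by simp
      also have "D powr \<dots> = 1 / D ^ (d - 2)" using D by (simp add: powr_minus powr_realpow inverse_eq_divide)
      finally show ?thesis .
    qed
    moreover have "1 / D ^ (d - 2) / (real d / 2 - 1) \<le> 2 / D ^ (d - 2)"
      using D d3 by (simp add: divide_simps)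
    ultimately have 2: "CHK * ((D\<^sup>2) powr (1 - real d / 2) / (real d / 2 - 1)) \<le> CHK * (2 / D ^ (d - 2))"
      using pos_consts by (intro mult_left_mono) auto
    show "a * D\<^sup>2 + CHK * ((D\<^sup>2) powr (1 - real d / 2) / (real d / 2 - 1)) \<le> CHK * (fact d / c1 ^ d + 2) / D ^ (d - 2)"
      using 1 2 by (simp add: add_divide_distrib distrib_left)
  qed
  finally show ?thesis by (simp add: d_def)
qed

text \<open>Times are cut at \<open>c * D\<close> and at \<open>H\<close>. Combes-Thomas handles the
  first part, the mere length of the window the second, and the heat kernel the last. Each part is
  brought to the common decay \<open>M^(- k)\<close>, where \<open>k = d - 2\<close>.\<close>

lemma occY_transient:
  assumes xy: "x \<in> Cinf \<omega>" "y \<in> Cinf \<omega>" and d: "3 \<le> CARD('d)"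
  shows "occY A (\<lambda>_. 1) y x \<le> ennreal (speed \<omega> y *
    (transient_const CARD('d) CHK c1 c2 * H ^ (CARD('d) - 1) / max 1 (real (gdist \<omega> x y)) ^ (CARD('d) - 2)))"
proof -
  define k where "k = CARD('d) - 2"
  define D where "D = real (gdist \<omega> x y)"
  define c where "c = max 1 c2"
  define M where "M = max 1 D"
  have c: "1 \<le> c" "c2 \<le> c" by (auto simp: c_def)
  have M: "1 \<le> M" "0 < M ^ k" by (auto simp: M_def)
  have D0: "0 \<le> D" by (simp add: D_def)
  have HS: "1 \<le> H ^ Suc k" using H by (rule one_le_power)
  define K3 where "K3 = CHK * (fact CARD('d) / c1 ^ CARD('d) + 2)"
  have K3: "0 \<le> K3" using pos_consts by (simp add: K3_def)
  let ?f1 = "indicator {..c * D} :: real \<Rightarrow> ennreal"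
  let ?f2 = "indicator {c * D<..<H} :: real \<Rightarrow> ennreal"
  let ?f3 = "indicator {max H (c * D)..} :: real \<Rightarrow> ennreal"
  have "occY A (\<lambda>_. 1) y x \<le> occY A (\<lambda>t. ?f1 t + (?f2 t + ?f3 t)) y x"
    by (rule Y.occ_mono) (auto split: split_indicator)
  also have "\<dots> = occY A ?f1 y x + (occY A ?f2 y x + occY A ?f3 y x)"
    by (simp add: Y.occ_add)
  also have "\<dots> \<le> ennreal (speed \<omega> y * (short_time_const c k / M ^ k))
     + (ennreal (speed \<omega> y * (H ^ Suc k / M ^ k)) + ennreal (speed \<omega> y * (K3 / M ^ k)))"
  proof (intro add_mono)
    show "occY A ?f1 y x \<le> ennreal (speed \<omega> y * (short_time_const c k / M ^ k))"
      unfolding D_def M_def by (rule occY_short_time'[OF xy c(1)])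
    show "occY A ?f2 y x \<le> ennreal (speed \<omega> y * (H ^ Suc k / M ^ k))"
    \<comment> \<open>The source of the power \<open>H^(d - 1)\<close>: if \<open>M \<le> H\<close>,
      the length \<open>H\<close> is multiplied by \<open>(H / M)^k\<close>, which is at least one;
      if \<open>H < M\<close>, then \<open>H < D\<close> and the window is empty.\<close>
    proof (cases "M \<le> H")
      case True
      have "occY A ?f2 y x \<le> occY A (indicator {..<H}) y x"
        by (rule Y.occ_mono) (auto split: split_indicator)
      also have "\<dots> \<le> ennreal (speed \<omega> y * H)" using H by (intro occY_le_length) simp
      also have "\<dots> \<le> ennreal (speed \<omega> y * (H ^ Suc k / M ^ k))"
      proof (intro ennreal_leI mult_left_mono)
        have "H * M ^ k \<le> H * H ^ k" using True M H by (intro mult_left_mono power_mono) auto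
        then show "H \<le> H ^ Suc k / M ^ k" using M by (simp add: pos_le_divide_eq)
      qed (use speed_ge_1[of \<omega> y] in simp)
      finally show ?thesis .
    next
      case False
      then have "H < D" using H by (auto simp: M_def max_def split: if_splits)
      also have "D \<le> c * D" using c D0 mult_right_mono[of 1 c D] by simp
      finally have "occY A ?f2 y x \<le> occY A (\<lambda>_. 0) y x"
        by (intro Y.occ_mono) (auto split: split_indicator)
      also have "\<dots> \<le> 0" using Y.occ_le_nn_integral[of "\<lambda>_. 0" A y x] by simp
      finally show ?thesis by simp
    qed
    show "occY A ?f3 y x \<le> ennreal (speed \<omega> y * (K3 / M ^ k))"
    proof -
      have "occY A ?f3 y x \<le> ennreal (speed \<omega> y) * (\<integral>\<^sup>+t. ?f3 t * ennreal (CHK * t powr (- real CARD('d) / 2) * exp (- c1 * D\<^sup>2 / t)) * indicator {0..} t \<partial>lborel)"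
        unfolding D_def
      proof (rule occY_le_heat_kernel[OF xy])
        fix t :: real assume "0 \<le> t" "indicator {max H (c * real (gdist \<omega> x y))..} t \<noteq> (0 :: ennreal)"
        then have "H \<le> t" "c * real (gdist \<omega> x y) \<le> t" by (auto split: split_indicator_asm)
        moreover have "c2 * real (gdist \<omega> x y) \<le> c * real (gdist \<omega> x y)" using c by (intro mult_right_mono) auto
        ultimately show "H \<le> t \<and> c2 * real (gdist \<omega> x y) \<le> t" by linarith
      qed simp
      also have "\<dots> \<le> ennreal (speed \<omega> y) * ennreal (K3 / M ^ k)"
      proof (rule mult_left_mono)
        show "(\<integral>\<^sup>+t. ?f3 t * ennreal (CHK * t powr (- real CARD('d) / 2) * exp (- c1 * D\<^sup>2 / t)) * indicator {0..} t \<partial>lborel)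
          \<le> ennreal (K3 / M ^ k)"
        proof (cases "D = 0")
          case False
          then have MD: "M = D" by (auto simp: M_def D_def)
          have "(\<integral>\<^sup>+t. ?f3 t * ennreal (CHK * t powr (- real CARD('d) / 2) * exp (- c1 * D\<^sup>2 / t)) * indicator {0..} t \<partial>lborel)
            \<le> (\<integral>\<^sup>+t. indicator {1..} t * ennreal (CHK * t powr (- real CARD('d) / 2) * exp (- c1 * D\<^sup>2 / t)) * indicator {0..} t \<partial>lborel)"
            using H by (intro nn_integral_mono) (auto split: split_indicator)
          also have "\<dots> \<le> ennreal (K3 / M ^ k)"
            unfolding K3_def MD k_def using False D0 by (intro heat_tail_transient[OF d]) simp
          finally show ?thesis .
        next
          case True
          have "(\<integral>\<^sup>+t. ?f3 t * ennreal (CHK * t powr (- real CARD('d) / 2) * exp (- c1 * D\<^sup>2 / t)) * indicator {0..} t \<partial>lborel)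
            \<le> (\<integral>\<^sup>+t. ennreal CHK * (ennreal (t powr - (real CARD('d) / 2)) * indicator {1..} t) \<partial>lborel)"
            using H True pos_consts by (intro nn_integral_mono) (auto split: split_indicator simp: ennreal_mult)
          also have "\<dots> = ennreal CHK * ennreal (1 / (real CARD('d) / 2 - 1))"
            using d by (subst nn_integral_cmult) (auto simp: nn_integral_powr_tail)
          also have "\<dots> = ennreal (CHK * (1 / (real CARD('d) / 2 - 1)))"
            using pos_consts d by (intro ennreal_mult[symmetric]) auto
          also have "\<dots> \<le> ennreal (K3 / M ^ k)"
          proof (rule ennreal_leI)
            have "CHK * (1 / (real CARD('d) / 2 - 1)) \<le> CHK * 2"
              using pos_consts d by (intro mult_left_mono) (auto simp: divide_simps)
            also have "\<dots> \<le> K3" using pos_consts by (simp add: K3_def)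
            finally show "CHK * (1 / (real CARD('d) / 2 - 1)) \<le> K3 / M ^ k" using True by (simp add: M_def)
          qed
          finally show ?thesis .
        qed
      qed simp
      also have "\<dots> = ennreal (speed \<omega> y * (K3 / M ^ k))"
        using speed_ge_1[of \<omega> y] K3 M by (intro ennreal_mult[symmetric]) auto
      finally show ?thesis .
    qed
  qed
  also have "\<dots> = ennreal (speed \<omega> y * (short_time_const c k / M ^ k)
     + (speed \<omega> y * (H ^ Suc k / M ^ k) + speed \<omega> y * (K3 / M ^ k)))"
    using speed_ge_1[of \<omega> y] K3 M H short_time_const_nonneg[OF c(1), of k]
    by (simp add: ennreal_plus[symmetric] del: ennreal_plus)
  also have "\<dots> \<le> ennreal (speed \<omega> y * (transient_const CARD('d) CHK c1 c2 * H ^ Suc k / M ^ k))"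
  proof (rule ennreal_leI)
    have "speed \<omega> y * (short_time_const c k / M ^ k) + (speed \<omega> y * (H ^ Suc k / M ^ k) + speed \<omega> y * (K3 / M ^ k))
      = speed \<omega> y * ((short_time_const c k + (H ^ Suc k + K3)) / M ^ k)"
      by (simp add: add_divide_distrib distrib_left)
    also have "\<dots> \<le> speed \<omega> y * ((short_time_const c k * H ^ Suc k + (H ^ Suc k + K3 * H ^ Suc k)) / M ^ k)"
      using M HS K3 short_time_const_nonneg[OF c(1), of k] speed_ge_1[of \<omega> y]
        mult_left_mono[OF HS, of K3] mult_left_mono[OF HS, of "short_time_const c k"]
      by (intro mult_left_mono divide_right_mono add_mono) auto
    also have "\<dots> = speed \<omega> y * (transient_const CARD('d) CHK c1 c2 * H ^ Suc k / M ^ k)"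
      by (simp only: transient_const_def K3_def c_def k_def distrib_right mult_1 add.assoc)
    finally show "speed \<omega> y * (short_time_const c k / M ^ k) + (speed \<omega> y * (H ^ Suc k / M ^ k) + speed \<omega> y * (K3 / M ^ k))
      \<le> speed \<omega> y * (transient_const CARD('d) CHK c1 c2 * H ^ Suc k / M ^ k)" .
  qed
  finally show ?thesis using d by (simp add: k_def M_def D_def Suc_diff_le numeral_2_eq_2 Suc_diff_Suc)
qed

end

section \<open>Occupation times in dimension two\<close>

text \<open>The last bracket collects the two ends of the heat kernel integral:
  \<open>1 / c1\<close> from times below the squared cutoff radius, \<open>1\<close> from times
  beyond the discount scale.\<close>

definition planar_const :: "real \<Rightarrow> real \<Rightarrow> real \<Rightarrow> real" where
  "planar_const CHK c1 c2 = short_time_const (max 1 c2) 0 + CHK * (1 / c1 + 1)"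

context percolation_env begin

text \<open>The discount cuts the divergent integral at \<open>T = 1 / \<beta>\<close>. Between
  \<open>r^2\<close> and \<open>T\<close> the bound \<open>CHK / t\<close> is integrated exactly,
  which yields the logarithm with the sharp factor \<open>CHK\<close>; the Gaussian factor tames
  times below \<open>r^2\<close> and the discount those above \<open>T\<close>. The cutoff
  \<open>r\<close> may be smaller than the graph distance, so that a multiple of the Euclidean
  distance can be inserted.\<close>

lemma occY_planar_resolvent:
  assumes d: "CARD('d) = 2" and xy: "x \<in> Cinf \<omega>" "y \<in> Cinf \<omega>" and \<beta>: "0 < \<beta>"
    and r: "0 < r" "r\<^sup>2 \<le> 1 / \<beta>" "r \<le> max 1 (real (gdist \<omega> x y))"
  shows "occY A (\<lambda>t. ennreal (exp (- \<beta> * t))) y x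
    \<le> ennreal (speed \<omega> y * (H + planar_const CHK c1 c2 + CHK * ln (1 / \<beta> / r\<^sup>2)))"
proof -
  define D where "D = real (gdist \<omega> x y)"
  define c where "c = max 1 c2"
  define T where "T = 1 / \<beta>"
  have T: "0 < T" using \<beta> by (simp add: T_def)
  have c: "1 \<le> c" "c2 \<le> c" by (auto simp: c_def)
  have D0: "0 \<le> D" by (simp add: D_def)
  define L where "L = ln (T / r\<^sup>2)"
  have L: "0 \<le> L"
    using r(2) zero_less_power[OF r(1), of 2] unfolding T_def[symmetric] L_def
    by (intro ln_ge_zero) (simp add: pos_le_divide_eq)
  let ?f1 = "indicator {..<H} :: real \<Rightarrow> ennreal"
  let ?f2 = "indicator {..c * D} :: real \<Rightarrow> ennreal"
  let ?f3 = "\<lambda>t. indicator {max H (c * D)..} t * ennreal (exp (- \<beta> * t))"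
  let ?h = "\<lambda>t. CHK * t powr (- real CARD('d) / 2) * exp (- c1 * D\<^sup>2 / t)"
  have "occY A (\<lambda>t. ennreal (exp (- \<beta> * t))) y x \<le> occY A (\<lambda>t. ?f1 t + (?f2 t + ?f3 t)) y x"
  proof (rule Y.occ_mono)
    fix t :: real assume "0 \<le> t"
    then have e1: "ennreal (exp (- \<beta> * t)) \<le> 1" using \<beta> by simp
    consider "t < H" | "t \<le> c * D" | "max H (c * D) \<le> t" by linarith
    then show "ennreal (exp (- \<beta> * t)) \<le> ?f1 t + (?f2 t + ?f3 t)"
    proof cases
      case 1
      then have "ennreal (exp (- \<beta> * t)) \<le> ?f1 t" using e1 by simp
      then show ?thesis by (rule order_trans) simp
    next
      case 2
      then have "ennreal (exp (- \<beta> * t)) \<le> ?f2 t + ?f3 t" using e1 by (simp add: add_increasing2)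
      then show ?thesis by (rule order_trans) (simp add: add_increasing)
    next
      case 3
      then have "ennreal (exp (- \<beta> * t)) = ?f3 t" by simp
      also have "\<dots> \<le> ?f1 t + (?f2 t + ?f3 t)" by (intro add_increasing) simp_all
      finally show ?thesis .
    qed
  qed simp
  also have "\<dots> = occY A ?f1 y x + (occY A ?f2 y x + occY A ?f3 y x)"
    by (simp add: Y.occ_add)
  also have "\<dots> \<le> ennreal (speed \<omega> y * H) + (ennreal (speed \<omega> y * short_time_const c 0)
      + ennreal (speed \<omega> y * (CHK * (1 / c1 + 1 + L))))"
  proof (intro add_mono)
    show "occY A ?f1 y x \<le> ennreal (speed \<omega> y * H)" using H by (intro occY_le_length) simp
    show "occY A ?f2 y x \<le> ennreal (speed \<omega> y * short_time_const c 0)"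
      unfolding D_def using occY_short_time'[OF xy c(1), of A 0] by simp
    have "occY A ?f3 y x \<le> ennreal (speed \<omega> y) * (\<integral>\<^sup>+t. ?f3 t * ennreal (?h t) * indicator {0..} t \<partial>lborel)"
      unfolding D_def
    proof (rule occY_le_heat_kernel[OF xy])
      fix t :: real assume "0 \<le> t" "indicator {max H (c * real (gdist \<omega> x y))..} t * ennreal (exp (- \<beta> * t)) \<noteq> 0"
      then have "H \<le> t" "c * real (gdist \<omega> x y) \<le> t" by (auto split: split_indicator_asm)
      moreover have "c2 * real (gdist \<omega> x y) \<le> c * real (gdist \<omega> x y)" using c by (intro mult_right_mono) auto
      ultimately show "H \<le> t \<and> c2 * real (gdist \<omega> x y) \<le> t" by linarith
    qed simp
    also have "\<dots> \<le> ennreal (speed \<omega> y) * ennreal (CHK * (1 / c1 + 1 + L))"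
    proof (rule mult_left_mono)
      define a where "a = CHK * (1 / (c1 * r\<^sup>2))"
      have a0: "0 \<le> a" using pos_consts by (simp add: a_def)
      have "?f3 t * ennreal (?h t) * indicator {0..} t
        \<le> ennreal a * indicator {0..r\<^sup>2} t + (ennreal CHK * (ennreal (1 / t) * indicator {r\<^sup>2..T} t)
           + ennreal (CHK / T) * (ennreal (exp (- \<beta> * t)) * indicator {T..} t))" for t
      proof (cases "max H (c * D) \<le> t")
        case True
        then have t: "1 \<le> t" using H by simp
        have tp: "t powr (- real CARD('d) / 2) = 1 / t"
          using t d by (simp add: powr_minus_divide)
        have f3: "?f3 t * ennreal (?h t) * indicator {0..} t = ennreal (exp (- \<beta> * t) * ?h t)"
          using True t pos_consts by (simp add: ennreal_mult)
        have h1: "?h t \<le> CHK * (1 / t)"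
        proof -
          have "CHK * (1 / t) * exp (- c1 * D\<^sup>2 / t) \<le> CHK * (1 / t) * 1"
            using t pos_consts by (intro mult_left_mono) auto
          then show ?thesis unfolding tp by simp
        qed
        have h0: "0 \<le> ?h t" using pos_consts by simp
        have e1: "exp (- \<beta> * t) \<le> 1" using \<beta> t by simp
        consider "t < r\<^sup>2" | "r\<^sup>2 \<le> t" "t \<le> T" | "T < t" by linarith
        then show ?thesis
        proof cases
          case 1
          \<comment> \<open>Here \<open>t\<close> is at least one, so this range of times is met
            only if \<open>r\<close> exceeds one. Then \<open>r \<le> max 1 D\<close> gives
            \<open>r \<le> D\<close>, and the Gaussian factor is effective.\<close>
          then have "1 < r\<^sup>2" using t by simp
          then have r1: "1 < r" using r power_le_one[of r 2] by (cases "1 < r") auto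
          then have rD: "r \<le> D" using r by (simp add: D_def)
          have D1: "0 < D" using r1 rD by simp
          have "exp (- (c1 * D\<^sup>2 / t)) \<le> fact 1 / (c1 * D\<^sup>2 / t) ^ 1"
            using pos_consts D1 t by (intro exp_minus_le_fact) simp
          then have "?h t \<le> CHK * (1 / t) * (1 / (c1 * D\<^sup>2 / t))"
            using pos_consts t unfolding tp by (intro mult_left_mono) simp_all
          also have "\<dots> = CHK * (1 / (c1 * D\<^sup>2))" using t by simp
          also have "\<dots> \<le> a"
            unfolding a_def using pos_consts r(1) rD
            by (intro mult_left_mono divide_left_mono power_mono mult_pos_pos) auto
          finally have "exp (- \<beta> * t) * ?h t \<le> a"
            using mult_mono[OF e1, of "?h t" a] h0 by simp
          then have "?f3 t * ennreal (?h t) * indicator {0..} t \<le> ennreal a * indicator {0..r\<^sup>2} t"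
            unfolding f3 using 1 t by (simp add: ennreal_leI)
          then show ?thesis by (rule order_trans) simp
        next
          case 2
          have "exp (- \<beta> * t) * ?h t \<le> CHK * (1 / t)"
            using mult_mono[OF e1 h1] h0 by simp
          then have "?f3 t * ennreal (?h t) * indicator {0..} t \<le> ennreal CHK * (ennreal (1 / t) * indicator {r\<^sup>2..T} t)"
            unfolding f3 using 2 t pos_consts by (simp add: ennreal_mult[symmetric] ennreal_leI)
          also have "\<dots> \<le> ennreal CHK * (ennreal (1 / t) * indicator {r\<^sup>2..T} t)
             + ennreal (CHK / T) * (ennreal (exp (- \<beta> * t)) * indicator {T..} t)" by simp
          finally show ?thesis by (rule order_trans) simp
        next
          case 3
          have "?h t \<le> CHK / T"
            using h1 3 T pos_consts by (intro order_trans[OF h1]) (simp add: frac_le)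
          then have "exp (- \<beta> * t) * ?h t \<le> CHK / T * exp (- \<beta> * t)"
            using mult_left_mono[of "?h t" "CHK / T" "exp (- \<beta> * t)"] by (simp add: mult.commute)
          then have "?f3 t * ennreal (?h t) * indicator {0..} t
            \<le> ennreal (CHK / T) * (ennreal (exp (- \<beta> * t)) * indicator {T..} t)"
            unfolding f3 using 3 T pos_consts by (simp add: ennreal_mult[symmetric] ennreal_leI)
          also have "\<dots> \<le> ennreal CHK * (ennreal (1 / t) * indicator {r\<^sup>2..T} t)
             + ennreal (CHK / T) * (ennreal (exp (- \<beta> * t)) * indicator {T..} t)" by simp
          finally show ?thesis by (rule order_trans) simp
        qed
      qed simp
      then have "(\<integral>\<^sup>+t. ?f3 t * ennreal (?h t) * indicator {0..} t \<partial>lborel)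
        \<le> (\<integral>\<^sup>+t. ennreal a * indicator {0..r\<^sup>2} t + (ennreal CHK * (ennreal (1 / t) * indicator {r\<^sup>2..T} t)
           + ennreal (CHK / T) * (ennreal (exp (- \<beta> * t)) * indicator {T..} t)) \<partial>lborel)"
        by (rule nn_integral_mono)
      also have "\<dots> = ennreal a * ennreal (r\<^sup>2) + (ennreal CHK * ennreal L + ennreal (CHK / T) * ennreal (exp (- \<beta> * T) / \<beta>))"
      proof -
        have "(\<integral>\<^sup>+t. ennreal a * indicator {0..r\<^sup>2} t \<partial>lborel) = ennreal a * ennreal (r\<^sup>2)"
          by (subst nn_integral_cmult_indicator) auto
        moreover have "(\<integral>\<^sup>+t. ennreal CHK * (ennreal (1 / t) * indicator {r\<^sup>2..T} t) \<partial>lborel) = ennreal CHK * ennreal L"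
          using r by (subst nn_integral_cmult) (simp_all add: nn_integral_inverse_Icc L_def T_def)
        moreover have "(\<integral>\<^sup>+t. ennreal (CHK / T) * (ennreal (exp (- \<beta> * t)) * indicator {T..} t) \<partial>lborel)
          = ennreal (CHK / T) * ennreal (exp (- \<beta> * T) / \<beta>)"
          unfolding nn_integral_exp_tail[OF \<beta>, symmetric] by (rule nn_integral_cmult) simp
        ultimately show ?thesis by (subst nn_integral_add, simp, simp, subst nn_integral_add) simp_all
      qed
      also have "\<dots> = ennreal (a * r\<^sup>2 + (CHK * L + CHK / T * (exp (- \<beta> * T) / \<beta>)))"
        using a0 L T \<beta> pos_consts
        by (simp only: ennreal_mult[symmetric] ennreal_plus[symmetric] mult_nonneg_nonneg zero_le_power2
            divide_nonneg_pos add_nonneg_nonneg less_imp_le exp_ge_zero)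
      also have "\<dots> \<le> ennreal (CHK * (1 / c1 + 1 + L))"
      proof (rule ennreal_leI)
        have "a * r\<^sup>2 = CHK * (1 / c1)" using r by (simp add: a_def)
        moreover have "CHK / T * (exp (- \<beta> * T) / \<beta>) \<le> CHK * 1"
          using \<beta> pos_consts by (simp add: T_def)
        ultimately show "a * r\<^sup>2 + (CHK * L + CHK / T * (exp (- \<beta> * T) / \<beta>)) \<le> CHK * (1 / c1 + 1 + L)"
          by (simp add: distrib_left)
      qed
      finally show "(\<integral>\<^sup>+t. ?f3 t * ennreal (?h t) * indicator {0..} t \<partial>lborel) \<le> ennreal (CHK * (1 / c1 + 1 + L))" .
    qed simp
    also have "\<dots> = ennreal (speed \<omega> y * (CHK * (1 / c1 + 1 + L)))"
      using speed_ge_1[of \<omega> y] pos_consts L by (intro ennreal_mult[symmetric]) auto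
    finally show "occY A ?f3 y x \<le> ennreal (speed \<omega> y * (CHK * (1 / c1 + 1 + L)))" .
  qed
  also have "\<dots> = ennreal (speed \<omega> y * H + (speed \<omega> y * short_time_const c 0 + speed \<omega> y * (CHK * (1 / c1 + 1 + L))))"
    using speed_ge_1[of \<omega> y] pos_consts L H short_time_const_nonneg[OF c(1), of 0]
    by (simp add: ennreal_plus[symmetric] del: ennreal_plus)
  also have "speed \<omega> y * H + (speed \<omega> y * short_time_const c 0 + speed \<omega> y * (CHK * (1 / c1 + 1 + L)))
    = speed \<omega> y * (H + planar_const CHK c1 c2 + CHK * ln (1 / \<beta> / r\<^sup>2))"
    unfolding planar_const_def L_def T_def c_def by (simp only: distrib_left add.assoc)
  finally show ?thesis .
qed

text \<open>By \<open>1 - exp (- \<beta> * t) \<le> \<beta> * t\<close> the difference of the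
  discounts carries a factor \<open>\<beta> * t\<close>. Against \<open>CHK / t\<close> it
  integrates to \<open>CHK\<close>, with no logarithm; times below \<open>b\<close> contribute at
  most \<open>\<beta> * b^2\<close>, which is at most one, and times below \<open>H\<close> at most
  \<open>H\<close>.\<close>

lemma resolvent_diff_le:
  assumes d: "CARD('d) = 2" and xy: "x \<in> Cinf \<omega>" "y \<in> Cinf \<omega>" and \<beta>: "0 < \<beta>"
    and D: "(max 1 c2 * real (gdist \<omega> x y))\<^sup>2 \<le> 1 / \<beta>"
  shows "resolvent \<beta> A y x \<le> resolvent (2 * \<beta>) A y x + speed \<omega> y * (H + 1 + CHK)"
proof -
  define b where "b = max 1 c2 * real (gdist \<omega> x y)"
  have b: "0 \<le> b" "c2 * real (gdist \<omega> x y) \<le> b" by (auto simp: b_def intro: mult_right_mono)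
  have b2: "\<beta> * b * b \<le> 1" using D \<beta> by (simp add: b_def[symmetric] power2_eq_square field_simps)
  let ?f0 = "\<lambda>t. ennreal (exp (- (2 * \<beta>) * t))"
  let ?f1 = "indicator {..<H} :: real \<Rightarrow> ennreal"
  let ?f2 = "\<lambda>t. ennreal (\<beta> * b) * indicator {..<b} t"
  let ?f3 = "\<lambda>t. indicator {max H b..} t * ennreal (\<beta> * t * exp (- \<beta> * t))"
  have split: "ennreal (exp (- \<beta> * t)) \<le> ?f0 t + (?f1 t + (?f2 t + ?f3 t))" if "0 \<le> t" for t
  proof -
    have e: "exp (- (2 * \<beta>) * t) = exp (- \<beta> * t) * exp (- \<beta> * t)"
      by (simp add: exp_add[symmetric])
    have "1 - exp (- \<beta> * t) \<le> \<beta> * t" using exp_ge_add_one_self[of "- \<beta> * t"] by simp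
    then have "exp (- \<beta> * t) * (1 - exp (- \<beta> * t)) \<le> exp (- \<beta> * t) * (\<beta> * t)"
      by (intro mult_left_mono) auto
    then have le: "exp (- \<beta> * t) \<le> exp (- (2 * \<beta>) * t) + \<beta> * t * exp (- \<beta> * t)"
      unfolding e by (simp add: algebra_simps)
    have bt: "0 \<le> \<beta> * t" using \<beta> that by simp
    have e1: "exp (- \<beta> * t) \<le> 1" using bt by simp
    consider "t < H" | "H \<le> t" "t < b" | "max H b \<le> t" by linarith
    then show ?thesis
    proof cases
      case 1
      then have "ennreal (exp (- \<beta> * t)) \<le> ?f1 t" using e1 by simp
      also have "\<dots> \<le> ?f1 t + (?f2 t + ?f3 t)" by simp
      finally show ?thesis by (rule order_trans) simp
    next
      case 2
      have "\<beta> * t * exp (- \<beta> * t) \<le> \<beta> * b * 1"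
        using 2 e1 \<beta> that b by (intro mult_mono) auto
      then have "ennreal (exp (- \<beta> * t)) \<le> ennreal (exp (- (2 * \<beta>) * t) + \<beta> * b)"
        using le by (intro ennreal_leI) linarith
      also have "\<dots> = ?f0 t + ?f2 t" using 2 \<beta> b by (simp add: ennreal_plus)
      also have "\<dots> \<le> ?f0 t + (?f1 t + (?f2 t + ?f3 t))" by (intro add_left_mono) (simp add: add_increasing)
      finally show ?thesis .
    next
      case 3
      have "ennreal (exp (- \<beta> * t)) \<le> ennreal (exp (- (2 * \<beta>) * t) + \<beta> * t * exp (- \<beta> * t))"
        using le by (intro ennreal_leI)
      also have "\<dots> = ?f0 t + ?f3 t" using 3 bt by (subst ennreal_plus) auto
      also have "\<dots> \<le> ?f0 t + (?f1 t + (?f2 t + ?f3 t))" by (intro add_left_mono) (simp add: add_increasing)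
      finally show ?thesis .
    qed
  qed
  have "occY A (\<lambda>t. ennreal (exp (- \<beta> * t))) y x \<le> occY A (\<lambda>t. ?f0 t + (?f1 t + (?f2 t + ?f3 t))) y x"
    by (rule Y.occ_mono) (use split in auto)
  also have "\<dots> = occY A ?f0 y x + (occY A ?f1 y x + (occY A ?f2 y x + occY A ?f3 y x))"
    by (simp add: Y.occ_add)
  also have "\<dots> \<le> ennreal (resolvent (2 * \<beta>) A y x) + (ennreal (speed \<omega> y * H) + (ennreal (speed \<omega> y) + ennreal (speed \<omega> y * CHK)))"
  proof (intro add_mono)
    show "occY A ?f0 y x \<le> ennreal (resolvent (2 * \<beta>) A y x)"
      using occ_eq_resolvent[of "2 * \<beta>" A y x] \<beta> by simp
    show "occY A ?f1 y x \<le> ennreal (speed \<omega> y * H)" using H by (intro occY_le_length) simp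
    have "occY A ?f2 y x = ennreal (\<beta> * b) * occY A (indicator {..<b}) y x" by (rule Y.occ_cmult) simp
    also have "\<dots> \<le> ennreal (\<beta> * b) * ennreal (speed \<omega> y * b)"
      by (intro mult_left_mono occY_le_length b) simp
    also have "\<dots> = ennreal (\<beta> * b * (speed \<omega> y * b))"
      using \<beta> b speed_ge_1[of \<omega> y] by (intro ennreal_mult[symmetric]) auto
    also have "\<dots> \<le> ennreal (speed \<omega> y)"
      using mult_left_mono[OF b2, of "speed \<omega> y"] speed_ge_1[of \<omega> y] by (intro ennreal_leI) (simp add: mult_ac)
    finally show "occY A ?f2 y x \<le> ennreal (speed \<omega> y)" .
    have "occY A ?f3 y x \<le> ennreal (speed \<omega> y) * (\<integral>\<^sup>+t. ?f3 t * ennreal (gaussian x y t) * indicator {0..} t \<partial>lborel)"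
    proof (rule occY_le_heat_kernel[OF xy])
      fix t :: real assume "0 \<le> t" "?f3 t \<noteq> 0"
      then have "H \<le> t" "b \<le> t" by (auto split: split_indicator_asm)
      then show "H \<le> t \<and> c2 * real (gdist \<omega> x y) \<le> t" using b by linarith
    qed simp
    also have "\<dots> \<le> ennreal (speed \<omega> y) * ennreal CHK"
    proof (rule mult_left_mono)
      have "(\<integral>\<^sup>+t. ?f3 t * ennreal (gaussian x y t) * indicator {0..} t \<partial>lborel)
        \<le> (\<integral>\<^sup>+t. ennreal (CHK * \<beta>) * (ennreal (exp (- \<beta> * t)) * indicator {0..} t) \<partial>lborel)"
      proof (rule nn_integral_mono)
        fix t :: real
        show "?f3 t * ennreal (gaussian x y t) * indicator {0..} t
          \<le> ennreal (CHK * \<beta>) * (ennreal (exp (- \<beta> * t)) * indicator {0..} t)"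
        proof (cases "max H b \<le> t")
          case True
          then have t: "1 \<le> t" using H by simp
          have tp: "t powr (- real CARD('d) / 2) = 1 / t"
            using t d by (simp add: powr_minus_divide)
          have "\<beta> * t * exp (- \<beta> * t) * (CHK * (1 / t) * exp (- c1 * (real (gdist \<omega> x y))\<^sup>2 / t))
            \<le> \<beta> * t * exp (- \<beta> * t) * (CHK * (1 / t) * 1)"
            using t \<beta> pos_consts by (intro mult_left_mono) auto
          also have "\<dots> = CHK * \<beta> * exp (- \<beta> * t)" using t by simp
          finally show ?thesis
            unfolding tp using True t \<beta> pos_consts
            by (simp only: indicator_simps atLeast_iff mult_1 mult_1_right order_trans[OF zero_le_one t])
               (simp add: ennreal_mult[symmetric] ennreal_leI)
        qed simp
      qed
      also have "\<dots> = ennreal (CHK * \<beta>) * ennreal (1 / \<beta>)"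
        using nn_integral_exp_tail[OF \<beta>, of 0] by (subst nn_integral_cmult) simp_all
      also have "\<dots> = ennreal CHK" using \<beta> pos_consts by (subst ennreal_mult[symmetric]) auto
      finally show "(\<integral>\<^sup>+t. ?f3 t * ennreal (gaussian x y t) * indicator {0..} t \<partial>lborel) \<le> ennreal CHK" .
    qed simp
    also have "\<dots> = ennreal (speed \<omega> y * CHK)"
      using speed_ge_1[of \<omega> y] pos_consts by (intro ennreal_mult[symmetric]) auto
    finally show "occY A ?f3 y x \<le> ennreal (speed \<omega> y * CHK)" .
  qed
  also have "\<dots> = ennreal (resolvent (2 * \<beta>) A y x + speed \<omega> y * (H + 1 + CHK))"
    using speed_ge_1[of \<omega> y] pos_consts H by (simp add: ennreal_plus[symmetric] distrib_left add.assoc del: ennreal_plus)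
  finally show ?thesis
    using speed_ge_1[of \<omega> y] pos_consts H unfolding occ_eq_resolvent[OF \<beta>] by (subst (asm) ennreal_le_iff) auto
qed

text \<open>The left side is the probability that an independent exponential clock of rate
  \<open>1 / (4 * s)\<close> rings before the walk leaves \<open>A\<close>. Times before
  \<open>s\<close> contribute \<open>1 / 4\<close>; after \<open>s\<close> the kernel is at most
  \<open>CHK / s\<close>, so the volume bound \<open>M\<close> gives \<open>CHK * M / s\<close>,
  again at most \<open>1 / 4\<close>.\<close>

lemma sum_resolvent_le_half:
  assumes d: "CARD('d) = 2" and A: "finite A" "A \<subseteq> Cinf \<omega>" and x: "x \<in> A"
    and M: "(\<Sum>z\<in>A. speed \<omega> z) \<le> M"
    and s: "H \<le> s" "4 * CHK * M \<le> s" "\<And>z. z \<in> A \<Longrightarrow> c2 * real (gdist \<omega> x z) \<le> s"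
  shows "1 / (4 * s) * (\<Sum>z\<in>A. resolvent (1 / (4 * s)) A z x) \<le> 1 / 2"
proof -
  define \<alpha> where "\<alpha> = 1 / (4 * s)"
  have s0: "1 \<le> s" using s H by simp
  have \<alpha>: "0 < \<alpha>" using s0 by (simp add: \<alpha>_def)
  let ?f1 = "indicator {..<s} :: real \<Rightarrow> ennreal"
  let ?f2 = "\<lambda>t. indicator {s..} t * ennreal (exp (- \<alpha> * t))"
  have f1: "(\<Sum>z\<in>A. occY A ?f1 z x) \<le> ennreal s"
  proof -
    have "(\<Sum>z\<in>A. occY A ?f1 z x) \<le> (\<integral>\<^sup>+t. ?f1 t * indicator {0..} t \<partial>lborel)"
      by (rule Y.sum_occ_le) (use A in simp_all)
    also have "\<dots> = (\<integral>\<^sup>+t. indicator {0..<s} t \<partial>lborel)"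
      by (intro nn_integral_cong) (auto split: split_indicator)
    also have "\<dots> = ennreal s" using s0 by simp
    finally show ?thesis .
  qed
  have f2: "occY A ?f2 z x \<le> ennreal (speed \<omega> z * (CHK / s / \<alpha>))" if z: "z \<in> A" for z
  proof -
    have "occY A ?f2 z x \<le> ennreal (speed \<omega> z) * (\<integral>\<^sup>+t. ?f2 t * ennreal (gaussian x z t) * indicator {0..} t \<partial>lborel)"
    proof (rule occY_le_heat_kernel)
      fix t :: real assume "0 \<le> t" "?f2 t \<noteq> 0"
      then show "H \<le> t \<and> c2 * real (gdist \<omega> x z) \<le> t"
        using s(1) s(3)[OF z] by (auto split: split_indicator_asm)
    qed (use A x z in auto)
    also have "\<dots> \<le> ennreal (speed \<omega> z) * ennreal (CHK / s / \<alpha>)"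
    proof (rule mult_left_mono)
      have "(\<integral>\<^sup>+t. ?f2 t * ennreal (gaussian x z t) * indicator {0..} t \<partial>lborel)
        \<le> (\<integral>\<^sup>+t. ennreal (CHK / s) * (ennreal (exp (- \<alpha> * t)) * indicator {0..} t) \<partial>lborel)"
      proof (rule nn_integral_mono)
        fix t :: real
        show "?f2 t * ennreal (gaussian x z t) * indicator {0..} t
          \<le> ennreal (CHK / s) * (ennreal (exp (- \<alpha> * t)) * indicator {0..} t)"
        proof (cases "s \<le> t")
          case True
          then have t: "1 \<le> t" using s0 by simp
          have tp: "t powr (- real CARD('d) / 2) = 1 / t"
            using t d by (simp add: powr_minus_divide)
          have "CHK * (1 / t) * exp (- c1 * (real (gdist \<omega> x z))\<^sup>2 / t) \<le> CHK * (1 / s) * 1"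
            using t s0 True pos_consts by (intro mult_mono) (auto simp: frac_le)
          then have "exp (- \<alpha> * t) * (CHK * (1 / t) * exp (- c1 * (real (gdist \<omega> x z))\<^sup>2 / t)) \<le> exp (- \<alpha> * t) * (CHK / s)"
            by (intro mult_left_mono) auto
          then show ?thesis
            unfolding tp using True t s0 pos_consts
            by (simp only: indicator_simps atLeast_iff mult_1 mult_1_right order_trans[OF zero_le_one t])
               (simp add: ennreal_mult[symmetric] ennreal_leI mult.commute)
        qed simp
      qed
      also have "\<dots> = ennreal (CHK / s) * ennreal (1 / \<alpha>)"
        using nn_integral_exp_tail[OF \<alpha>, of 0] by (subst nn_integral_cmult) simp_all
      also have "\<dots> = ennreal (CHK / s / \<alpha>)" using \<alpha> s0 pos_consts by (subst ennreal_mult[symmetric]) auto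
      finally show "(\<integral>\<^sup>+t. ?f2 t * ennreal (gaussian x z t) * indicator {0..} t \<partial>lborel) \<le> ennreal (CHK / s / \<alpha>)" .
    qed simp
    also have "\<dots> = ennreal (speed \<omega> z * (CHK / s / \<alpha>))"
      using speed_ge_1[of \<omega> z] pos_consts s0 \<alpha> by (intro ennreal_mult[symmetric]) auto
    finally show ?thesis .
  qed
  have "ennreal (\<Sum>z\<in>A. resolvent \<alpha> A z x) = (\<Sum>z\<in>A. occY A (\<lambda>t. ennreal (exp (- \<alpha> * t))) z x)"
    by (simp only: occ_eq_resolvent[OF \<alpha>] sum_ennreal resolvent_nonneg)
  also have "\<dots> \<le> (\<Sum>z\<in>A. occY A ?f1 z x + occY A ?f2 z x)"
  proof (rule sum_mono)
    fix z
    have "occY A (\<lambda>t. ennreal (exp (- \<alpha> * t))) z x \<le> occY A (\<lambda>t. ?f1 t + ?f2 t) z x"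
    proof (rule Y.occ_mono)
      fix t :: real assume "0 \<le> t"
      then have "ennreal (exp (- \<alpha> * t)) \<le> 1" using \<alpha> by simp
      then show "ennreal (exp (- \<alpha> * t)) \<le> ?f1 t + ?f2 t"
        by (cases "t < s") (simp_all add: add_increasing2)
    qed simp
    then show "occY A (\<lambda>t. ennreal (exp (- \<alpha> * t))) z x \<le> occY A ?f1 z x + occY A ?f2 z x"
      by (simp add: Y.occ_add)
  qed
  also have "\<dots> \<le> ennreal s + (\<Sum>z\<in>A. ennreal (speed \<omega> z * (CHK / s / \<alpha>)))"
    unfolding sum.distrib by (intro add_mono f1 sum_mono f2)
  also have "(\<Sum>z\<in>A. ennreal (speed \<omega> z * (CHK / s / \<alpha>))) = ennreal (\<Sum>z\<in>A. speed \<omega> z * (CHK / s / \<alpha>))"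
    using pos_consts s0 \<alpha> speed_ge_1[of \<omega>] by (intro sum_ennreal mult_nonneg_nonneg) (auto intro: order_trans[OF zero_le_one])
  also have "(\<Sum>z\<in>A. speed \<omega> z * (CHK / s / \<alpha>)) = (\<Sum>z\<in>A. speed \<omega> z) * (CHK / s / \<alpha>)"
    by (simp only: sum_distrib_right)
  also have "ennreal s + ennreal \<dots> \<le> ennreal s + ennreal (M * (CHK / s / \<alpha>))"
    using M pos_consts s0 \<alpha> by (intro add_left_mono ennreal_leI mult_right_mono) auto
  also have "\<dots> = ennreal (s + M * (CHK / s / \<alpha>))"
  proof -
    have "0 \<le> (\<Sum>z\<in>A. speed \<omega> z)" using speed_ge_1[of \<omega>] by (intro sum_nonneg) (auto intro: order_trans[OF zero_le_one])
    then have "0 \<le> M" using M by simp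
    then show ?thesis using s0 pos_consts \<alpha> by (subst ennreal_plus) auto
  qed
  finally have "(\<Sum>z\<in>A. resolvent \<alpha> A z x) \<le> s + M * (CHK / s / \<alpha>)"
  proof (subst (asm) ennreal_le_iff)
    have "0 \<le> (\<Sum>z\<in>A. speed \<omega> z)" using speed_ge_1[of \<omega>] by (intro sum_nonneg) (auto intro: order_trans[OF zero_le_one])
    then have "0 \<le> M" using M by simp
    then show "0 \<le> s + M * (CHK / s / \<alpha>)" using s0 pos_consts \<alpha> by simp
  qed
  then have "\<alpha> * (\<Sum>z\<in>A. resolvent \<alpha> A z x) \<le> \<alpha> * (s + M * (CHK / s / \<alpha>))"
    using \<alpha> by (intro mult_left_mono) auto
  also have "\<dots> = 1 / 4 + CHK * M / s" using s0 by (simp add: \<alpha>_def distrib_left)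
  also have "\<dots> \<le> 1 / 2" using s(2) s0 by (simp add: divide_simps)
  finally show ?thesis by (simp add: \<alpha>_def)
qed

text \<open>The function \<open>w - h - S * \<phi>\<close> with \<open>w = R\<^sub>\<gamma> - R\<^sub>\<beta>\<close>, \<open>h = R\<^sub>\<beta> - R\<^sub>\<alpha>\<close>, \<open>S = max w\<close> and
  \<open>\<phi> = \<alpha> * R\<^sub>\<alpha> 1\<close> is a subsolution, whence \<open>S \<le> max h + S / 2\<close>.\<close>

lemma resolvent_small_parameter:
  assumes A: "finite A" and \<beta>: "0 < \<beta>" and \<gamma>: "0 < \<gamma>" and x: "x \<in> A"
    and half: "\<And>x. x \<in> A \<Longrightarrow> 2 * \<beta> * (\<Sum>z\<in>A. resolvent (2 * \<beta>) A z x) \<le> 1 / 2"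
    and h: "\<And>x. x \<in> A \<Longrightarrow> resolvent \<beta> A y x - resolvent (2 * \<beta>) A y x \<le> h0" and h0: "0 \<le> h0"
  shows "resolvent \<gamma> A y x \<le> resolvent \<beta> A y x + 2 * h0"
proof -
  define \<alpha> where "\<alpha> = 2 * \<beta>"
  have \<alpha>: "0 < \<alpha>" using \<beta> by (simp add: \<alpha>_def)
  define w where "w z = resolvent \<gamma> A y z - resolvent \<beta> A y z" for z
  define h where "h z = resolvent \<beta> A y z - resolvent \<alpha> A y z" for z
  define \<phi> where "\<phi> z = \<alpha> * (\<Sum>u\<in>A. resolvent \<alpha> A u z)" for z
  \<comment> \<open>Truncation at zero keeps the coefficient of \<open>\<phi>\<close> nonnegative
    even if \<open>w\<close> is negative throughout \<open>A\<close>.\<close>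
  define S where "S = max 0 (Max (w ` A))"
  have S0: "0 \<le> S" by (simp add: S_def)
  have wS: "w z \<le> S" if "z \<in> A" for z
    unfolding S_def using A that by (intro max.coboundedI2 Max_ge) auto
  define L where "L f z = (\<Sum>u | nbr z u. \<omega> {z, u} * (f u - f z))" for f :: "int ^ 'd \<Rightarrow> real" and z
  have L_diff: "L (\<lambda>z. f z - g z) z = L f z - L g z" for f g z
    unfolding L_def sum_subtractf[symmetric] by (intro sum.cong) (auto simp: algebra_simps)
  have L_cmult: "L (\<lambda>z. k * f z) z = k * L f z" for f k z
    unfolding L_def sum_distrib_left by (intro sum.cong) (auto simp: algebra_simps)
  have L_sum: "L (\<lambda>z. \<Sum>u\<in>A. f u z) z = (\<Sum>u\<in>A. L (f u) z)" for f z
    unfolding L_def by (subst sum.swap) (auto simp: sum_subtractf sum_distrib_left right_diff_distrib)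
  have R: "L (resolvent \<delta> A u) z = \<delta> * speed \<omega> z * resolvent \<delta> A u z - speed \<omega> z * indicator {u} z"
    if "0 < \<delta>" "z \<in> A" for \<delta> u z
    using resolvent_eq[OF that, of u] by (simp add: L_def)
  have sub: "w z - h z - S * \<phi> z \<le> 0" for z
  proof (rule maximum_principle[OF A \<alpha>, where v="\<lambda>z. w z - h z - S * \<phi> z"])
    show "w z - h z - S * \<phi> z \<le> 0" if "z \<notin> A" for z
      using that \<alpha> \<beta> \<gamma> by (simp add: w_def h_def \<phi>_def resolvent_outside)
    fix z assume z: "z \<in> A"
    have "L \<phi> z = \<alpha> * (\<Sum>u\<in>A. L (resolvent \<alpha> A u) z)"
      unfolding \<phi>_def L_cmult L_sum ..
    also have "(\<Sum>u\<in>A. L (resolvent \<alpha> A u) z) = (\<Sum>u\<in>A. \<alpha> * speed \<omega> z * resolvent \<alpha> A u z) - (\<Sum>u\<in>A. speed \<omega> z * indicator {u} z)"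
      unfolding R[OF \<alpha> z] by (rule sum_subtractf)
    also have "(\<Sum>u\<in>A. \<alpha> * speed \<omega> z * resolvent \<alpha> A u z) = speed \<omega> z * \<phi> z"
      unfolding \<phi>_def by (simp add: sum_distrib_left mult_ac)
    also have "(\<Sum>u\<in>A. speed \<omega> z * indicator {u} z) = speed \<omega> z"
    proof -
      have "(\<Sum>u\<in>A. speed \<omega> z * indicator {u} z) = (\<Sum>u\<in>A. if u = z then speed \<omega> z else 0)"
        by (intro sum.cong) auto
      then show ?thesis using A z by simp
    qed
    finally have L\<phi>: "L \<phi> z = \<alpha> * speed \<omega> z * \<phi> z - \<alpha> * speed \<omega> z" by (simp add: algebra_simps)
    have Lw: "L w z = \<gamma> * speed \<omega> z * resolvent \<gamma> A y z - \<beta> * speed \<omega> z * resolvent \<beta> A y z"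
      unfolding w_def L_diff R[OF \<gamma> z] R[OF \<beta> z] by simp
    have Lh: "L h z = \<beta> * speed \<omega> z * resolvent \<beta> A y z - \<alpha> * speed \<omega> z * resolvent \<alpha> A y z"
      unfolding h_def L_diff R[OF \<alpha> z] R[OF \<beta> z] by simp
    \<comment> \<open>The choice \<open>\<alpha> = 2 * \<beta>\<close> is made for this line:
      \<open>L w - L h\<close> contains
      \<open>- 2 * \<beta> * R_\<beta> + \<alpha> * R_\<alpha>\<close>, which is then exactly
      \<open>- \<alpha> * h\<close>, and all terms in \<open>h\<close> and \<open>\<phi>\<close>
      cancel.\<close>
    have "L (\<lambda>z. w z - h z - S * \<phi> z) z - \<alpha> * speed \<omega> z * (w z - h z - S * \<phi> z)
      = speed \<omega> z * (\<gamma> * resolvent \<gamma> A y z + \<alpha> * (S - w z))"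
    proof -
      have "L (\<lambda>z. w z - h z - S * \<phi> z) z = L w z - L h z - S * L \<phi> z"
        by (simp only: L_diff L_cmult)
      then show ?thesis unfolding Lw Lh L\<phi> by (simp add: w_def h_def \<alpha>_def algebra_simps)
    qed
    also have "\<dots> \<ge> 0"
      using wS[OF z] \<alpha> \<gamma> speed_ge_1[of \<omega> z] by (intro mult_nonneg_nonneg add_nonneg_nonneg) auto
    finally show "\<alpha> * speed \<omega> z * (w z - h z - S * \<phi> z)
      \<le> (\<Sum>u | nbr z u. \<omega> {z, u} * (w u - h u - S * \<phi> u - (w z - h z - S * \<phi> z)))"
      by (simp add: L_def)
  qed
  \<comment> \<open>Since \<open>\<phi>\<close> is at most one half on \<open>A\<close>, only half
    of \<open>S\<close> reappears on the right. As \<open>S\<close> is finite, it can be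
    absorbed.\<close>
  have w_le: "w z \<le> h0 + S / 2" if "z \<in> A" for z
  proof -
    have "S * \<phi> z \<le> S * (1 / 2)"
      unfolding \<phi>_def \<alpha>_def by (intro mult_left_mono half that S0)
    moreover have "h z \<le> h0"
      using h[OF that] by (simp add: h_def \<alpha>_def)
    ultimately show ?thesis using sub[of z] by simp
  qed
  have "Max (w ` A) \<le> h0 + S / 2" using w_le A x by (subst Max_le_iff) auto
  then have "S \<le> 2 * h0" using h0 S0 unfolding S_def by (simp add: max_def split: if_splits)
  then show ?thesis using wS[OF x] by (simp add: w_def)
qed

text \<open>The bound at discount \<open>\<beta>\<close> contains the logarithm; passing to a
  smaller discount \<open>\<gamma>\<close> adds only \<open>2 * h0\<close>, uniformly in
  \<open>\<gamma>\<close>. Letting \<open>\<gamma>\<close> tend to zero gives the undiscounted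
  occupation time.\<close>

lemma occY_planar:
  assumes d: "CARD('d) = 2" and A: "finite A" "A \<subseteq> Cinf \<omega>" and x: "x \<in> A" and y: "y \<in> A"
    and M: "(\<Sum>z\<in>A. speed \<omega> z) \<le> M"
    and s: "H \<le> s" "4 * CHK * M \<le> s" "\<And>z w. z \<in> A \<Longrightarrow> w \<in> A \<Longrightarrow> (max 1 c2 * real (gdist \<omega> z w))\<^sup>2 \<le> s"
    and r: "0 < r" "r\<^sup>2 \<le> 8 * s" "r \<le> max 1 (real (gdist \<omega> x y))"
  shows "occY A (\<lambda>_. 1) y x \<le> ennreal (speed \<omega> y *
    (H + planar_const CHK c1 c2 + CHK * ln (8 * s / r\<^sup>2) + 2 * (H + 1 + CHK)))"
proof -
  have s0: "1 \<le> s" using s H by simp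
  \<comment> \<open>Chosen so that \<open>2 * \<beta>\<close> is the parameter
    \<open>1 / (4 * s)\<close> of the exit estimate.\<close>
  define \<beta> where "\<beta> = 1 / (8 * s)"
  have \<beta>: "0 < \<beta>" "2 * \<beta> = 1 / (4 * s)" "1 / \<beta> = 8 * s" using s0 by (auto simp: \<beta>_def)
  define h0 where "h0 = speed \<omega> y * (H + 1 + CHK)"
  have h0: "0 \<le> h0" using H pos_consts speed_ge_1[of \<omega> y] by (simp add: h0_def)
  define K where "K = H + planar_const CHK c1 c2 + CHK * ln (8 * s / r\<^sup>2)"
  have "resolvent \<gamma> A y x \<le> speed \<omega> y * K + 2 * h0" if \<gamma>: "0 < \<gamma>" for \<gamma>
  proof -
    have "resolvent \<gamma> A y x \<le> resolvent \<beta> A y x + 2 * h0"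
    proof (rule resolvent_small_parameter[OF A(1) \<beta>(1) \<gamma> x _ _ h0])
      fix z assume z: "z \<in> A"
      show "2 * \<beta> * (\<Sum>u\<in>A. resolvent (2 * \<beta>) A u z) \<le> 1 / 2"
        unfolding \<beta>(2)
      proof (rule sum_resolvent_le_half[OF d A z M s(1,2)])
        fix u assume u: "u \<in> A"
        let ?g = "real (gdist \<omega> z u)"
        have "c2 * ?g \<le> max 1 c2 * ?g" by (intro mult_right_mono) auto
        also have "\<dots> \<le> s"
        \<comment> \<open>The hypothesis bounds the square by \<open>s\<close>; a number above one
          is at most its square, and \<open>s\<close> itself is at least one.\<close>
        proof (cases "max 1 c2 * ?g \<le> 1")
          case False
          then have "max 1 c2 * ?g * 1 \<le> max 1 c2 * ?g * (max 1 c2 * ?g)" by (intro mult_left_mono) auto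
          then show ?thesis using s(3)[OF z u] by (simp add: power2_eq_square)
        qed (use s0 in simp)
        finally show "c2 * ?g \<le> s" .
      qed
      have "(max 1 c2 * real (gdist \<omega> z y))\<^sup>2 \<le> 1 / \<beta>"
        using s(3)[OF z y] s0 unfolding \<beta>(3) by simp
      then have "resolvent \<beta> A y z \<le> resolvent (2 * \<beta>) A y z + h0"
        unfolding h0_def using z y A(2) \<beta>(1) by (intro resolvent_diff_le[OF d]) auto
      then show "resolvent \<beta> A y z - resolvent (2 * \<beta>) A y z \<le> h0" by simp
    qed
    moreover have "resolvent \<beta> A y x \<le> speed \<omega> y * K"
    proof -
      have "ennreal (resolvent \<beta> A y x) \<le> ennreal (speed \<omega> y * K)"
        unfolding occ_eq_resolvent[OF \<beta>(1), symmetric] K_def \<beta>(3)[symmetric]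
        using x y A(2) r by (intro occY_planar_resolvent d \<beta>) (auto simp: \<beta>(3))
      moreover have "0 \<le> speed \<omega> y * K"
      proof -
        have "0 \<le> ln (8 * s / r\<^sup>2)" using r by simp
        then show ?thesis
          using H pos_consts short_time_const_nonneg[of "max 1 c2" 0] speed_ge_1[of \<omega> y]
          by (simp add: K_def planar_const_def)
      qed
      ultimately show ?thesis by (subst (asm) ennreal_le_iff) auto
    qed
    ultimately show ?thesis by linarith
  qed
  then have "occY A (\<lambda>_. 1) y x \<le> ennreal (speed \<omega> y * K + 2 * h0)"
    unfolding Y.occ_one_eq_SUP by (intro SUP_least) (subst occ_eq_resolvent, auto intro!: ennreal_leI)
  also have "speed \<omega> y * K + 2 * h0 = speed \<omega> y * (K + 2 * (H + 1 + CHK))"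
    by (simp add: h0_def algebra_simps)
  finally show ?thesis by (simp only: K_def)
qed

end

section \<open>Green functions\<close>

context environment begin

text \<open>Edges leading out of the cluster have conductance zero, so every iterate of the jump
  operator applied to the indicator of the complement vanishes on the cluster.\<close>

lemma AE_walk_law_Cinf:
  assumes x: "x \<in> Cinf \<omega>"
  shows "AE s in walk_law (generatorY \<omega>) x. \<forall>k. fst s k \<in> Cinf \<omega>"
proof (subst AE_all_countable, rule allI)
  fix k
  define b :: "int ^ 'd \<Rightarrow> ennreal" where "b = indicator (- Cinf \<omega>)"
  define T where "T f z = 1 * (\<integral>\<^sup>+w. f w \<partial>jump_kernel (generatorY \<omega>) z)" for f and z :: "int ^ 'd"
  have zero: "(T ^^ k) b z = 0" if "z \<in> Cinf \<omega>" for k z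
    using that
  proof (induction k arbitrary: z)
    case (Suc k)
    have "ennreal (\<omega> {z, w} / mu \<omega> z) * (T ^^ k) b w = 0" if "nbr z w" for w
    proof (cases "0 < \<omega> {z, w}")
      case True
      then have "(z, w) \<in> open_edge \<omega>" using that by (simp add: open_edge_def)
      then have "w \<in> Cinf \<omega>" using Suc.prems Cinf_step by blast
      then show ?thesis using Suc.IH by simp
    next
      case False
      then have "\<omega> {z, w} = 0" using conductance_nonneg[OF that] by simp
      then show ?thesis by simp
    qed
    then have "(\<integral>\<^sup>+w. (T ^^ k) b w \<partial>jump_kernel (generatorY \<omega>) z) = 0"
      unfolding jump_kernel_generatorY nn_integral_jump_kernel_generator[OF mu_Cinf[OF Suc.prems]]
      by (intro sum.neutral) simp
    then have "T ((T ^^ k) b) z = 0" unfolding T_def[of "(T ^^ k) b"] by simp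
    then show ?case by simp
  qed (simp add: b_def)
  have "(\<integral>\<^sup>+s. b (fst s k) \<partial>walk_law (generatorY \<omega>) x) = (\<integral>\<^sup>+Z. \<integral>\<^sup>+E. b (fst (Z, E) k) \<partial>holding_law \<partial>chain_law (generatorY \<omega>) x)"
    by (rule Y.nn_integral_walk_law) measurable
  also have "\<dots> = (\<integral>\<^sup>+Z. b (Z k) \<partial>chain_law (generatorY \<omega>) x)"
    using prob_space.emeasure_space_1[OF prob_space_holding_law] by (intro nn_integral_cong) simp
  also have "\<dots> = (T ^^ k) b x"
    using Y.nn_integral_chain_law_prod[where a="\<lambda>_. 1" and b=b and k=k and x=x] unfolding T_def[abs_def] by simp
  also have "\<dots> = 0" by (rule zero[OF x])
  finally have "(\<integral>\<^sup>+s. b (fst s k) \<partial>walk_law (generatorY \<omega>) x) = 0" .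
  then have "AE s in walk_law (generatorY \<omega>) x. b (fst s k) = 0"
    by (subst (asm) nn_integral_0_iff_AE) measurable
  then show "AE s in walk_law (generatorY \<omega>) x. fst s k \<in> Cinf \<omega>"
    by (rule eventually_mono) (auto simp: b_def split: split_indicator_asm)
qed

text \<open>The Green function kills outside \<open>\<Lambda>\<close> only. Intersecting with the
  cluster changes no probability and confines sums over \<open>A\<close> to vertices to which the
  heat kernel and distance bounds apply.\<close>

lemma occ_restrict_Cinf:
  assumes x: "x \<in> Cinf \<omega>"
  shows "occ (generatorY \<omega>) A f y x = occ (generatorY \<omega>) (A \<inter> Cinf \<omega>) f y x"
  unfolding occ_def
proof (intro nn_integral_cong_AE eventually_mono[OF AE_walk_law_Cinf[OF x]])
  fix s :: "(nat \<Rightarrow> int ^ 'd) \<times> (nat \<Rightarrow> real)" assume "\<forall>k. fst s k \<in> Cinf \<omega>"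
  then have "path_in (A \<inter> Cinf \<omega>) y k (fst s) = path_in A y k (fst s)" for k
    by (auto simp: path_in_def)
  then show "(\<Sum>k. if path_in A y k (fst s)
      then \<integral>\<^sup>+t. f t * indicator {jump_time (generatorY \<omega>) s k..<jump_time (generatorY \<omega>) s (Suc k)} t \<partial>lborel else 0)
    = (\<Sum>k. if path_in (A \<inter> Cinf \<omega>) y k (fst s)
      then \<integral>\<^sup>+t. f t * indicator {jump_time (generatorY \<omega>) s k..<jump_time (generatorY \<omega>) s (Suc k)} t \<partial>lborel else 0)"
    by simp
qed

lemma green_le_ennreal:
  assumes xy: "x \<in> Cinf \<omega>" "y \<in> Cinf \<omega>"
    and occ: "occ (generatorY \<omega>) (emb -` \<Lambda> \<inter> Cinf \<omega>) (\<lambda>_. 1) y x \<le> ennreal (speed \<omega> y * B)" and B: "0 \<le> B"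
  shows "green \<omega> \<Lambda> x y \<le> ennreal B"
proof -
  have "green \<omega> \<Lambda> x y \<le> occ (generatorY \<omega>) (emb -` \<Lambda>) (\<lambda>_. 1) y x / ennreal (speed \<omega> y)"
    by (rule green_le_occ[OF mu_Cinf[OF xy(2)]])
  also have "\<dots> \<le> ennreal (speed \<omega> y * B) / ennreal (speed \<omega> y)"
    unfolding occ_restrict_Cinf[OF xy(1), of "emb -` \<Lambda>"] by (rule divide_right_mono_ennreal[OF occ])
  also have "\<dots> = ennreal B"
    using B speed_ge_1[of \<omega> y] by (subst divide_ennreal) auto
  finally show ?thesis .
qed

end

text \<open>Taking integer parts changes each coordinate difference by at most one, so the scaled
  distance is at most the lattice distance plus \<open>d\<close>. The form with \<open>max 1\<close>
  also covers distinct points with the same integer part.\<close>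

lemma norm_le_gdist:
  fixes x y :: "real ^ ('d::finite)"
  assumes \<omega>: "\<omega> \<in> Omega_star"
    and Cinf: "floor_vec (real n *\<^sub>R x) \<in> Cinf \<omega>" "floor_vec (real n *\<^sub>R y) \<in> Cinf \<omega>"
  shows "real n * norm (x - y) \<le> (1 + real CARD('d))
    * max 1 (real (gdist \<omega> (floor_vec (real n *\<^sub>R x)) (floor_vec (real n *\<^sub>R y))))"
proof -
  let ?a = "floor_vec (real n *\<^sub>R x)" and ?b = "floor_vec (real n *\<^sub>R y)"
  have "real n * norm (x - y) = norm (real n *\<^sub>R x - real n *\<^sub>R y)"
    by (simp add: scaleR_diff_right[symmetric])
  also have "\<dots> \<le> (\<Sum>i\<in>UNIV. \<bar>(real n *\<^sub>R x - real n *\<^sub>R y) $ i\<bar>)"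
    by (rule norm_le_l1_cart)
  also have "\<dots> \<le> (\<Sum>i\<in>UNIV. real_of_int \<bar>?a $ i - ?b $ i\<bar> + 1)"
  proof (rule sum_mono)
    fix i
    show "\<bar>(real n *\<^sub>R x - real n *\<^sub>R y) $ i\<bar> \<le> real_of_int \<bar>?a $ i - ?b $ i\<bar> + 1"
      using floor_correct[of "real n * x $ i"] floor_correct[of "real n * y $ i"]
      unfolding floor_vec_def vec_lambda_beta vector_minus_component vector_scaleR_component of_int_abs of_int_diff real_scaleR_def
      by linarith
  qed
  also have "\<dots> = real_of_int (\<Sum>i\<in>UNIV. \<bar>?a $ i - ?b $ i\<bar>) + real CARD('d)"
    by (simp add: sum.distrib)
  also have "\<dots> \<le> real (gdist \<omega> ?a ?b) + real CARD('d)"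
    using of_int_le_iff[where 'a=real, THEN iffD2, OF gdist_ge_l1[OF \<omega> Cinf]]
    by (simp only: of_int_of_nat_eq add_right_mono)
  also have "\<dots> \<le> max 1 (real (gdist \<omega> ?a ?b)) + real CARD('d) * max 1 (real (gdist \<omega> ?a ?b))"
    using mult_left_mono[of 1 "max 1 (real (gdist \<omega> ?a ?b))" "real CARD('d)"] by (intro add_mono) simp_all
  finally show ?thesis by (simp add: distrib_right)
qed

text \<open>As \<open>f \<ge> 1\<close> and \<open>p \<ge> 1\<close>, pointwise
  \<open>f \<le> f powr p\<close>. The maximum of two constants provides for
  \<open>p = \<infinity>\<close>, where \<open>real_of_ereal p\<close> is zero and the bound is
  \<open>b\<close> itself.\<close>

lemma sum_le_avg_norm:
  fixes f :: "'a \<Rightarrow> real"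
  assumes A: "finite A" "A \<noteq> {}" and p: "1 \<le> p" and f: "\<And>x. x \<in> A \<Longrightarrow> 1 \<le> f x"
    and avg: "avg_norm p f A \<le> b" and b: "0 < b"
  shows "sum f A \<le> max b (b powr real_of_ereal p) * real (card A)"
proof (cases "p = \<infinity>")
  case True
  have "f x \<le> b" if "x \<in> A" for x
  proof -
    have "\<bar>f x\<bar> \<le> Max ((\<lambda>x. \<bar>f x\<bar>) ` A)" using A that by (intro Max_ge) auto
    then show ?thesis using avg True by (simp add: avg_norm_def)
  qed
  then have "sum f A \<le> real (card A) * b" by (rule sum_bounded_above)
  also have "\<dots> \<le> max b (b powr real_of_ereal p) * real (card A)"
    by (subst mult.commute) (intro mult_right_mono, auto)
  finally show ?thesis .
next
  case False
  define r where "r = real_of_ereal p"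
  have r: "1 \<le> r" using p False by (cases p) (auto simp: r_def)
  define S where "S = (\<Sum>x\<in>A. \<bar>f x\<bar> powr r) / real (card A)"
  have S0: "0 \<le> S" by (simp add: S_def sum_nonneg)
  have c: "0 < real (card A)" using A by (simp add: card_gt_0_iff)
  have "S powr (1 / r) \<le> b" using avg False by (simp add: avg_norm_def S_def r_def)
  then have "(S powr (1 / r)) powr r \<le> b powr r" using r by (intro powr_mono2) auto
  then have S: "S \<le> b powr r" using r S0 by (simp add: powr_powr)
  have "sum f A \<le> (\<Sum>x\<in>A. \<bar>f x\<bar> powr r)"
  proof (rule sum_mono)
    fix x assume "x \<in> A"
    then have "f x powr 1 \<le> f x powr r" using f r by (intro powr_mono) auto
    then show "f x \<le> \<bar>f x\<bar> powr r" using f[OF \<open>x \<in> A\<close>] by simp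
  qed
  also have "\<dots> = S * real (card A)" using c by (simp add: S_def)
  also have "\<dots> \<le> max b (b powr r) * real (card A)" using S by (intro mult_right_mono) auto
  finally show ?thesis by (simp add: r_def)
qed

text \<open>The origin is a cluster point at distance zero, hence the unique closest one. With this,
  the averaging hypothesis at \<open>x = 0\<close> speaks of balls around the origin.\<close>

lemma nearest_0:
  fixes \<omega> :: "('d::finite) env"
  assumes "0 \<in> Cinf \<omega>" "linear_order_on UNIV ord"
  shows "nearest ord \<omega> n 0 = 0"
proof -
  have emb0: "emb (0 :: int ^ 'd) = 0" by (simp add: emb_def vec_eq_iff)
  have "z = 0" if "z \<in> closest_pts \<omega> (0 :: real ^ 'd)" for z
  proof -
    have "dist (emb z) 0 \<le> dist (emb (0 :: int ^ 'd)) (0 :: real ^ 'd)"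
      using that assms(1) by (auto simp: closest_pts_def)
    then have "emb z = 0" by (simp add: emb0)
    then show ?thesis by (simp add: emb_def vec_eq_iff)
  qed
  then have cp: "closest_pts \<omega> (0 :: real ^ 'd) = {0}"
    using assms(1) by (auto simp: closest_pts_def emb0)
  have "(0, 0) \<in> ord"
    using assms(2) by (auto simp: linear_order_on_def partial_order_on_def preorder_on_def refl_on_def)
  then show ?thesis unfolding nearest_def scaleR_zero_right cp by (intro the_equality) auto
qed

lemma gball_zero_subset:
  assumes "\<omega> \<in> Omega_star" "0 \<in> Cinf \<omega>"
  shows "gball \<omega> 0 (real n) \<subseteq> {z :: int ^ ('d::finite). \<forall>i. - int n \<le> z $ i \<and> z $ i \<le> int n}"
proof (intro subsetI CollectI allI)
  fix z :: "int ^ 'd" and i assume z: "z \<in> gball \<omega> 0 (real n)"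
  then have "int (gdist \<omega> 0 z) \<le> int n" "z \<in> Cinf \<omega>" by (auto simp: gball_def)
  moreover have "\<bar>z $ i\<bar> \<le> (\<Sum>i\<in>UNIV. \<bar>z $ i\<bar>)" by (rule member_le_sum) auto
  ultimately have "\<bar>z $ i\<bar> \<le> int n" using gdist_ge_l1[OF assms, of z] by simp
  then show "- int n \<le> z $ i \<and> z $ i \<le> int n" by linarith
qed

lemma infdist_lat_le:
  assumes "\<And>i. \<bar>x $ i - y $ i\<bar> \<le> k"
  shows "infdist_lat x y \<le> k"
  unfolding infdist_lat_def using assms by (subst Max_le_iff) auto

lemma N3_NHK_ereal:
  assumes "N1 \<omega> = ereal a" "N2 (max 1 R) \<omega> = ereal b"
  shows "N3 \<kappa> N1 N2 R \<omega> = ereal (max (max a b) (R powr \<kappa>))"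
    and "NHK \<kappa> N1 N2 R \<omega> = ereal (max (4 * (max (max a b) (R powr \<kappa>))\<^sup>2) 1)"
proof -
  show 1: "N3 \<kappa> N1 N2 R \<omega> = ereal (max (max a b) (R powr \<kappa>))"
    by (simp add: N3_def assms flip: ereal_max)
  show "NHK \<kappa> N1 N2 R \<omega> = ereal (max (4 * (max (max a b) (R powr \<kappa>))\<^sup>2) 1)"
  proof -
    have "max (4 * (ereal X)\<^sup>2) 1 = ereal (max (4 * X\<^sup>2) 1)" for X
      by (cases "4 * X\<^sup>2 \<le> 1") (auto simp: max_def)
    then show ?thesis unfolding NHK_def 1 .
  qed
qed

text \<open>The heat kernel bound does not depend on \<open>n\<close>, and every pair of vertices lies in the ball of radius
  \<open>R * n\<close> for large \<open>n\<close>.\<close>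

lemma percolation_envI:
  assumes \<omega>: "\<omega> \<in> Oreg \<inter> Omega_star0 \<inter> Oc R" and R: "1 \<le> R"
    and hk: "heat_kernel_bound Oreg Oc N1 N2 \<kappa> CHK c1 c2 c3 c4"
    and pos: "0 < CHK" "0 < c1" "0 < c2"
    and N3: "N3 \<kappa> N1 N2 R \<omega> = ereal v" and NHK: "NHK \<kappa> N1 N2 R \<omega> = ereal H" and H: "1 \<le> H"
  shows "percolation_env \<omega> H CHK c1 c2"
proof
  fix x y t assume xy: "x \<in> Cinf \<omega>" "y \<in> Cinf \<omega>" and t: "H \<le> t" "c2 * real (gdist \<omega> x y) \<le> t"
  \<comment> \<open>Large enough for the hypothesis at scale \<open>n\<close> and for both points to
    lie in the ball; the time threshold does not change with \<open>n\<close>.\<close>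
  define n where "n = nat \<lceil>v\<rceil> + gdist \<omega> 0 x + gdist \<omega> 0 y"
  have n: "N3 \<kappa> N1 N2 R \<omega> \<le> ereal (real n)" unfolding N3 n_def by simp linarith
  have ball: "z \<in> gball \<omega> 0 (R * real n)" if "z \<in> Cinf \<omega>" "gdist \<omega> 0 z \<le> n" for z
  proof -
    have "real (gdist \<omega> 0 z) \<le> 1 * real n" using that by simp
    also have "\<dots> \<le> R * real n" using R by (intro mult_right_mono) auto
    finally show ?thesis using that by (simp add: gball_def le_floor_iff)
  qed
  have "NHK \<kappa> N1 N2 R \<omega> \<le> ereal t"
    using t NHK by auto
  moreover have "gdist \<omega> 0 x \<le> n" "gdist \<omega> 0 y \<le> n" by (simp_all add: n_def)
  ultimately show "heat_kernel \<omega> t x y \<le> CHK * t powr (- real CARD('a) / 2) * exp (- c1 * (real (gdist \<omega> x y))\<^sup>2 / t)"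
    using hk[unfolded heat_kernel_bound_def, rule_format, OF R \<omega> n ball[OF xy(1)] ball[OF xy(2)], THEN conjunct1] t(2)
    by simp
qed (use \<omega> H pos in auto)

lemma ereal_green_le:
  assumes "g \<le> ennreal X" "0 \<le> X" "0 \<le> k" "k * X \<le> Y"
  shows "ereal k * enn2ereal g \<le> ereal Y"
proof -
  have "enn2ereal g \<le> enn2ereal (ennreal X)" using assms(1) by (simp only: less_eq_ennreal.rep_eq)
  then have "enn2ereal g \<le> ereal X" using assms(2) by (simp)
  then have "ereal k * enn2ereal g \<le> ereal k * ereal X" using assms(3) by (intro ereal_mult_left_mono) auto
  also have "\<dots> \<le> ereal Y" using assms(4) by simp
  finally show ?thesis .
qed

text \<open>The powers of \<open>4\<close> and of \<open>1 + d\<close> come from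
  \<open>H \<le> 4 * H0\<close> and from comparing Euclidean with graph distance. Leaving
  \<open>\<Lambda>\<close> arbitrary treats the killed and the full Green function together.\<close>

lemma green_transient:
  fixes x y :: "real ^ ('d::finite)"
  assumes env: "percolation_env \<omega> H CHK c1 c2" and d: "3 \<le> CARD('d)"
    and H0: "1 \<le> H0" "H \<le> 4 * H0"
  defines "C \<equiv> transient_const CARD('d) CHK c1 c2 * 4 ^ (CARD('d) - 1) * (1 + real CARD('d)) ^ (CARD('d) - 2)"
  shows "ereal (real n ^ (CARD('d) - 2)) * enn2ereal (green \<omega> \<Lambda> (floor_vec (real n *\<^sub>R x)) (floor_vec (real n *\<^sub>R y)))
    \<le> ereal C * ereal H0 ^ (CARD('d) - 1) / ereal (norm (x - y) ^ (CARD('d) - 2))"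
proof -
  interpret percolation_env \<omega> H CHK c1 c2 by fact
  let ?a = "floor_vec (real n *\<^sub>R x)" and ?b = "floor_vec (real n *\<^sub>R y)"
  define k where "k = CARD('d) - 2"
  have k: "0 < k" "CARD('d) - 1 = Suc k" using d by (auto simp: k_def)
  define K where "K = transient_const CARD('d) CHK c1 c2"
  have K: "0 < K"
    using short_time_const_nonneg[of "max 1 c2" "CARD('d) - 2"] pos_consts
    by (simp add: K_def transient_const_def add_nonneg_pos add_pos_nonneg)
  have C: "0 < C" using K by (simp add: C_def K_def[symmetric])
  have C_eq: "C = K * 4 ^ Suc k * (1 + real CARD('d)) ^ k" unfolding C_def K_def k(2) k_def[symmetric] ..
  show ?thesis
  proof (cases "x = y")
    case True
    \<comment> \<open>For coinciding points the right side is a positive number divided by zero,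
      which is infinite in \<open>ereal\<close>.\<close>
    have "0 < C * H0 ^ Suc k" using C H0 by simp
    then show ?thesis unfolding k(2) k_def[symmetric] using True k(1) C H0 by (simp add: zero_power)
  next
    case False
    then have nrm: "0 < norm (x - y)" by simp
    define M where "M = max 1 (real (gdist \<omega> ?a ?b))"
    define X where "X = (if ?a \<in> Cinf \<omega> \<and> ?b \<in> Cinf \<omega> then K * H ^ Suc k / M ^ k else 0)"
    have M: "1 \<le> M" by (simp add: M_def)
    have X0: "0 \<le> X" using K H M by (simp add: X_def)
    have g: "green \<omega> \<Lambda> ?a ?b \<le> ennreal X"
    proof (cases "?a \<in> Cinf \<omega> \<and> ?b \<in> Cinf \<omega>")
      case True
      then show ?thesis
        using occY_transient[of ?a ?b "emb -` \<Lambda> \<inter> Cinf \<omega>", OF _ _ d, unfolded k(2), folded k_def K_def M_def] X0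
        by (intro green_le_ennreal) (simp_all only: X_def if_True simp_thms)
    next
      case False
      then show ?thesis by (auto simp: green_def)
    qed
    have "real n ^ k * X \<le> C * H0 ^ Suc k / norm (x - y) ^ k"
    proof (cases "?a \<in> Cinf \<omega> \<and> ?b \<in> Cinf \<omega>")
      case True
      have "(real n * norm (x - y)) ^ k \<le> ((1 + real CARD('d)) * M) ^ k"
        using norm_le_gdist[OF omega_star, of n x y] True by (intro power_mono) (auto simp: M_def)
      then have "real n ^ k / M ^ k \<le> (1 + real CARD('d)) ^ k / norm (x - y) ^ k"
        using nrm M by (simp add: power_mult_distrib divide_simps mult_ac)
      moreover have "K * H ^ Suc k \<le> K * (4 * H0) ^ Suc k"
        using K H H0 by (intro mult_left_mono power_mono) auto
      ultimately have "K * H ^ Suc k * (real n ^ k / M ^ k) \<le> K * (4 * H0) ^ Suc k * ((1 + real CARD('d)) ^ k / norm (x - y) ^ k)"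
        using K H H0 M nrm by (intro mult_mono) auto
      then show ?thesis using True unfolding X_def C_eq power_mult_distrib by (simp add: mult_ac)
    next
      case False
      then show ?thesis using C H0 nrm by (auto simp: X_def)
    qed
    then have "ereal (real n ^ k) * enn2ereal (green \<omega> \<Lambda> ?a ?b) \<le> ereal (C * H0 ^ Suc k / norm (x - y) ^ k)"
      by (intro ereal_green_le[OF g X0]) auto
    then show ?thesis unfolding k(2) k_def[symmetric] using nrm by simp
  qed
qed

section \<open>Dimension two at scale \<open>n\<close>: the domain, its distances and its
  volume\<close>

lemma dilate_D:
  assumes "dilate n D \<subseteq> cube (r * real n)" "1 \<le> n" "x \<in> D"
  shows "\<bar>x $ i\<bar> \<le> r"
proof -
  have "real n *\<^sub>R x \<in> dilate n D" using assms(2,3) by (simp add: dilate_def)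
  then have "real n *\<^sub>R x \<in> cube (r * real n)" using assms(1) by blast
  then have "- (r * real n) \<le> real n * x $ i \<and> real n * x $ i \<le> r * real n"
    by (simp add: cube_def)
  then have "(- r) * real n \<le> x $ i * real n" "x $ i * real n \<le> r * real n" by (simp_all add: mult.commute)
  moreover have "0 < real n" using assms(2) by simp
  ultimately have "- r \<le> x $ i" "x $ i \<le> r"
    by (blast intro: mult_right_le_imp_le)+
  then show ?thesis by (simp add: abs_le_iff)
qed

text \<open>The summands, multiplied by \<open>n^2\<close>, serve the requirements on the time
  \<open>s\<close>: to exceed \<open>H\<close>, to make leaving the domain likely, to exceed all
  squared distances, and to dominate the squared cutoff radius.\<close>

definition planar_scale :: "real \<Rightarrow> real \<Rightarrow> real \<Rightarrow> real \<Rightarrow> real \<Rightarrow> real" where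
  "planar_scale CHK c2 M0 G r = 4 + 4 * CHK * M0 + (max 1 c2 * G)\<^sup>2 + r\<^sup>2"

text \<open>\<open>12\<close> is three occurrences of \<open>H\<close> times the factor in
  \<open>H \<le> 4 * H0\<close>. \<open>72\<close> is \<open>8\<close> from \<open>8 * s\<close>
  times \<open>9\<close> from the squared cutoff radius.\<close>

definition planar_green_const :: "real \<Rightarrow> real \<Rightarrow> real \<Rightarrow> real \<Rightarrow> real \<Rightarrow> real \<Rightarrow> real" where
  "planar_green_const CHK c1 c2 M0 G r =
    12 + planar_const CHK c1 c2 + 2 + 2 * CHK + CHK * ln (72 * planar_scale CHK c2 M0 G r)"

lemma green_planar:
  fixes x y :: "real ^ ('d::finite)"
  assumes env: "percolation_env \<omega> H CHK c1 c2" and d: "CARD('d) = 2"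
    and H0: "1 \<le> H0" "H \<le> 4 * H0" and Hn: "H \<le> 4 * (real n)\<^sup>2" and n: "1 \<le> n"
    and r: "0 < r" and D: "dilate n D \<subseteq> cube (r * real n)" and x: "x \<in> D" and y: "y \<in> D" and xy: "x \<noteq> y"
    and M0: "0 \<le> M0" "(\<Sum>z | z \<in> Cinf \<omega> \<and> emb z \<in> dilate n D. speed \<omega> z) \<le> M0 * (real n)\<^sup>2"
    and G: "\<And>z w. z \<in> Cinf \<omega> \<Longrightarrow> w \<in> Cinf \<omega> \<Longrightarrow> emb z \<in> cube (r * real n) \<Longrightarrow> emb w \<in> cube (r * real n) \<Longrightarrow>
      real (gdist \<omega> z w) \<le> G * real n"
  shows "ereal (real n ^ (CARD('d) - 2)) *
      enn2ereal (green \<omega> (dilate n D) (floor_vec (real n *\<^sub>R x)) (floor_vec (real n *\<^sub>R y)))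
    \<le> ereal (2 * CHK * ln (1 / norm (x - y))) + ereal (planar_green_const CHK c1 c2 M0 G r) * ereal H0"
proof -
  interpret percolation_env \<omega> H CHK c1 c2 by fact
  let ?a = "floor_vec (real n *\<^sub>R x)" and ?b = "floor_vec (real n *\<^sub>R y)"
  define A where "A = {z. z \<in> Cinf \<omega> \<and> emb z \<in> dilate n D}"
  define K where "K = planar_scale CHK c2 M0 G r"
  define s where "s = K * (real n)\<^sup>2"
  \<comment> \<open>The divisor is \<open>1 + d\<close> with \<open>d = 2\<close>, so that
    \<open>norm_le_gdist\<close> makes \<open>\<rho>\<close> an admissible cutoff radius.\<close>
  define \<rho> where "\<rho> = real n * norm (x - y) / 3"
  define X where "X = H + planar_const CHK c1 c2 + CHK * ln (8 * s / \<rho>\<^sup>2) + 2 * (H + 1 + CHK)"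
  have CHKM: "0 \<le> CHK * M0" using pos_consts M0 by simp
  have K: "4 \<le> K" "4 * CHK * M0 \<le> K" "(max 1 c2 * G)\<^sup>2 \<le> K" "r\<^sup>2 \<le> K"
    using CHKM by (simp_all add: K_def planar_scale_def)
  have n2: "0 < (real n)\<^sup>2" using n by simp
  have nrm: "0 < norm (x - y)" using xy by simp
  have \<rho>: "0 < \<rho>" using n nrm by (simp add: \<rho>_def)
  have "norm (x - y) \<le> (\<Sum>i\<in>UNIV. \<bar>(x - y) $ i\<bar>)" by (rule norm_le_l1_cart)
  also have "\<dots> \<le> (\<Sum>i\<in>(UNIV :: 'd set). 2 * r)"
  proof (rule sum_mono)
    fix i
    show "\<bar>(x - y) $ i\<bar> \<le> 2 * r"
      using dilate_D[OF D n x, of i] dilate_D[OF D n y, of i] by simp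
  qed
  also have "\<dots> = 4 * r" using d by simp
  finally have "norm (x - y) \<le> 4 * r" .
  then have "real n * norm (x - y) \<le> real n * (6 * r)"
    using r by (intro mult_left_mono) auto
  then have "\<rho> \<le> 2 * real n * r" by (simp add: \<rho>_def)
  then have "\<rho>\<^sup>2 \<le> (2 * real n * r)\<^sup>2" using \<rho> by (intro power_mono) auto
  also have "\<dots> = 4 * r\<^sup>2 * (real n)\<^sup>2" by (simp add: power_mult_distrib)
  also have "\<dots> \<le> 8 * K * (real n)\<^sup>2" using K(1,4) by (intro mult_right_mono) auto
  \<comment> \<open>Points of \<open>D\<close> may be more than one apart, so
    \<open>ln (1 / norm (x - y))\<close> can be negative; this inequality keeps the full logarithm,
    and with it \<open>X\<close>, nonnegative.\<close>
  finally have \<rho>s: "\<rho>\<^sup>2 \<le> 8 * s" by (simp add: s_def)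
  have planar0: "0 \<le> planar_const CHK c1 c2"
    using short_time_const_nonneg[of "max 1 c2" 0] pos_consts by (simp add: planar_const_def)
  have "1 \<le> 8 * s / \<rho>\<^sup>2" using \<rho> \<rho>s by (simp add: pos_le_divide_eq)
  then have "0 \<le> ln (8 * s / \<rho>\<^sup>2)" by simp
  then have X0: "0 \<le> X" using planar0 pos_consts H by (simp add: X_def)
  have g: "green \<omega> (dilate n D) ?a ?b \<le> ennreal X"
  proof (cases "?a \<in> A \<and> ?b \<in> A")
    case False
    then show ?thesis by (auto simp: green_def A_def)
  next
    case True
    have emb_cube: "emb z \<in> cube (r * real n)" if "z \<in> A" for z
      using that D by (auto simp: A_def)
    have finA: "finite A"
    proof (rule finite_subset)
      show "A \<subseteq> {z. \<forall>i. - \<lceil>r * real n\<rceil> \<le> z $ i \<and> z $ i \<le> \<lceil>r * real n\<rceil>}"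
      proof (intro subsetI CollectI allI)
        fix z i assume "z \<in> A"
        then have "- (r * real n) \<le> real_of_int (z $ i) \<and> real_of_int (z $ i) \<le> r * real n"
          using emb_cube[of z] by (simp add: cube_def emb_def)
        then show "- \<lceil>r * real n\<rceil> \<le> z $ i \<and> z $ i \<le> \<lceil>r * real n\<rceil>" by linarith
      qed
    qed (rule finite_int_box)
    have "occY A (\<lambda>_. 1) ?b ?a \<le> ennreal (speed \<omega> ?b * X)"
      unfolding X_def
    proof (rule occY_planar[OF d finA])
      show "(\<Sum>z\<in>A. speed \<omega> z) \<le> M0 * (real n)\<^sup>2" using M0(2) by (simp add: A_def)
      show "H \<le> s" using Hn mult_right_mono[OF K(1), of "(real n)\<^sup>2"] by (simp add: s_def)
      show "4 * CHK * (M0 * (real n)\<^sup>2) \<le> s" using mult_right_mono[OF K(2), of "(real n)\<^sup>2"] by (simp add: s_def mult.assoc)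
      show "\<rho> \<le> max 1 (real (gdist \<omega> ?a ?b))"
        using norm_le_gdist[OF omega_star, of n x y] True d by (simp add: A_def \<rho>_def)
      fix z w assume zw: "z \<in> A" "w \<in> A"
      have "real (gdist \<omega> z w) \<le> G * real n"
        using zw emb_cube by (intro G) (auto simp: A_def)
      then have "(max 1 c2 * real (gdist \<omega> z w))\<^sup>2 \<le> (max 1 c2 * (G * real n))\<^sup>2"
        by (intro power_mono mult_left_mono) auto
      also have "\<dots> = (max 1 c2 * G)\<^sup>2 * (real n)\<^sup>2" by (simp add: power_mult_distrib)
      also have "\<dots> \<le> s" unfolding s_def by (intro mult_right_mono K) simp
      finally show "(max 1 c2 * real (gdist \<omega> z w))\<^sup>2 \<le> s" .
    qed (use True \<rho> \<rho>s in \<open>auto simp: A_def\<close>)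
    moreover have "A = emb -` dilate n D \<inter> Cinf \<omega>" by (auto simp: A_def)
    ultimately show ?thesis
      using True X0 by (intro green_le_ennreal) (auto simp: A_def)
  qed
  \<comment> \<open>Both \<open>s\<close> and the squared radius scale as \<open>n^2\<close>, which
    cancels. The square of the distance is what doubles the factor \<open>CHK\<close> of the
    logarithm.\<close>
  have "8 * s / \<rho>\<^sup>2 = 72 * K * (1 / norm (x - y))\<^sup>2"
    using n nrm by (simp add: s_def \<rho>_def power_divide power_mult_distrib)
  also have "ln \<dots> = ln (72 * K) + 2 * ln (1 / norm (x - y))"
    using K(1) nrm by (subst ln_mult_pos) (simp_all add: ln_realpow)
  finally have ln_eq: "ln (8 * s / \<rho>\<^sup>2) = ln (72 * K) + 2 * ln (1 / norm (x - y))" .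
  have lnK: "0 \<le> ln (72 * K)" using K(1) by simp
  define c where "c = planar_const CHK c1 c2 + 2 + 2 * CHK + CHK * ln (72 * K)"
  have c: "0 \<le> c" using planar0 pos_consts lnK by (simp add: c_def)
  have "X = 2 * CHK * ln (1 / norm (x - y)) + (3 * H + c)"
    by (simp only: X_def ln_eq c_def) (simp add: algebra_simps)
  also have "3 * H + c \<le> 12 * H0 + c * H0"
    using H0 mult_left_mono[OF H0(1) c] by simp
  also have "12 * H0 + c * H0 = planar_green_const CHK c1 c2 M0 G r * H0"
    by (simp only: planar_green_const_def K_def[symmetric] c_def) (simp add: algebra_simps)
  finally have "X \<le> 2 * CHK * ln (1 / norm (x - y)) + planar_green_const CHK c1 c2 M0 G r * H0" by simp
  then have "ereal (real n ^ (CARD('d) - 2)) * enn2ereal (green \<omega> (dilate n D) ?a ?b)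
    \<le> ereal (2 * CHK * ln (1 / norm (x - y)) + planar_green_const CHK c1 c2 M0 G r * H0)"
    using d by (intro ereal_green_le[OF g X0]) simp_all
  then show ?thesis by simp
qed

text \<open>The distance comparison is used at scale \<open>m = k * n\<close>, with \<open>k\<close>
  so large that the cube of half-side \<open>r * n\<close> fits into \<open>[-m, m]^d\<close>. There
  the alternative \<open>m powr (1 - \<delta>)\<close> is at most \<open>m\<close>, so both
  alternatives are linear in \<open>n\<close>.\<close>

lemma gdist_cluster_le:
  fixes z w :: "int ^ ('d::finite)"
  assumes cl: "cluster_assm P \<theta> \<delta> Cd CV Criso CW Oreg N1" and \<omega>: "\<omega> \<in> Oreg \<inter> Omega_star0"
    and n: "1 \<le> n" "N1 \<omega> \<le> ereal (real n)" and \<delta>: "0 < \<delta>" and Cd: "1 \<le> Cd" and r: "0 < r"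
    and z: "z \<in> Cinf \<omega>" "emb z \<in> cube (r * real n)" and w: "w \<in> Cinf \<omega>" "emb w \<in> cube (r * real n)"
  shows "real (gdist \<omega> z w) \<le> real (nat \<lceil>2 * Cd * r\<rceil> + nat \<lceil>max 1 r\<rceil>) * real n"
proof -
  define k where "k = nat \<lceil>max 1 r\<rceil>"
  define m where "m = k * n"
  have k: "1 \<le> real k" "r \<le> real k" unfolding k_def by linarith+
  have nm: "real n \<le> real m" using mult_right_mono[OF k(1), of "real n"] by (simp add: m_def)
  have m: "1 \<le> real m" "N1 \<omega> \<le> ereal (real m)" "r * real n \<le> real m"
  proof -
    show "1 \<le> real m" using n(1) nm by simp
    show "N1 \<omega> \<le> ereal (real m)" using n(2) by (rule order_trans) (use nm in simp)
    show "r * real n \<le> real m" using mult_right_mono[OF k(2), of "real n"] by (simp add: m_def)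
  qed
  have cube: "emb u \<in> cube (real m)" if "emb u \<in> cube (r * real n)" for u :: "int ^ 'd"
    using that m(3) unfolding cube_def by (auto intro: order_trans[of _ "- (r * real n)"] order_trans[of _ "r * real n"])
  have "real (gdist \<omega> z w) \<le> max (Cd * real_of_int (infdist_lat z w)) (real m powr (1 - \<delta>))"
    using cl \<omega> m(2) z w cube unfolding cluster_assm_def by blast
  also have "\<dots> \<le> real (nat \<lceil>2 * Cd * r\<rceil> + k) * real n"
  proof (rule max.boundedI)
    have "infdist_lat z w \<le> \<lfloor>2 * (r * real n)\<rfloor>"
    proof (rule infdist_lat_le)
      fix i
      have "\<bar>real_of_int (z $ i)\<bar> \<le> r * real n" "\<bar>real_of_int (w $ i)\<bar> \<le> r * real n"
        using z(2) w(2) by (auto simp: cube_def emb_def abs_le_iff minus_le_iff)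
      then show "\<bar>z $ i - w $ i\<bar> \<le> \<lfloor>2 * (r * real n)\<rfloor>" by linarith
    qed
    then have "Cd * real_of_int (infdist_lat z w) \<le> Cd * (2 * (r * real n))"
      using Cd by (intro mult_left_mono) linarith+
    also have "\<dots> = 2 * Cd * r * real n" by simp
    also have "\<dots> \<le> real (nat \<lceil>2 * Cd * r\<rceil> + k) * real n"
    proof (rule mult_right_mono)
      have "2 * Cd * r \<le> real (nat \<lceil>2 * Cd * r\<rceil>)" by linarith
      then show "2 * Cd * r \<le> real (nat \<lceil>2 * Cd * r\<rceil> + k)" by simp
    qed simp
    finally show "Cd * real_of_int (infdist_lat z w) \<le> real (nat \<lceil>2 * Cd * r\<rceil> + k) * real n" .
    have "real m powr (1 - \<delta>) \<le> real m powr 1" using m(1) \<delta> by (intro powr_mono) auto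
    also have "\<dots> = real k * real n" using m(1) by (simp add: m_def)
    also have "\<dots> \<le> real (nat \<lceil>2 * Cd * r\<rceil> + k) * real n" by (intro mult_right_mono) auto
    finally show "real m powr (1 - \<delta>) \<le> real (nat \<lceil>2 * Cd * r\<rceil> + k) * real n" .
  qed
  finally show ?thesis by (simp add: k_def)
qed

text \<open>By \<open>gd\<close> the domain lies in the graph ball of radius \<open>k * n\<close>
  about the origin. The averaged moment bound there, times the cardinality of the ball, which is at
  most \<open>(2 * m + 1)^2 \<le> 9 * m^2\<close>, controls the total speed.\<close>

lemma sum_speed_le:
  fixes D :: "(real ^ ('d::finite)) set" and ord :: "((int ^ 'd) \<times> (int ^ 'd)) set"
  assumes d: "CARD('d) = 2" and av: "averages_bounded P p q ord Oreg Oc mubar nubar N2"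
    and \<omega>: "\<omega> \<in> Oreg \<inter> Omega_star0 \<inter> Oc R" and R: "1 \<le> R" and ord: "linear_order_on UNIV ord"
    and n: "1 \<le> n" "N2 R \<omega> \<le> ereal (real n)" and p: "1 \<le> p" and b: "0 < mubar R"
    and k: "1 \<le> k" and gd: "\<And>z. z \<in> Cinf \<omega> \<Longrightarrow> emb z \<in> dilate n D \<Longrightarrow> gdist \<omega> 0 z \<le> k * n"
  shows "(\<Sum>z | z \<in> Cinf \<omega> \<and> emb z \<in> dilate n D. speed \<omega> z)
    \<le> max (mubar R) (mubar R powr real_of_ereal p) * (9 * (real k)\<^sup>2) * (real n)\<^sup>2"
proof -
  have star: "\<omega> \<in> Omega_star" "0 \<in> Cinf \<omega>" using \<omega> by (auto simp: Omega_star0_def)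
  define m where "m = k * n"
  let ?B = "gball \<omega> (0 :: int ^ 'd) (real m)"
  let ?c = "max (mubar R) (mubar R powr real_of_ereal p)"
  have nm: "real n \<le> real m" using mult_right_mono[of 1 "real k" "real n"] k by (simp add: m_def)
  have N2: "N2 R \<omega> \<le> ereal (real m)" using n(2) nm by (auto elim: order_trans)
  have finB: "finite ?B" by (rule finite_subset[OF gball_zero_subset[OF star] finite_int_box(1)])
  have "(0 :: real ^ 'd) \<in> cube R" using R by (simp add: cube_def)
  then have "avg_norm p (\<lambda>z. max 1 (mu \<omega> z)) (gball \<omega> (nearest ord \<omega> m 0) (real m)) \<le> mubar R"
    using av \<omega> R N2 unfolding averages_bounded_def by blast
  then have avg: "avg_norm p (speed \<omega>) ?B \<le> mubar R"
    unfolding nearest_0[OF star(2) ord] speed_def[abs_def] .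
  have "0 \<in> ?B" using star by (simp add: gball_def)
  then have "sum (speed \<omega>) ?B \<le> ?c * real (card ?B)"
    using finB p avg b speed_ge_1 by (intro sum_le_avg_norm) auto
  also have "\<dots> \<le> ?c * (9 * (real k)\<^sup>2 * (real n)\<^sup>2)"
  proof (rule mult_left_mono)
    have "card ?B \<le> card {z :: int ^ 'd. \<forall>i. - int m \<le> z $ i \<and> z $ i \<le> int m}"
      by (rule card_mono[OF finite_int_box(1) gball_zero_subset[OF star]])
    also have "\<dots> \<le> (\<Prod>i\<in>(UNIV :: 'd set). nat (int m - - int m + 1))" by (rule finite_int_box(2))
    also have "\<dots> = (2 * m + 1)\<^sup>2" using d by (simp add: nat_add_distrib nat_mult_distrib flip: mult_2)
    finally have "real (card ?B) \<le> real ((2 * m + 1)\<^sup>2)" by (rule of_nat_mono)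
    also have "\<dots> \<le> real ((3 * m)\<^sup>2)"
      using k n by (intro of_nat_mono power_mono) (simp_all add: m_def Suc_le_eq)
    also have "\<dots> = 9 * (real k)\<^sup>2 * (real n)\<^sup>2" by (simp add: m_def power_mult_distrib)
    finally show "real (card ?B) \<le> 9 * (real k)\<^sup>2 * (real n)\<^sup>2" .
  qed (use b in simp)
  finally have "sum (speed \<omega>) ?B \<le> ?c * (9 * (real k)\<^sup>2) * (real n)\<^sup>2" by (simp add: mult.assoc)
  moreover have "(\<Sum>z | z \<in> Cinf \<omega> \<and> emb z \<in> dilate n D. speed \<omega> z) \<le> sum (speed \<omega>) ?B"
  proof (rule sum_mono2[OF finB])
    show "{z. z \<in> Cinf \<omega> \<and> emb z \<in> dilate n D} \<subseteq> ?B"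
      using gd by (auto simp: gball_def m_def simp flip: of_nat_mult)
  qed (use speed_ge_1[of \<omega>] in \<open>auto intro: order_trans[OF zero_le_one]\<close>)
  ultimately show ?thesis by linarith
qed

text \<open>Intersects the events of full probability and conditions on the origin lying in the
  cluster, which reduces the almost sure claim to one fixed environment.\<close>

lemma AE_good_environment:
  assumes law: "law_assm P" and O: "Oreg \<in> sets P" "measure P Oreg = 1" "Oc \<in> sets P" "measure P Oc = 1"
    and Q: "\<And>\<omega>. \<omega> \<in> space P \<Longrightarrow> \<omega> \<in> Oreg \<inter> Omega_star0 \<inter> Oc \<Longrightarrow> Q \<omega>"
  shows "AE \<omega> in uniform_measure P {\<omega> \<in> space P. 0 \<in> Cinf \<omega>}. Q \<omega>"
proof (rule AE_uniform_measureI)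
  interpret prob_space P using law by (simp add: law_assm_def)
  \<comment> \<open>\<open>measure\<close> assigns zero to sets that are not measurable, so a set of
    measure one is measurable. This applies to \<open>Omega_star\<close>; the same argument with
    positive measure serves the conditioning event.\<close>
  have full: "AE \<omega> in P. \<omega> \<in> A" if "measure P A = 1" for A
  proof -
    have "A \<in> sets P" using that measure_notin_sets[of A P] by fastforce
    then show ?thesis using that by (subst AE_in_set_eq_1)
  qed
  have "measure P {\<omega> \<in> space P. 0 \<in> Cinf \<omega>} > 0" "measure P Omega_star = 1"
    using law by (auto simp: law_assm_def)
  then show "{\<omega> \<in> space P. 0 \<in> Cinf \<omega>} \<in> sets P"
    using measure_notin_sets[of "{\<omega> \<in> space P. 0 \<in> Cinf \<omega>}" P] by fastforce
  have "AE \<omega> in P. \<omega> \<in> Omega_star" "AE \<omega> in P. \<omega> \<in> Oreg" "AE \<omega> in P. \<omega> \<in> Oc"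
    using full O \<open>measure P Omega_star = 1\<close> by auto
  then show "AE \<omega> in P. \<omega> \<in> {\<omega> \<in> space P. 0 \<in> Cinf \<omega>} \<longrightarrow> Q \<omega>"
    by eventually_elim (use Q in \<open>auto simp: Omega_star0_def\<close>)
qed

text \<open>The radius \<open>r\<close> may be below one, while the heat kernel bound is stated for
  radii at least one. The scales \<open>v0\<close> at \<open>r\<close> and \<open>v\<close> at
  \<open>max 1 r\<close> differ only in the power of the radius, and
  \<open>v \<le> max v0 1\<close>; hence the times \<open>H\<close> and \<open>H0\<close> differ by
  a factor of at most \<open>4\<close>.\<close>

lemma environment_scales:
  assumes cl: "cluster_assm P \<theta> \<delta> Cd CV Criso CW Oreg N1"
    and av: "averages_bounded P p q ord Oreg Oc mubar nubar N2"
    and hk: "heat_kernel_bound Oreg Oc N1 N2 \<kappa> CHK c1 c2 c3 c4"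
    and pos: "0 < \<kappa>" "0 < CHK" "0 < c1" "0 < c2" and r: "0 < r"
    and \<omega>: "\<omega> \<in> space P" "\<omega> \<in> Oreg \<inter> Omega_star0 \<inter> Oc (max 1 r)"
    and n: "N3 \<kappa> N1 N2 r \<omega> \<le> ereal (real n)"
  obtains H H0 where "percolation_env \<omega> H CHK c1 c2" "1 \<le> H0" "H \<le> 4 * H0" "H \<le> 4 * (real n)\<^sup>2"
    "NHK \<kappa> N1 N2 r \<omega> = ereal H0" "1 \<le> n" "N1 \<omega> \<le> ereal (real n)" "N2 (max 1 r) \<omega> \<le> ereal (real n)"
proof -
  have "0 \<le> N1 \<omega>" "N1 \<omega> < \<infinity>"
    using cl \<omega> by (auto simp: cluster_assm_def)
  then obtain a where a: "N1 \<omega> = ereal a" "0 \<le> a" by (cases "N1 \<omega>") auto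
  have "\<bar>N2 (max 1 r) \<omega>\<bar> \<noteq> \<infinity>"
    using av \<omega> unfolding averages_bounded_def by auto
  then obtain b where b: "N2 (max 1 r) \<omega> = ereal b" by (cases "N2 (max 1 r) \<omega>") auto
  define v0 where "v0 = max (max a b) (r powr \<kappa>)"
  define v where "v = max (max a b) (max 1 r powr \<kappa>)"
  define H0 where "H0 = max (4 * v0\<^sup>2) 1"
  define H where "H = max (4 * v\<^sup>2) 1"
  have b': "N2 (max 1 (max 1 r)) \<omega> = ereal b" using b by simp
  have v0n: "v0 \<le> real n" using n N3_NHK_ereal(1)[of N1 \<omega> a N2 r b \<kappa>] a b by (simp add: v0_def)
  \<comment> \<open>Positivity of this term makes \<open>v0\<close>, and hence \<open>n\<close>,
    positive; it excludes the degenerate scale \<open>n = 0\<close>.\<close>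
  have "0 < r powr \<kappa>" using r by simp
  then have n1: "1 \<le> n" using v0n by (cases n) (auto simp: v0_def)
  have v: "0 \<le> v" "v \<le> max v0 1"
    using a(2) by (auto simp: v_def v0_def max_def)
  have "percolation_env \<omega> H CHK c1 c2"
    by (rule percolation_envI[OF \<omega>(2) _ hk pos(2-4)])
       (simp_all add: N3_NHK_ereal[of N1 \<omega> a N2 "max 1 r" b, OF a(1) b'] H_def v_def del: ereal_max)
  moreover have v2: "v\<^sup>2 \<le> max (v0\<^sup>2) 1"
    using power_mono[OF v(2,1), of 2] by (cases "v0 \<le> 1") (auto simp: max_def)
  then have "H \<le> 4 * H0" by (auto simp: H_def H0_def)
  moreover have "H \<le> 4 * (real n)\<^sup>2"
  proof -
    have "v \<le> real n" using v(2) v0n n1 by simp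
    then have "v\<^sup>2 \<le> (real n)\<^sup>2" using v(1) by (rule power_mono)
    moreover have "1 \<le> (real n)\<^sup>2" using n1 by simp
    ultimately show ?thesis by (simp add: H_def)
  qed
  moreover have "NHK \<kappa> N1 N2 r \<omega> = ereal H0"
    unfolding H0_def v0_def by (rule N3_NHK_ereal(2)[of N1 \<omega> a N2 r b \<kappa>, OF a(1) b])
  moreover have "N1 \<omega> \<le> ereal (real n)" "N2 (max 1 r) \<omega> \<le> ereal (real n)"
    using v0n a b by (auto simp: v0_def)
  moreover have "1 \<le> H0" by (simp add: H0_def)
  ultimately show ?thesis using n1 by (intro that)
qed

theorem corollary1p14:
  fixes \<theta> rD \<delta> Cd CV Criso CW \<kappa> CHK c1 c2 c3 c4 :: real
    and p q :: ereal
    and mubar nubar :: "real \<Rightarrow> real"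
  assumes dim: "CARD('d::finite) \<ge> 2"
    and theta: "0 < \<theta>" "\<theta> < 1"
    and pq: "1 \<le> p" "1 \<le> q"
    and rD: "0 < rD"
    and delta: "0 < \<delta>" "\<delta> < 1"
    and Cd: "1 \<le> Cd"
    and CV: "0 < CV" "CV \<le> 1"
    and Criso: "0 < Criso"
    and CW: "1 \<le> CW"
    and bars: "\<forall>R\<ge>1. 0 < mubar R \<and> 0 < nubar R"
    and HK_consts: "0 < \<kappa>" "0 < CHK" "0 < c1" "0 < c2" "0 < c3" "0 < c4"
  shows "\<exists>C3 C4 :: real.
    \<forall>(P :: 'd env measure) (D :: (real ^ 'd) set) ord Oreg N1 Oc N2.
      bounded D \<longrightarrow> (\<forall>n\<ge>1. dilate n D \<subseteq> cube (rD * real n)) \<longrightarrow>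
      law_assm P \<longrightarrow>
      cluster_assm P \<theta> \<delta> Cd CV Criso CW Oreg N1 \<longrightarrow>
      moments_assm P \<theta> p q \<longrightarrow>
      linear_order_on UNIV ord \<longrightarrow>
      averages_bounded P p q ord Oreg Oc mubar nubar N2 \<longrightarrow>
      heat_kernel_bound Oreg Oc N1 N2 \<kappa> CHK c1 c2 c3 c4 \<longrightarrow>
      (AE \<omega> in uniform_measure P {\<omega> \<in> space P. 0 \<in> Cinf \<omega>}.
        \<forall>n::nat. N3 \<kappa> N1 N2 (Cd * rD) \<omega> \<le> ereal (real n) \<longrightarrow>
          (\<forall>x\<in>D. \<forall>y\<in>D. x \<noteq> y \<longrightarrow>
            (CARD('d) = 2 \<longrightarrow>
              ereal (real n ^ (CARD('d) - 2)) *
                enn2ereal (green \<omega> (dilate n D) (floor_vec (real n *\<^sub>R x)) (floor_vec (real n *\<^sub>R y)))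
              \<le> ereal (2 * CHK * ln (1 / norm (x - y))) + ereal C3 * NHK \<kappa> N1 N2 (Cd * rD) \<omega>) \<and>
            (CARD('d) \<ge> 3 \<longrightarrow>
              ereal (real n ^ (CARD('d) - 2)) *
                enn2ereal (green \<omega> (dilate n D) (floor_vec (real n *\<^sub>R x)) (floor_vec (real n *\<^sub>R y)))
              \<le> ereal C4 * NHK \<kappa> N1 N2 (Cd * rD) \<omega> ^ (CARD('d) - 1)
                  / ereal (norm (x - y) ^ (CARD('d) - 2)))) \<and>
          (CARD('d) \<ge> 3 \<longrightarrow> (\<forall>x\<in>D. \<forall>y\<in>D.
              ereal (real n ^ (CARD('d) - 2)) *
                enn2ereal (green \<omega> (range emb) (floor_vec (real n *\<^sub>R x)) (floor_vec (real n *\<^sub>R y)))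
              \<le> ereal C4 * NHK \<kappa> N1 N2 (Cd * rD) \<omega> ^ (CARD('d) - 1)
                  / ereal (norm (x - y) ^ (CARD('d) - 2)))))"
proof -
  define R where "R = max 1 (Cd * rD)"
  \<comment> \<open>Used twice: as the linear bound on distances inside the domain, and as the
    radius of a ball about the origin containing it. The second use is legitimate because the origin
    is itself a cluster point of the cube.\<close>
  define k where "k = nat \<lceil>2 * Cd * rD\<rceil> + nat \<lceil>max 1 rD\<rceil>"
  define M0 where "M0 = max (mubar R) (mubar R powr real_of_ereal p) * (9 * (real k)\<^sup>2)"
  define C3 where "C3 = planar_green_const CHK c1 c2 M0 (real k) rD"
  define C4 where "C4 = transient_const CARD('d) CHK c1 c2 * 4 ^ (CARD('d) - 1) * (1 + real CARD('d)) ^ (CARD('d) - 2)"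
  have R: "1 \<le> R" by (simp add: R_def)
  have k: "1 \<le> k" unfolding k_def by linarith
  have CrD: "0 < Cd * rD" using Cd rD by simp
  have M0: "0 \<le> M0" using bars R by (simp add: M0_def le_max_iff_disj less_imp_le)
  show ?thesis
  proof (rule exI[of _ C3], rule exI[of _ C4], intro allI impI)
    fix P :: "'d env measure" and D :: "(real ^ 'd) set" and ord Oreg N1 Oc N2
    assume D: "\<forall>n\<ge>1. dilate n D \<subseteq> cube (rD * real n)"
      and law: "law_assm P" and cl: "cluster_assm P \<theta> \<delta> Cd CV Criso CW Oreg N1"
      and ord: "linear_order_on UNIV ord"
      and av: "averages_bounded P p q ord Oreg Oc mubar nubar N2"
      and hk: "heat_kernel_bound Oreg Oc N1 N2 \<kappa> CHK c1 c2 c3 c4"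
    have O: "Oreg \<in> sets P" "measure P Oreg = 1" "Oc R \<in> sets P" "measure P (Oc R) = 1"
      using cl av R by (auto simp: cluster_assm_def averages_bounded_def)
    let ?g = "\<lambda>\<omega> n \<Lambda> x y. ereal (real n ^ (CARD('d) - 2)) *
      enn2ereal (green \<omega> \<Lambda> (floor_vec (real n *\<^sub>R x)) (floor_vec (real n *\<^sub>R y)))"
    let ?NHK = "NHK \<kappa> N1 N2 (Cd * rD)"
    let ?B2 = "\<lambda>\<omega> x y :: real ^ 'd. ereal (2 * CHK * ln (1 / norm (x - y))) + ereal C3 * ?NHK \<omega>"
    let ?B3 = "\<lambda>\<omega> x y :: real ^ 'd. ereal C4 * ?NHK \<omega> ^ (CARD('d) - 1) / ereal (norm (x - y) ^ (CARD('d) - 2))"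
    show "AE \<omega> in uniform_measure P {\<omega> \<in> space P. 0 \<in> Cinf \<omega>}.
      \<forall>n. N3 \<kappa> N1 N2 (Cd * rD) \<omega> \<le> ereal (real n) \<longrightarrow>
        (\<forall>x\<in>D. \<forall>y\<in>D. x \<noteq> y \<longrightarrow>
          (CARD('d) = 2 \<longrightarrow> ?g \<omega> n (dilate n D) x y \<le> ?B2 \<omega> x y) \<and>
          (CARD('d) \<ge> 3 \<longrightarrow> ?g \<omega> n (dilate n D) x y \<le> ?B3 \<omega> x y)) \<and>
        (CARD('d) \<ge> 3 \<longrightarrow> (\<forall>x\<in>D. \<forall>y\<in>D. ?g \<omega> n (range emb) x y \<le> ?B3 \<omega> x y))"
    proof (rule AE_good_environment[OF law O], intro allI impI)
      fix \<omega> n assume \<omega>: "\<omega> \<in> space P" "\<omega> \<in> Oreg \<inter> Omega_star0 \<inter> Oc R"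
        and n: "N3 \<kappa> N1 N2 (Cd * rD) \<omega> \<le> ereal (real n)"
      obtain H H0 where env: "percolation_env \<omega> H CHK c1 c2" and H0: "1 \<le> H0" "H \<le> 4 * H0"
        and Hn: "H \<le> 4 * (real n)\<^sup>2" and NHK: "?NHK \<omega> = ereal H0"
        and n1: "1 \<le> n" and N1n: "N1 \<omega> \<le> ereal (real n)" and N2n: "N2 R \<omega> \<le> ereal (real n)"
        using environment_scales[OF cl av hk HK_consts(1-4) CrD \<omega>(1) _ n] \<omega>(2) unfolding R_def by blast
      have Dn: "dilate n D \<subseteq> cube (rD * real n)" using D n1 by blast
      have \<omega>': "\<omega> \<in> Oreg \<inter> Omega_star0" using \<omega>(2) by blast
      then have zero: "0 \<in> Cinf \<omega>" "emb (0 :: int ^ 'd) \<in> cube (rD * real n)"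
        using rD by (auto simp: Omega_star0_def cube_def emb_def)
      have gd: "real (gdist \<omega> z w) \<le> real k * real n"
        if "z \<in> Cinf \<omega>" "w \<in> Cinf \<omega>" "emb z \<in> cube (rD * real n)" "emb w \<in> cube (rD * real n)" for z w
        unfolding k_def by (rule gdist_cluster_le[OF cl \<omega>' n1 N1n delta(1) Cd rD that(1,3,2,4)])
      \<comment> \<open>Stated for every \<open>\<Lambda>\<close> and all pairs, including equal
        ones, so that it also settles the claim about \<open>range emb\<close>, where the walk is
        never killed.\<close>
      have transient: "?g \<omega> n \<Lambda> x y \<le> ?B3 \<omega> x y" if "CARD('d) \<ge> 3" for \<Lambda> x y
        unfolding NHK C4_def by (rule green_transient[OF env that H0])
      moreover have "?g \<omega> n (dilate n D) x y \<le> ?B2 \<omega> x y"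
        if d: "CARD('d) = 2" and x: "x \<in> D" and y: "y \<in> D" and xy: "x \<noteq> y" for x y
      proof -
        have "(\<Sum>z | z \<in> Cinf \<omega> \<and> emb z \<in> dilate n D. speed \<omega> z) \<le> M0 * (real n)\<^sup>2"
          unfolding M0_def
        proof (rule sum_speed_le[OF d av \<omega>(2) R ord n1 N2n pq(1) _ k])
          show "0 < mubar R" using bars R by blast
          fix z assume z: "z \<in> Cinf \<omega>" "emb z \<in> dilate n D"
          then have "emb z \<in> cube (rD * real n)" using Dn by blast
          from gd[OF zero(1) z(1) zero(2) this] show "gdist \<omega> 0 z \<le> k * n"
            by (simp flip: of_nat_mult)
        qed
        then show ?thesis
          unfolding NHK C3_def by (intro green_planar[OF env d H0 Hn n1 rD Dn x y xy M0]) (use gd in auto)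
      qed
      ultimately show "(\<forall>x\<in>D. \<forall>y\<in>D. x \<noteq> y \<longrightarrow>
          (CARD('d) = 2 \<longrightarrow> ?g \<omega> n (dilate n D) x y \<le> ?B2 \<omega> x y) \<and>
          (CARD('d) \<ge> 3 \<longrightarrow> ?g \<omega> n (dilate n D) x y \<le> ?B3 \<omega> x y)) \<and>
        (CARD('d) \<ge> 3 \<longrightarrow> (\<forall>x\<in>D. \<forall>y\<in>D. ?g \<omega> n (range emb) x y \<le> ?B3 \<omega> x y))"
        by blast
    qed
  qed
qed

end
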